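(* Let $p_1$ and $p_2$ be two probability densities on $\mathbb{R}^d$ with $p_2=\pi_0p_1$, let $X_1\sim p_1$ and $X_2\sim p_2$, and assume that $\mathbb{E}[|\nabla\pi_0(X_1)|]<\infty$. 1. Assume that $p_1$ is $k$-strongly log-concave. Then $$d_{\mathcal{W}}(X_1,X_2)\le\frac1k\,\mathbb{E}\left[|\nabla\pi_0(X_1)|\right].$$ 2. Assume that $p_1$ admits a Poincaré constant $C_p$ and $\pi_0\in W_{1,2}(p_1)$. Then $$d_{\mathcal{W}}(X_1,X_2)\le C_p\sqrt{\mathbb{E}\left[|\nabla\pi_0(X_1)|^2\right]}.$$
   Context: Standing assumption on all densities $p$ considered: with $K_p$ the support of $p$ (the complement of the largest open set on which $p\equiv0$), there is an open set $\Omega_p$ such that $K_p\setminus\Omega_p$ is Lebesgue-null, $p>0$ on $\Omega_p$ and $p$ is $\mathcal{C}^1$ on $\Omega_p$. $|\cdot|$ is the Euclidean norm. The 1-Wasserstein distance is $d_{\mathcal{W}}(X_1,X_2)=\sup_h|\mathbb{E}[h(X_1)]-\mathbb{E}[h(X_2)]|$, the supremum being over all Lipschitz $h:\mathbb{R}^d\to\mathbb{R}$ with Lipschitz constant at most $1$. A smooth density $p$ is $k$-strongly log-concave, for some $k>0$, if $\langle y-x,\nabla\log p(y)-\nabla\log p(x)\rangle\le-k|y-x|^2$ for all $x,y\in\mathbb{R}^d$. $C_p$ is a Poincaré constant associated to $p$ if, for $X\sim p$ and every differentiable $\varphi\in L^2(p)$ with $\mathbb{E}[\varphi(X)]=0$,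 one has $\mathbb{E}[\varphi(X)^2]\le C_p\,\mathbb{E}[|\nabla\varphi(X)|^2]$. $W_{1,2}(p)$ is the weighted Sobolev space of $p$: the Hilbert space of functions admitting a gradient, with scalar product $\int(fg+\langle\nabla f,\nabla g\rangle)\,p$, obtained from $\mathcal{C}_c^\infty(\mathbb{R}^d)$ by completion (this construction is understood with the Dirichlet form $\int\langle\nabla f,\nabla g\rangle p$ closable). *)

theory Defs
  imports "HOL-Probability.Probability"
begin

definition grad :: "('a::euclidean_space \<Rightarrow> real) \<Rightarrow> 'a \<Rightarrow> 'a" where
  "grad f x = (THE D. GDERIV f x :> D)"

(* Only used for open S. *)
fun Ck_on :: "nat \<Rightarrow> 'a::euclidean_space set \<Rightarrow> ('a \<Rightarrow> real) \<Rightarrow> bool" where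
  "Ck_on 0 S f \<longleftrightarrow> continuous_on S f"
| "Ck_on (Suc k) S f \<longleftrightarrow>
     (\<forall>x\<in>S. f differentiable (at x)) \<and> (\<forall>b\<in>Basis. Ck_on k S (\<lambda>x. grad f x \<bullet> b))"

definition test_functions :: "'a::euclidean_space set \<Rightarrow> ('a \<Rightarrow> real) set" where
  "test_functions S =
     {\<phi>. (\<forall>k. Ck_on k UNIV \<phi>) \<and> compact (closure {x. \<phi> x \<noteq> 0}) \<and> closure {x. \<phi> x \<noteq> 0} \<subseteq> S}"


definition density_support :: "('a::euclidean_space \<Rightarrow> real) \<Rightarrow> 'a set" where
  "density_support p = - \<Union>{U. open U \<and> (\<forall>x\<in>U. p x = 0)}"

definition admissible_density :: "('a::euclidean_space \<Rightarrow> real) \<Rightarrow> bool" where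
  "admissible_density p \<longleftrightarrow>
     p \<in> borel_measurable borel \<and> (\<forall>x. 0 \<le> p x) \<and> (\<integral>\<^sup>+x. ennreal (p x) \<partial>lborel) = 1 \<and>
     (\<exists>\<Omega>. open \<Omega> \<and> density_support p - \<Omega> \<in> null_sets lborel \<and> (\<forall>x\<in>\<Omega>. 0 < p x) \<and> Ck_on 1 \<Omega> p)"

(* The open set in admissible_density is not unique: deleting a closed null set gives another one.
   The gradient of the ratio p2 / p1 refers to the largest choice for p1, since a weak gradient on a smaller set would not
   see a jump of the function across the deleted set. *)
definition Omega :: "('a::euclidean_space \<Rightarrow> real) \<Rightarrow> 'a set" where
  "Omega p = \<Union>{U. open U \<and> (\<forall>x\<in>U. 0 < p x) \<and> Ck_on 1 U p}"

definition law :: "('a::euclidean_space \<Rightarrow> real) \<Rightarrow> 'a measure" where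
  "law p = density lborel (\<lambda>x. ennreal (p x))"


definition has_weak_gradient_on ::
    "('a::euclidean_space \<Rightarrow> real) \<Rightarrow> ('a \<Rightarrow> 'a) \<Rightarrow> 'a set \<Rightarrow> bool" where
  "has_weak_gradient_on f G S \<longleftrightarrow>
     (\<forall>K. compact K \<and> K \<subseteq> S \<longrightarrow> set_integrable lborel K f \<and> set_integrable lborel K G) \<and>
     (\<forall>\<phi>\<in>test_functions S.
        (\<integral>x. f x *\<^sub>R grad \<phi> x \<partial>lborel) = - (\<integral>x. \<phi> x *\<^sub>R G x \<partial>lborel))"

(* An element of the completion of the test functions in the norm of W_{1,2}(p) is a pair (f, g) of
   L2(p) limits of phi_n and grad phi_n. On Omega p, where p is locally bounded below, g is the weak
   gradient of f; for an admissible density the form is therefore closable, and the completion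
   embeds into L2(p) via the first component. *)
definition W12 :: "('a::euclidean_space \<Rightarrow> real) \<Rightarrow> ('a \<Rightarrow> real) set" where
  "W12 p = {f \<in> borel_measurable borel. \<exists>\<phi>. \<exists>g \<in> borel_measurable borel.
     (\<forall>n. \<phi> n \<in> test_functions UNIV) \<and>
     (\<lambda>n::nat. \<integral>\<^sup>+x. ennreal ((\<phi> n x - f x)\<^sup>2) \<partial>law p) \<longlonglongrightarrow> 0 \<and>
     (\<lambda>n. \<integral>\<^sup>+x. ennreal ((norm (grad (\<phi> n) x - g x))\<^sup>2) \<partial>law p) \<longlonglongrightarrow> 0}"


(* Only C1 smoothness is required, which is what the inequality needs to make sense. *)
definition strongly_log_concave :: "real \<Rightarrow> ('a::euclidean_space \<Rightarrow> real) \<Rightarrow> bool" where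
  "strongly_log_concave k p \<longleftrightarrow>
     (\<forall>x. 0 < p x) \<and> Ck_on 1 UNIV p \<and>
     (\<forall>x y. (y - x) \<bullet> (grad (\<lambda>z. ln (p z)) y - grad (\<lambda>z. ln (p z)) x) \<le> - k * (norm (y - x))\<^sup>2)"

lemma strongly_log_concave_Omega: "strongly_log_concave k p \<Longrightarrow> Omega p = UNIV"
  unfolding strongly_log_concave_def Omega_def by blast

(* The right-hand side may be infinite, in which case there is no condition on phi. *)
definition poincare_constant :: "real \<Rightarrow> ('a::euclidean_space \<Rightarrow> real) \<Rightarrow> bool" where
  "poincare_constant C p \<longleftrightarrow>
     (\<forall>\<phi>. (\<forall>x. \<phi> differentiable (at x)) \<and> integrable (law p) (\<lambda>x. (\<phi> x)\<^sup>2) \<and> (\<integral>x. \<phi> x \<partial>law p) = 0 \<longrightarrow>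
        (\<integral>\<^sup>+x. ennreal ((\<phi> x)\<^sup>2) \<partial>law p) \<le> ennreal C * (\<integral>\<^sup>+x. ennreal ((norm (grad \<phi> x))\<^sup>2) \<partial>law p))"

(* A test function h without finite expectations makes the distance infinite; the Bochner integral,
   which is 0 on non-integrable functions, would silently drop it from the supremum. *)
definition wasserstein1 ::
    "'s measure \<Rightarrow> ('s \<Rightarrow> 'a::euclidean_space) \<Rightarrow> 't measure \<Rightarrow> ('t \<Rightarrow> 'a) \<Rightarrow> ennreal" where
  "wasserstein1 M X N Y =
     (SUP h \<in> {h :: 'a \<Rightarrow> real. 1-lipschitz_on UNIV h}.
        if integrable M (\<lambda>\<omega>. h (X \<omega>)) \<and> integrable N (\<lambda>\<omega>. h (Y \<omega>))
        then ennreal \<bar>(\<integral>\<omega>. h (X \<omega>) \<partial>M) - (\<integral>\<omega>. h (Y \<omega>) \<partial>N)\<bar>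
        else \<infinity>)"

end

theory Submission
  imports Defs
begin

text \<open>
  Part 1 avoids solving a Stein equation. Let \<open>b = grad (ln p1)\<close>, let \<open>F\<close> be \<open>(\<pi>0 - 1) * p1\<close> (mollified, cut off
  and recentred to integral 0), and let \<open>S\<close> be the supremum of \<open>\<integral> h F\<close> over 1-Lipschitz \<open>h\<close>.
  One step of length \<open>\<eta>\<close> of a random walk with drift \<open>b\<close> defines a Markov operator \<open>P\<close>.
  Strong log-concavity makes \<open>P\<close> contract Lipschitz constants by \<open>1 - k \<eta> + O(\<eta>\<^sup>2)\<close>, while
  \<open>\<integral> (h - P h) F \<le> \<eta> \<integral> |grad F - F b| + o(\<eta>)\<close> uniformly in \<open>h\<close>. Hence
  \<open>S \<le> \<eta> \<integral> |grad F - F b| + o(\<eta>) + (1 - k \<eta>) S\<close>, that is, \<open>k S \<le> \<integral> |grad F - F b|\<close>, and the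
  integrand is \<open>p1 |grad \<pi>0|\<close>.

  Part 2 follows from the Cauchy-Schwarz inequality for
  \<open>E h(X2) - E h(X1) = \<integral> (h - m) (\<pi>0 - 1) p1\<close>, where \<open>m = E h(X1)\<close>, and the Poincare inequality for \<open>h\<close> and for
  \<open>\<pi>0\<close>, each factor contributing \<open>sqrt C\<close>. The Poincare inequality is applied to mollifications of \<open>h\<close> and to
  test functions approximating \<open>\<pi>0\<close>.
\<close>

section \<open>Gradients and smooth bump functions\<close>

text \<open>To first order in \<eta>, the walk with step length
  \<open>sqrt (2 * DIM('a) * \<eta>)\<close> and drift \<open>b\<close> has as generator the
  Laplacian plus \<open>b \<bullet> grad\<close>, for which \<open>p1\<close> is stationary. For
  \<open>F = g * p1\<close> the product rule turns \<open>grad F - F b\<close> into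
  \<open>p1 * grad g\<close>, since \<open>b * p1 = grad p1\<close>. The supremum \<open>S\<close>
  can be absorbed only if it is finite; hence compact support and integral 0 for \<open>F\<close>.
  The second-order error of a step contains \<open>(norm (b x - b y))\<^sup>2\<close>, which
  monotonicity does not control, so \<open>b\<close> is first made locally Lipschitz by a
  mollification that keeps monotonicity. The approximations are removed in the order: drift,
  mollification of \<open>\<pi>0\<close>, cut-off, boundedness of \<open>h\<close>. The distance is
  infinite unless every Lipschitz \<open>h\<close> is integrable under both laws. The first moment
  of \<open>p1\<close> comes from log-concavity or from the Poincare inequality, that of
  \<open>p2\<close> from the estimate itself applied to truncated norms. In part 2 the L2 limit of
  the approximating gradients must also be identified with the given \<open>G\<close>; this happens
  on \<open>Omega p1\<close>, where \<open>p1\<close> is locally bounded below.\<close>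

lemma grad_eqI: "GDERIV f x :> D \<Longrightarrow> grad f x = D"
  unfolding grad_def
proof (rule the_equality)
  fix E assume "GDERIV f x :> D" "GDERIV f x :> E"
  then have "(\<lambda>h. h \<bullet> D) = (\<lambda>h. h \<bullet> E)"
    unfolding gderiv_def by (rule has_derivative_unique)
  then show "E = D"
    by (metis inner_commute vector_eq_rdot)
qed

text \<open>\<open>grad\<close> is a definite description, so a representing vector has to be
  exhibited: its coordinates are the values of the derivative on the basis.\<close>

lemma GDERIV_grad:
  fixes f :: "'a::euclidean_space \<Rightarrow> real"
  assumes "f differentiable (at x)"
  shows "GDERIV f x :> grad f x"
proof -
  obtain f' where f': "(f has_derivative f') (at x)"
    using assms by (auto simp: differentiable_def)
  then have lin: "linear f'" by (rule has_derivative_linear)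
  have "f' h = h \<bullet> (\<Sum>b\<in>Basis. f' b *\<^sub>R b)" for h
  proof -
    have "f' h = f' (\<Sum>b\<in>Basis. (h \<bullet> b) *\<^sub>R b)" by (simp add: euclidean_representation)
    also have "\<dots> = (\<Sum>b\<in>Basis. (h \<bullet> b) * f' b)"
      using lin by (simp add: linear_sum linear_cmul)
    finally show ?thesis by (simp add: inner_sum_right mult.commute)
  qed
  then have "GDERIV f x :> (\<Sum>b\<in>Basis. f' b *\<^sub>R b)"
    unfolding gderiv_def using f' by (metis (no_types, lifting) ext)
  then show ?thesis using grad_eqI by metis
qed

lemma GDERIV_imp_differentiable: "GDERIV f x :> D \<Longrightarrow> f differentiable (at x)"
  unfolding gderiv_def by (rule differentiableI)

lemma GDERIV_imp_continuous_on:
  assumes "\<And>x. GDERIV f x :> D x"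
  shows "continuous_on A f"
  using assms[THEN GDERIV_imp_differentiable]
  by (meson continuous_at_imp_continuous_on differentiable_imp_continuous_within)

lemma Ck_on_1_iff:
  "Ck_on 1 S f \<longleftrightarrow> (\<forall>x\<in>S. f differentiable (at x)) \<and> continuous_on S (grad f)"
  unfolding One_nat_def Ck_on.simps
  by (subst continuous_on_componentwise[of S "grad f"]) simp

text \<open>The later smoothness inductions bring each partial derivative into this form;
  coefficients \<open>0\<close>, \<open>1\<close> and \<open>-1\<close> cover scaling, sums and
  reflection.\<close>

lemma Ck_on_linear:
  fixes f g :: "'a::euclidean_space \<Rightarrow> real"
  assumes "Ck_on k UNIV f" "Ck_on k UNIV g"
  shows "Ck_on k UNIV (\<lambda>x. a * f x + c * g x)"
  using assms
proof (induction k arbitrary: f g)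
  case 0 then show ?case by (auto intro!: continuous_intros)
next
  case (Suc k)
  have G: "GDERIV (\<lambda>x. a * f x + c * g x) x :> a *\<^sub>R grad f x + c *\<^sub>R grad g x" for x
    using GDERIV_grad[of f x] GDERIV_grad[of g x] Suc.prems
      GDERIV_add[OF GDERIV_mult[OF GDERIV_const[of a]] GDERIV_mult[OF GDERIV_const[of c]]]
    by simp
  have "grad (\<lambda>x. a * f x + c * g x) x \<bullet> b = a * (grad f x \<bullet> b) + c * (grad g x \<bullet> b)" for x b
    using grad_eqI[OF G[of x]] by (simp add: inner_add_left)
  then show ?case
    using Suc G by (auto intro: GDERIV_imp_differentiable)
qed

lemma GDERIV_reflect:
  fixes f :: "'a::euclidean_space \<Rightarrow> real"
  assumes "GDERIV f (x - y) :> D"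
  shows "GDERIV (\<lambda>y. f (x - y)) y :> - D"
  using has_derivative_compose[of "\<lambda>y. x - y" "\<lambda>h. - h" y UNIV f "\<lambda>h. h \<bullet> D"] assms
  unfolding gderiv_def by (force intro!: derivative_eq_intros)

lemma Ck_on_reflect:
  fixes f :: "'a::euclidean_space \<Rightarrow> real"
  assumes "Ck_on k UNIV f"
  shows "Ck_on k UNIV (\<lambda>y. f (x - y))"
  using assms
proof (induction k arbitrary: f)
  case 0 then show ?case by (auto intro!: continuous_intros continuous_on_compose2[of UNIV f])
next
  case (Suc k)
  have G: "GDERIV (\<lambda>y. f (x - y)) y :> - grad f (x - y)" for y
    using GDERIV_reflect[OF GDERIV_grad[of f "x-y"]] Suc.prems by simp
  have eq: "grad (\<lambda>y. f (x - y)) y \<bullet> b = -1 * (grad f (x - y) \<bullet> b) + 0 * (grad f (x - y) \<bullet> b)" for y b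
    using grad_eqI[OF G[of y]] by simp
  have "Ck_on k UNIV (\<lambda>y. grad (\<lambda>y. f (x - y)) y \<bullet> b)" if "b \<in> Basis" for b
    unfolding eq using Suc that by (intro Ck_on_linear Suc.IH[of "\<lambda>z. grad f z \<bullet> b"]) auto
  then show ?case
    using G by (auto intro: GDERIV_imp_differentiable)
qed

section \<open>Flat exponential functions and smooth bumps on boxes\<close>

definition flat_exp :: "nat \<Rightarrow> real \<Rightarrow> real" where
  "flat_exp n t = (if t > 0 then exp (- 1 / t) / t ^ n else 0)"

lemma flat_exp_nonneg: "0 \<le> flat_exp n t"
  by (simp add: flat_exp_def)

text \<open>With \<open>x = inverse t\<close> this is the decay of \<open>x ^ n / exp x\<close> at
  infinity.\<close>

lemma flat_exp_tendsto_0: "(flat_exp n \<longlongrightarrow> 0) (at_right 0)"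
proof -
  have "((\<lambda>x. x ^ n / exp x) \<longlongrightarrow> 0) (at_top::real filter)"
    by (rule tendsto_power_div_exp_0)
  then have "((\<lambda>t. inverse t ^ n / exp (inverse t)) \<longlongrightarrow> 0) (at_right (0::real))"
    by (rule filterlim_compose) (rule filterlim_inverse_at_top_right)
  moreover have "\<forall>\<^sub>F t in at_right (0::real). inverse t ^ n / exp (inverse t) = flat_exp n t"
    by (auto simp: eventually_at_filter flat_exp_def field_simps exp_minus)
  ultimately show ?thesis
    by (rule Lim_transform_eventually)
qed

text \<open>Dividing by \<open>t ^ n\<close> closes the family under differentiation up to linear
  combinations, so every derivative is again flat at 0.\<close>

lemma flat_exp_deriv:
  "(flat_exp n has_real_derivative flat_exp (n + 2) t - n * flat_exp (n + 1) t) (at t)"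
proof (cases "t = 0")
  case False
  show ?thesis
  proof (cases "t > 0")
    case True
    have "((\<lambda>t. exp (- 1 / t) / t ^ n) has_real_derivative flat_exp (n + 2) t - n * flat_exp (n + 1) t) (at t)"
      using True
      \<comment> \<open>The case split on \<open>n\<close> resolves the truncated exponent
        \<open>n - 1\<close> in the derivative of \<open>t ^ n\<close>.\<close>
      by (auto intro!: derivative_eq_intros; cases n)
        (auto simp: flat_exp_def field_simps power2_eq_square)
    then show ?thesis
      by (rule has_field_derivative_transform_within_open[of _ _ _ "{0<..}"])
         (use True in \<open>auto simp: flat_exp_def\<close>)
  next
    case neg: False
    have "((\<lambda>t. 0) has_real_derivative flat_exp (n + 2) t - n * flat_exp (n + 1) t) (at t)"
      using neg by (auto simp: flat_exp_def)
    then show ?thesis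
      by (rule has_field_derivative_transform_within_open[of _ _ _ "{..<0}"])
         (use neg False in \<open>auto simp: flat_exp_def\<close>)
  qed
next
  case True
  \<comment> \<open>At 0 the right difference quotient is itself \<open>flat_exp (Suc n)\<close>,
    and the claimed derivative is 0 because \<open>flat_exp\<close> vanishes at 0.\<close>
  have "((\<lambda>h. flat_exp n h / h) \<longlongrightarrow> 0) (at_right 0)"
  proof (rule Lim_transform_eventually[OF flat_exp_tendsto_0[of "Suc n"]])
    show "\<forall>\<^sub>F h in at_right 0. flat_exp (Suc n) h = flat_exp n h / h"
      by (auto simp: eventually_at_filter flat_exp_def field_simps)
  qed
  moreover have "((\<lambda>h. flat_exp n h / h) \<longlongrightarrow> 0) (at_left 0)"
    by (rule Lim_transform_eventually[OF tendsto_const])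
       (auto simp: eventually_at_filter flat_exp_def)
  ultimately have "((\<lambda>h. flat_exp n h / h) \<longlongrightarrow> 0) (at 0)"
    by (simp add: filterlim_at_split)
  then show ?thesis
    using True by (auto simp: DERIV_def flat_exp_def)
qed

text \<open>The exponents \<open>m\<close>, \<open>k\<close> are there because partial derivatives of such products are linear
  combinations of products of the same form; smoothness of every order follows by induction.\<close>

definition box_bump ::
    "('a::euclidean_space \<Rightarrow> nat) \<Rightarrow> ('a \<Rightarrow> nat) \<Rightarrow> 'a \<Rightarrow> 'a \<Rightarrow> real \<Rightarrow> 'a \<Rightarrow> real" where
  "box_bump m k a c N x =
     (\<Prod>b\<in>Basis. flat_exp (m b) (N * (x \<bullet> b - a \<bullet> b)) * flat_exp (k b) (N * (c \<bullet> b - x \<bullet> b)))"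

lemma GDERIV_prod_coordinates:
  fixes \<beta> :: "'a::euclidean_space \<Rightarrow> real \<Rightarrow> real"
  assumes "\<And>b. b \<in> Basis \<Longrightarrow> (\<beta> b has_real_derivative \<beta>' b) (at (x \<bullet> b))"
  shows "GDERIV (\<lambda>x. \<Prod>b\<in>Basis. \<beta> b (x \<bullet> b)) x :>
           (\<Sum>b\<in>Basis. (\<beta>' b * (\<Prod>i\<in>Basis - {b}. \<beta> i (x \<bullet> i))) *\<^sub>R b)"
proof -
  have "((\<lambda>x. \<beta> b (x \<bullet> b)) has_derivative (\<lambda>h. (h \<bullet> b) * \<beta>' b)) (at x)" if "b \<in> Basis" for b
  proof -
    have "((\<lambda>x. x \<bullet> b) has_derivative (\<lambda>h. h \<bullet> b)) (at x)"
      by (auto intro!: derivative_eq_intros)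
    from has_derivative_compose[OF this assms[OF that, unfolded has_field_derivative_def]]
    show ?thesis
      unfolding has_field_derivative_def by (simp add: mult.commute)
  qed
  from has_derivative_prod[OF this]
  show ?thesis
    unfolding gderiv_def by (simp add: inner_sum_right mult_ac)
qed

lemma box_bump_GDERIV:
  fixes a c x :: "'a::euclidean_space"
  shows "GDERIV (box_bump m k a c N) x :> (\<Sum>b\<in>Basis.
    (N * (box_bump (m(b := m b + 2)) k a c N x - m b * box_bump (m(b := m b + 1)) k a c N x
     - box_bump m (k(b := k b + 2)) a c N x + k b * box_bump m (k(b := k b + 1)) a c N x)) *\<^sub>R b)"
proof -
  define \<beta> where "\<beta> m k b t = flat_exp m (N * (t - a \<bullet> b)) * flat_exp k (N * (c \<bullet> b - t))" for m k t and b :: 'a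
  define \<beta>' where "\<beta>' b = N * (\<beta> (m b + 2) (k b) b (x \<bullet> b) - m b * \<beta> (m b + 1) (k b) b (x \<bullet> b)
     - \<beta> (m b) (k b + 2) b (x \<bullet> b) + k b * \<beta> (m b) (k b + 1) b (x \<bullet> b))" for b
  have e1: "((\<lambda>t. flat_exp n (N * (t - q))) has_real_derivative
      N * (flat_exp (n + 2) (N * (t - q)) - n * flat_exp (n + 1) (N * (t - q)))) (at t)" for n q t
  proof -
    have "((\<lambda>t. N * (t - q)) has_real_derivative N) (at t)"
      by (auto intro!: derivative_eq_intros)
    from DERIV_chain2[OF flat_exp_deriv this] show ?thesis
      by (simp add: algebra_simps)
  qed
  have e2: "((\<lambda>t. flat_exp n (N * (q - t))) has_real_derivative
      - N * (flat_exp (n + 2) (N * (q - t)) - n * flat_exp (n + 1) (N * (q - t)))) (at t)" for n q t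
  proof -
    have "((\<lambda>t. N * (q - t)) has_real_derivative -N) (at t)"
      by (auto intro!: derivative_eq_intros)
    from DERIV_chain2[OF flat_exp_deriv this] show ?thesis
      by (simp add: algebra_simps)
  qed
  have d: "(\<beta> (m b) (k b) b has_real_derivative \<beta>' b) (at (x \<bullet> b))" for b
    unfolding \<beta>_def \<beta>'_def
    by (rule derivative_eq_intros e1 e2 refl)+ (simp add: algebra_simps)
  have eq: "\<beta>' b * (\<Prod>i\<in>Basis - {b}. \<beta> (m i) (k i) i (x \<bullet> i)) =
     N * (box_bump (m(b := m b + 2)) k a c N x - m b * box_bump (m(b := m b + 1)) k a c N x
     - box_bump m (k(b := k b + 2)) a c N x + k b * box_bump m (k(b := k b + 1)) a c N x)"
    if "b \<in> Basis" for b
  proof -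
    \<comment> \<open>Split off the factor of coordinate \<open>b\<close>; changing an exponent at
      \<open>b\<close> leaves the remaining product alone (\<open>s1\<close> and
      \<open>s2\<close>).\<close>
    have r: "box_bump m' k' a c N x = \<beta> (m' b) (k' b) b (x \<bullet> b) * (\<Prod>i\<in>Basis - {b}. \<beta> (m' i) (k' i) i (x \<bullet> i))" for m' k'
      unfolding box_bump_def \<beta>_def by (rule prod.remove) (use that in auto)
    have s1: "(\<Prod>i\<in>Basis - {b}. \<beta> ((m(b := n)) i) (k i) i (x \<bullet> i)) = (\<Prod>i\<in>Basis - {b}. \<beta> (m i) (k i) i (x \<bullet> i))" for n
      by (rule prod.cong) auto
    have s2: "(\<Prod>i\<in>Basis - {b}. \<beta> (m i) ((k(b := n)) i) i (x \<bullet> i)) = (\<Prod>i\<in>Basis - {b}. \<beta> (m i) (k i) i (x \<bullet> i))" for n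
      by (rule prod.cong) auto
    show ?thesis
      unfolding r s1 s2 \<beta>'_def by (simp add: algebra_simps)
  qed
  have "box_bump m k a c N = (\<lambda>x. \<Prod>b\<in>Basis. \<beta> (m b) (k b) b (x \<bullet> b))"
    by (simp add: box_bump_def \<beta>_def fun_eq_iff)
  then show ?thesis
    using GDERIV_prod_coordinates[of "\<lambda>b. \<beta> (m b) (k b) b" \<beta>' x, OF d]
    by (simp add: eq cong: sum.cong)
qed

lemma box_bump_Ck: "Ck_on j UNIV (box_bump m k a c N)"
proof (induction j arbitrary: m k)
  case 0
  show ?case
    using box_bump_GDERIV[THEN GDERIV_imp_differentiable, THEN differentiable_imp_continuous_within]
    by (auto simp: continuous_on_eq_continuous_within)
next
  case (Suc j)
  have eq: "(\<lambda>x. grad (box_bump m k a c N) x \<bullet> b) =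
    (\<lambda>x. 1 * (N * box_bump (m(b := m b + 2)) k a c N x + (- N * m b) * box_bump (m(b := m b + 1)) k a c N x)
     + 1 * ((- N) * box_bump m (k(b := k b + 2)) a c N x + (N * k b) * box_bump m (k(b := k b + 1)) a c N x))"
    if "b \<in> Basis" for b
    using that by (simp add: fun_eq_iff grad_eqI[OF box_bump_GDERIV]) (simp add: algebra_simps)
  have "Ck_on j UNIV (\<lambda>x. grad (box_bump m k a c N) x \<bullet> b)" if "b \<in> Basis" for b
    unfolding eq[OF that] by (intro Ck_on_linear Suc.IH)
  then show ?case
    using box_bump_GDERIV[THEN GDERIV_imp_differentiable] by auto
qed

lemma box_bump_nonneg: "0 \<le> box_bump m k a c N x"
  by (auto simp: box_bump_def intro!: prod_nonneg mult_nonneg_nonneg flat_exp_nonneg)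

lemma box_bump_nonzero_iff:
  assumes "N > 0"
  shows "box_bump m k a c N x \<noteq> 0 \<longleftrightarrow> x \<in> box a c"
  using assms by (auto simp: box_bump_def flat_exp_def mem_box zero_less_mult_iff split: if_splits)

lemma box_bump_test_function:
  assumes "N > 0" "cbox a c \<subseteq> S"
  shows "box_bump m k a c N \<in> test_functions S"
proof -
  have "{x. box_bump m k a c N x \<noteq> 0} = box a c"
    using box_bump_nonzero_iff[OF assms(1), of m k a c] by blast
  moreover have "closure (box a c) \<subseteq> cbox a c"
    by (rule closure_minimal[OF box_subset_cbox closed_cbox])
  ultimately show ?thesis
    using assms(2) box_bump_Ck unfolding test_functions_def
    by (auto intro: bounded_subset)
qed

section \<open>Test functions and mollification\<close>

lemma onorm_inner_le:
  fixes D :: "'a::euclidean_space"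
  shows "onorm (\<lambda>h. h \<bullet> D) \<le> norm D"
proof (rule onorm_bound)
  show "norm (x \<bullet> D) \<le> norm D * norm x" for x
    using Cauchy_Schwarz_ineq2[of x D] by (simp add: mult.commute)
qed simp

lemma GDERIV_lipschitz_bound:
  fixes f :: "'a::euclidean_space \<Rightarrow> real"
  assumes "\<And>x. GDERIV f x :> D x" "\<And>x. norm (D x) \<le> B"
  shows "\<bar>f x - f y\<bar> \<le> B * norm (x - y)"
proof -
  have "norm (f x - f y) \<le> B * norm (x - y)"
  proof (rule differentiable_bound[of UNIV f "\<lambda>x h. h \<bullet> D x"])
    show "(f has_derivative (\<lambda>h. h \<bullet> D x)) (at x within UNIV)" for x
      using assms(1)[of x] by (simp add: gderiv_def)
    show "onorm (\<lambda>h. h \<bullet> D x) \<le> B" for x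
      using onorm_inner_le[of "D x"] assms(2)[of x] by linarith
  qed auto
  then show ?thesis by simp
qed

lemma GDERIV_linear_remainder:
  fixes f :: "'a::euclidean_space \<Rightarrow> real"
  assumes "\<And>x. GDERIV f x :> D x" "\<And>z. z \<in> closed_segment x (x + v) \<Longrightarrow> norm (D z - D x) \<le> B"
  shows "\<bar>f (x + v) - f x - v \<bullet> D x\<bar> \<le> B * norm v"
proof -
  have "norm (f (x + v) - f x - (\<lambda>h. h \<bullet> D x) ((x + v) - x)) \<le> norm ((x + v) - x) * B"
  proof (rule differentiable_bound_linearization[of _ _ "closed_segment x (x + v)" f "\<lambda>z h. h \<bullet> D z"])
    show "x + t *\<^sub>R (x + v - x) \<in> closed_segment x (x + v)" if "t \<in> {0..1}" for t
      using that by (auto simp: closed_segment_def algebra_simps intro!: exI[of _ t])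
    show "(f has_derivative (\<lambda>h. h \<bullet> D z)) (at z within closed_segment x (x + v))" for z
      using assms(1)[of z] has_derivative_at_withinI by (auto simp: gderiv_def)
    show "onorm ((\<lambda>h. h \<bullet> D z) - (\<lambda>h. h \<bullet> D x)) \<le> B" if "z \<in> closed_segment x (x + v)" for z
    proof -
      have "(\<lambda>h. h \<bullet> D z) - (\<lambda>h. h \<bullet> D x) = (\<lambda>h. h \<bullet> (D z - D x))"
        by (simp add: fun_eq_iff inner_diff_right)
      then show ?thesis
        using onorm_inner_le[of "D z - D x"] assms(2)[OF that] by simp
    qed
  qed auto
  then show ?thesis by (simp add: mult.commute)
qed

lemma GDERIV_quadratic_remainder:
  fixes f :: "'a::euclidean_space \<Rightarrow> real"
  assumes "\<And>x. GDERIV f x :> D x" "\<And>x y. norm (D x - D y) \<le> M * norm (x - y)"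
  shows "\<bar>f (x + v) - f x - v \<bullet> D x\<bar> \<le> M * (norm v)\<^sup>2"
proof -
  have M: "0 \<le> M"
  proof -
    obtain b :: 'a where "b \<in> Basis" using nonempty_Basis by blast
    then show ?thesis using order_trans[OF norm_ge_zero assms(2)[of b 0]] by simp
  qed
  have "\<bar>f (x + v) - f x - v \<bullet> D x\<bar> \<le> (M * norm v) * norm v"
  proof (rule GDERIV_linear_remainder[OF assms(1)])
    fix z assume "z \<in> closed_segment x (x + v)"
    then have "M * norm (z - x) \<le> M * norm v"
      using M segment_bound1 by (intro mult_left_mono) fastforce+
    then show "norm (D z - D x) \<le> M * norm v" using assms(2)[of z x] by linarith
  qed
  then show ?thesis by (simp add: power2_eq_square mult.assoc)
qed

section \<open>Calculus of test functions\<close>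

lemma test_functions_differentiable:
  "\<phi> \<in> test_functions S \<Longrightarrow> \<phi> differentiable (at x)"
  unfolding test_functions_def by (metis (mono_tags, lifting) Ck_on.simps(2) UNIV_I mem_Collect_eq)

lemma test_functions_GDERIV:
  "\<phi> \<in> test_functions S \<Longrightarrow> GDERIV \<phi> x :> grad \<phi> x"
  by (rule GDERIV_grad[OF test_functions_differentiable])

lemma test_functions_continuous: "\<phi> \<in> test_functions S \<Longrightarrow> continuous_on A \<phi>"
  unfolding test_functions_def
  by (metis (mono_tags, lifting) Ck_on.simps(1) continuous_on_subset mem_Collect_eq subset_UNIV)

lemma grad_eq_0_outside_support:
  fixes \<phi> :: "'a::euclidean_space \<Rightarrow> real"
  assumes "x \<notin> closure {x. \<phi> x \<noteq> 0}"
  shows "grad \<phi> x = 0"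
proof -
  have "((\<lambda>_. 0) has_derivative (\<lambda>h. h \<bullet> 0)) (at x)" by simp
  then have "(\<phi> has_derivative (\<lambda>h. h \<bullet> 0)) (at x)"
  proof (rule has_derivative_transform_within_open[of _ _ _ UNIV "- closure {x. \<phi> x \<noteq> 0}"])
    fix y assume "y \<in> - closure {x. \<phi> x \<noteq> 0}"
    then show "0 = \<phi> y" using closure_subset[of "{x. \<phi> x \<noteq> 0}"] by auto
  qed (use assms in auto)
  then show ?thesis by (intro grad_eqI) (simp add: gderiv_def)
qed

lemma GDERIV_eq_0_outside_cball:
  fixes F :: "'a::euclidean_space \<Rightarrow> real"
  assumes "\<And>x. GDERIV F x :> D x" "\<And>x. x \<notin> cball 0 R \<Longrightarrow> F x = 0" "x \<notin> cball 0 R"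
  shows "D x = 0"
proof -
  have "closure {x. F x \<noteq> 0} \<subseteq> cball 0 R" by (rule closure_minimal) (use assms(2) in fastforce)+
  then have "x \<notin> closure {x. F x \<noteq> 0}" using assms(3) by blast
  then show ?thesis
    using grad_eq_0_outside_support[of x F] grad_eqI[OF assms(1)[of x]] by simp
qed

text \<open>Through this, facts about test functions, such as continuity and the Lipschitz property,
  carry over to their gradients.\<close>

lemma grad_component_test_function:
  assumes "\<phi> \<in> test_functions S" "b \<in> Basis"
  shows "(\<lambda>x. grad \<phi> x \<bullet> b) \<in> test_functions S"
proof -
  have *: "closure {x. grad \<phi> x \<bullet> b \<noteq> 0} \<subseteq> closure {x. \<phi> x \<noteq> 0}"
  proof (rule closure_minimal)
    show "{x. grad \<phi> x \<bullet> b \<noteq> 0} \<subseteq> closure {x. \<phi> x \<noteq> 0}"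
    proof
      fix x assume "x \<in> {x. grad \<phi> x \<bullet> b \<noteq> 0}"
      then have "grad \<phi> x \<noteq> 0" by auto
      then show "x \<in> closure {x. \<phi> x \<noteq> 0}"
        using grad_eq_0_outside_support by blast
    qed
  qed simp
  have "compact (closure {x. grad \<phi> x \<bullet> b \<noteq> 0})"
    using assms(1) compact_Int_closed[of "closure {x. \<phi> x \<noteq> 0}" "closure {x. grad \<phi> x \<bullet> b \<noteq> 0}"] *
    by (simp add: test_functions_def Int_absorb1)
  moreover have "Ck_on k UNIV (\<lambda>x. grad \<phi> x \<bullet> b)" for k
    using assms unfolding test_functions_def mem_Collect_eq by (metis Ck_on.simps(2))
  ultimately show ?thesis
    using assms(1) * by (auto simp: test_functions_def)
qed

lemma test_functions_grad_continuous:
  assumes "\<phi> \<in> test_functions S"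
  shows "continuous_on A (grad \<phi>)"
  by (subst continuous_on_componentwise)
     (use grad_component_test_function[OF assms] test_functions_continuous in blast)

lemma test_functions_vanish:
  fixes \<phi> :: "'a::euclidean_space \<Rightarrow> real"
  assumes "\<phi> \<in> test_functions S"
  obtains R where "R > 0" "\<And>x. x \<notin> cball 0 R \<Longrightarrow> \<phi> x = 0" "\<And>x. x \<notin> cball 0 R \<Longrightarrow> grad \<phi> x = 0"
proof -
  have "bounded (closure {x. \<phi> x \<noteq> 0})"
    using assms by (auto simp: test_functions_def compact_imp_bounded)
  then obtain R where R: "R > 0" "\<forall>x\<in>closure {x. \<phi> x \<noteq> 0}. norm x \<le> R"
    using bounded_pos by blast
  show ?thesis
  proof (rule that[of R])
    fix x :: 'a assume "x \<notin> cball 0 R"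
    then have "x \<notin> closure {x. \<phi> x \<noteq> 0}" using R(2) by auto
    then show "\<phi> x = 0" "grad \<phi> x = 0"
      using grad_eq_0_outside_support[of x \<phi>] closure_subset[of "{x. \<phi> x \<noteq> 0}"] by auto
  qed (use R in auto)
qed

lemma continuous_bounded_on_cball:
  fixes f :: "'a::euclidean_space \<Rightarrow> 'b::real_normed_vector"
  assumes "continuous_on UNIV f"
  obtains B where "B > 0" "\<And>x. x \<in> cball 0 R \<Longrightarrow> norm (f x) \<le> B"
proof -
  have "bounded (f ` cball 0 R)"
    by (meson assms compact_cball compact_continuous_image compact_imp_bounded continuous_on_subset subset_UNIV)
  then show ?thesis using that bounded_pos by (metis imageI)
qed

lemma continuous_vanishing_bounded:
  fixes f :: "'a::euclidean_space \<Rightarrow> 'b::real_normed_vector"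
  assumes "continuous_on UNIV f" "\<And>x. x \<notin> cball 0 R \<Longrightarrow> f x = 0"
  obtains B where "B > 0" "\<And>x. norm (f x) \<le> B"
proof -
  obtain B where B: "B > 0" "\<And>x. x \<in> cball 0 R \<Longrightarrow> norm (f x) \<le> B"
    using continuous_bounded_on_cball[OF assms(1)] by blast
  have "norm (f x) \<le> B" for x
    using B assms(2)[of x] by (cases "x \<in> cball 0 R") auto
  then show ?thesis using that B(1) by blast
qed

lemma continuous_vanishing_integrable:
  fixes f :: "'a::euclidean_space \<Rightarrow> 'b::euclidean_space"
  assumes "continuous_on UNIV f" "\<And>x. x \<notin> cball 0 R \<Longrightarrow> f x = 0"
  shows "integrable lborel f"
proof -
  have "integrable lborel (\<lambda>x. indicator (cball 0 R) x *\<^sub>R f x)"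
    using assms(1) by (intro borel_integrable_compact) (auto intro: continuous_on_subset)
  moreover have "(\<lambda>x. indicator (cball 0 R) x *\<^sub>R f x) = f"
    using assms(2) by (auto simp: fun_eq_iff indicator_def)
  ultimately show ?thesis by simp
qed

lemma test_functions_lipschitz:
  assumes "\<phi> \<in> test_functions S"
  obtains L where "L > 0" "\<And>x y. \<bar>\<phi> x - \<phi> y\<bar> \<le> L * norm (x - y)"
proof -
  obtain R where "\<And>x. x \<notin> cball 0 R \<Longrightarrow> grad \<phi> x = 0"
    using test_functions_vanish[OF assms] by blast
  then obtain L where "L > 0" "\<And>x. norm (grad \<phi> x) \<le> L"
    using continuous_vanishing_bounded[OF test_functions_grad_continuous[OF assms]] by blast
  then show ?thesis
    using that GDERIV_lipschitz_bound[OF test_functions_GDERIV[OF assms]] by blast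
qed

lemma test_functions_grad_lipschitz:
  fixes \<phi> :: "'a::euclidean_space \<Rightarrow> real"
  assumes "\<phi> \<in> test_functions S"
  obtains L where "L > 0" "\<And>x y. norm (grad \<phi> x - grad \<phi> y) \<le> L * norm (x - y)"
proof -
  have "\<exists>L>0. \<forall>x y. \<bar>grad \<phi> x \<bullet> b - grad \<phi> y \<bullet> b\<bar> \<le> L * norm (x - y)" if "b \<in> Basis" for b
    using test_functions_lipschitz[OF grad_component_test_function[OF assms that]] by metis
  then obtain L where L: "\<And>b x y. b \<in> Basis \<Longrightarrow> L b > 0 \<and> \<bar>grad \<phi> x \<bullet> b - grad \<phi> y \<bullet> b\<bar> \<le> L b * norm (x - y)"
    by metis
  show ?thesis
  proof (rule that[of "sum L Basis"])
    show "0 < sum L Basis" using L by (intro sum_pos) auto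
    fix x y
    have "norm (grad \<phi> x - grad \<phi> y) \<le> (\<Sum>b\<in>Basis. \<bar>(grad \<phi> x - grad \<phi> y) \<bullet> b\<bar>)"
      by (rule norm_le_l1)
    also have "\<dots> \<le> (\<Sum>b\<in>Basis. L b * norm (x - y))"
      using L by (intro sum_mono) (auto simp: inner_diff_left)
    finally show "norm (grad \<phi> x - grad \<phi> y) \<le> sum L Basis * norm (x - y)"
      by (simp add: sum_distrib_right)
  qed
qed

lemma test_functions_scale:
  assumes "\<phi> \<in> test_functions S"
  shows "(\<lambda>x. a * \<phi> x) \<in> test_functions S"
\<comment> \<open>For \<open>a = 0\<close> the support becomes empty; otherwise it is
  unchanged.\<close>
proof (cases "a = 0")
  case True
  have "Ck_on k UNIV (\<lambda>x. a * \<phi> x)" for k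
    using assms Ck_on_linear[of k \<phi> \<phi> a 0] by (simp add: test_functions_def)
  then show ?thesis using True by (simp add: test_functions_def)
next
  case False
  have "Ck_on k UNIV (\<lambda>x. a * \<phi> x)" for k
    using assms Ck_on_linear[of k \<phi> \<phi> a 0] by (simp add: test_functions_def)
  then show ?thesis using False assms by (simp add: test_functions_def)
qed

lemma test_functions_reflect:
  assumes "\<phi> \<in> test_functions UNIV"
  shows "(\<lambda>y. \<phi> (x - y)) \<in> test_functions UNIV"
proof -
  obtain R where R: "\<And>x. x \<notin> cball 0 R \<Longrightarrow> \<phi> x = 0"
    using test_functions_vanish[OF assms] by blast
  have "bounded {y. \<phi> (x - y) \<noteq> 0}"
    by (rule bounded_subset[OF bounded_cball[of x R]]) (use R in \<open>force simp: dist_norm\<close>)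
  then show ?thesis
    using assms Ck_on_reflect by (auto simp: test_functions_def)
qed

lemma grad_reflect:
  assumes "\<phi> \<in> test_functions S"
  shows "grad (\<lambda>y. \<phi> (x - y)) y = - grad \<phi> (x - y)"
  by (rule grad_eqI[OF GDERIV_reflect[OF test_functions_GDERIV[OF assms]]])

section \<open>Reflection and translation invariance of Lebesgue integrals\<close>

lemma lborel_reflect:
  fixes x :: "'a::euclidean_space"
  shows "distr lborel borel (\<lambda>y. x - y) = lborel"
  by (subst (2) lborel_affine[of "-1" x]) (auto simp: density_1)

lemma
  fixes f :: "'a::euclidean_space \<Rightarrow> 'b::euclidean_space"
  assumes [measurable]: "f \<in> borel_measurable borel"
  shows integrable_lborel_reflect: "integrable lborel (\<lambda>y. f (x - y)) \<longleftrightarrow> integrable lborel f"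
    and integral_lborel_reflect: "(LBINT y. f (x - y)) = (LBINT y. f y)"
  using lborel_reflect[of x] integrable_distr_eq[of "\<lambda>y. x - y" lborel borel f] integral_distr[of "\<lambda>y. x - y" lborel borel f]
  by auto

lemma
  fixes f :: "'a::euclidean_space \<Rightarrow> 'b::euclidean_space"
  assumes [measurable]: "f \<in> borel_measurable borel"
  shows integrable_lborel_shift: "integrable lborel (\<lambda>y. f (y + x)) \<longleftrightarrow> integrable lborel f"
    and integral_lborel_shift: "(LBINT y. f (y + x)) = (LBINT y. f y)"
  using lborel_distr_plus[of x] integrable_distr_eq[of "(+) x" lborel borel f] integral_distr[of "(+) x" lborel borel f]
  by (auto simp: add.commute)

text \<open>For \<open>r \<le> 0\<close> the box is empty and \<open>moll r = 0\<close>.\<close>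

definition moll :: "real \<Rightarrow> 'a::euclidean_space \<Rightarrow> real" where
  "moll r x = (let \<phi> = box_bump (\<lambda>_. 0) (\<lambda>_. 0) (- (r / DIM('a)) *\<^sub>R One) ((r / DIM('a)) *\<^sub>R One) 1
               in inverse (LBINT y. \<phi> y) * \<phi> x)"

lemma
  fixes x :: "'a::euclidean_space"
  assumes "r > 0"
  shows moll_nonneg: "0 \<le> moll r x"
    and moll_eq_0: "x \<notin> cball 0 r \<Longrightarrow> moll r x = 0"
    and moll_integral: "(\<integral>x. moll r x \<partial>(lborel :: 'a measure)) = 1"
    and moll_test_function: "moll r \<in> test_functions (UNIV :: 'a set)"
proof -
  \<comment> \<open>The half side \<open>r / DIM('a)\<close> keeps the box inside
    \<open>cball 0 r\<close>, since the norm is at most the sum of the absolute values of the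
    coordinates.\<close>
  define a where "a = (r / DIM('a)) *\<^sub>R (One :: 'a)"
  define \<phi> where "\<phi> = box_bump (\<lambda>_. 0) (\<lambda>_. 0) (- a) a 1"
  have moll: "moll r x = inverse (LBINT y. \<phi> y) * \<phi> x" for x :: 'a
    by (simp add: moll_def \<phi>_def a_def Let_def)
  have \<phi>: "\<phi> \<in> test_functions UNIV"
    unfolding \<phi>_def by (rule box_bump_test_function) auto
  obtain R where R: "\<And>x. x \<notin> cball 0 R \<Longrightarrow> \<phi> x = 0"
    using test_functions_vanish[OF \<phi>] by blast
  have int: "integrable lborel \<phi>"
    by (rule continuous_vanishing_integrable[OF test_functions_continuous[OF \<phi>] R])
  have nn: "0 \<le> \<phi> x" for x by (simp add: \<phi>_def box_bump_nonneg)
  have nz: "\<phi> x \<noteq> 0 \<longleftrightarrow> x \<in> box (-a) a" for x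
    unfolding \<phi>_def by (rule box_bump_nonzero_iff) simp
  \<comment> \<open>If the integral vanished, the box, on which the bump is nonzero, would be a null
    set.\<close>
  have pos: "0 < (LBINT y. \<phi> y)"
  proof (rule ccontr)
    assume "\<not> 0 < (LBINT y. \<phi> y)"
    then have "(LBINT y. \<phi> y) = 0"
      using Bochner_Integration.integral_nonneg[of lborel \<phi>] nn by (simp add: order_antisym)
    then have "AE x in lborel. \<phi> x = 0"
      using integral_nonneg_eq_0_iff_AE[OF int] nn by simp
    then have "AE x in lborel. x \<notin> box (-a) a" using nz by auto
    then have "emeasure lborel (box (-a) a) = 0"
      by (subst (asm) AE_iff_measurable[OF _ refl]) (auto simp: )
    moreover have "emeasure lborel (box (-a) a) = ennreal (\<Prod>b\<in>(Basis :: 'a set). 2 * (r / DIM('a)))"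
    proof -
      have "(\<Prod>b\<in>(Basis :: 'a set). (a - - a) \<bullet> b) = (\<Prod>b\<in>(Basis :: 'a set). 2 * (r / DIM('a)))"
        by (rule prod.cong) (auto simp: a_def inner_add_left)
      moreover have "(- a) \<bullet> b \<le> a \<bullet> b" if "b \<in> Basis" for b
        using that assms by (simp add: a_def)
      ultimately show ?thesis by (subst emeasure_lborel_box) auto
    qed
    moreover have "(\<Prod>b\<in>(Basis :: 'a set). 2 * (r / DIM('a))) > 0"
      using assms by (intro prod_pos) auto
    ultimately show False by (simp add: ennreal_eq_0_iff)
  qed
  show "0 \<le> moll r x" using moll pos nn by simp
  show "moll r \<in> test_functions (UNIV :: 'a set)"
    using test_functions_scale[OF \<phi>, of "inverse (LBINT y. \<phi> y)"] by (simp add: moll[abs_def])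
  show "(\<integral>x. moll r x \<partial>(lborel :: 'a measure)) = 1"
    using pos by (simp add: moll)
  show "moll r x = 0" if "x \<notin> cball 0 r"
  proof -
    have "x \<notin> box (-a) a"
    proof
      assume "x \<in> box (-a) a"
      then have "\<bar>x \<bullet> b\<bar> \<le> r / DIM('a)" if "b \<in> Basis" for b
        using that by (force simp: mem_box a_def)
      then have "(\<Sum>b\<in>Basis. \<bar>x \<bullet> b\<bar>) \<le> of_nat DIM('a) * (r / DIM('a))"
        by (intro sum_bounded_above) auto
      then have "norm x \<le> r" using norm_le_l1[of x] by simp
      then show False using that by simp
    qed
    then have "\<phi> x = 0" using nz by blast
    then show ?thesis by (simp add: moll)
  qed
qed

section \<open>Locally integrable functions\<close>

definition locally_integrable :: "('a::euclidean_space \<Rightarrow> 'b::euclidean_space) \<Rightarrow> bool" where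
  "locally_integrable f \<longleftrightarrow> (\<forall>R. set_integrable lborel (cball 0 R) f)"

text \<open>The truncations to the balls \<open>cball 0 n\<close> are integrable, hence measurable,
  and at each point they are eventually equal to \<open>f\<close>.\<close>

lemma locally_integrable_measurable:
  assumes "locally_integrable f"
  shows "f \<in> borel_measurable borel"
proof (rule borel_measurable_LIMSEQ_metric)
  show "(\<lambda>x. indicator (cball 0 (real n)) x *\<^sub>R f x) \<in> borel_measurable borel" for n
    using assms borel_measurable_integrable[of lborel]
    by (auto simp: locally_integrable_def set_integrable_def)
  show "(\<lambda>n. indicator (cball 0 (real n)) x *\<^sub>R f x) \<longlonglongrightarrow> f x" for x
  proof (rule tendsto_eventually)
    show "\<forall>\<^sub>F n in sequentially. indicator (cball 0 (real n)) x *\<^sub>R f x = f x"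
      using eventually_ge_at_top[of "nat \<lceil>norm x\<rceil>"]
      by eventually_elim (auto simp: indicator_def; linarith)
  qed
qed

lemma continuous_locally_integrable:
  assumes "continuous_on UNIV f"
  shows "locally_integrable f"
  unfolding locally_integrable_def set_integrable_def
  using assms by (auto intro!: borel_integrable_compact intro: continuous_on_subset)

lemma locally_integrable_norm:
  assumes "locally_integrable f"
  shows "locally_integrable (\<lambda>x. norm (f x))"
  using assms integrable_norm[of lborel] unfolding locally_integrable_def set_integrable_def
  by fastforce

text \<open>The basic estimate for integrating kernels against a rough \<open>f\<close>: here
  \<open>g\<close> is a kernel times \<open>f\<close>, and a small kernel bound \<open>B\<close>
  makes the integral small by a factor that does not depend on the kernel.\<close>

lemma locally_integrable_dominates:
  fixes f :: "'a::euclidean_space \<Rightarrow> 'b::euclidean_space" and g :: "'a \<Rightarrow> 'c::euclidean_space"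
  assumes "locally_integrable f" "g \<in> borel_measurable borel"
    "\<And>x. norm (g x) \<le> B * norm (f x)" "\<And>x. x \<notin> cball 0 R \<Longrightarrow> g x = 0"
  shows "integrable lborel g"
    and "norm (integral\<^sup>L lborel g) \<le> B * (LBINT x. indicator (cball 0 R) x * norm (f x))"
proof -
  have i: "integrable lborel (\<lambda>x. indicator (cball 0 R) x * norm (f x))"
    using locally_integrable_norm[OF assms(1)] by (simp add: locally_integrable_def set_integrable_def)
  have le: "norm (g x) \<le> B * (indicator (cball 0 R) x * norm (f x))" for x
    using assms(3)[of x] assms(4)[of x] by (auto simp: indicator_def)
  show g: "integrable lborel g"
  proof (rule Bochner_Integration.integrable_bound)
    show "integrable lborel (\<lambda>x. B * (indicator (cball 0 R) x * norm (f x)))"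
      using i by simp
    show "AE x in lborel. norm (g x) \<le> norm (B * (indicator (cball 0 R) x * norm (f x)))"
      using order_trans[OF le abs_ge_self] by simp
  qed (use assms in simp)
  have "norm (integral\<^sup>L lborel g) \<le> (LBINT x. norm (g x))"
    by (rule integral_norm_bound)
  also have "\<dots> \<le> (LBINT x. B * (indicator (cball 0 R) x * norm (f x)))"
    using i g le by (intro integral_mono) auto
  finally show "norm (integral\<^sup>L lborel g) \<le> B * (LBINT x. indicator (cball 0 R) x * norm (f x))"
    by simp
qed

lemma locally_integrable_mult:
  fixes f :: "'a::euclidean_space \<Rightarrow> 'b::euclidean_space"
  assumes "locally_integrable f" "continuous_on UNIV w" "\<And>x. x \<notin> cball 0 R \<Longrightarrow> w x = 0"
  shows "integrable lborel (\<lambda>x. w x *\<^sub>R f x)"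
proof -
  obtain B where B: "\<And>x. norm (w x) \<le> B"
    using continuous_vanishing_bounded[OF assms(2,3)] by blast
  have [measurable]: "f \<in> borel_measurable borel" "w \<in> borel_measurable borel"
    using assms locally_integrable_measurable borel_measurable_continuous_onI by auto
  show ?thesis
    by (rule locally_integrable_dominates(1)[OF assms(1), of _ B R])
       (use B assms(3) in \<open>auto intro!: mult_right_mono\<close>)
qed

text \<open>A quadratic remainder is stable under integration in a parameter, so this form of
  differentiability suits convolutions.\<close>

lemma GDERIV_quadraticI:
  fixes f :: "'a::euclidean_space \<Rightarrow> real"
  assumes "\<And>v. norm v \<le> 1 \<Longrightarrow> \<bar>f (x + v) - f x - v \<bullet> D\<bar> \<le> C * (norm v)\<^sup>2"
  shows "GDERIV f x :> D"
  unfolding gderiv_def has_derivative_at_alt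
proof (intro conjI allI impI)
  show "bounded_linear (\<lambda>h. h \<bullet> D)" by (rule bounded_linear_inner_left)
  fix e :: real assume "e > 0"
  define d where "d = min 1 (e / (\<bar>C\<bar> + 1))"
  have "d > 0" using \<open>e > 0\<close> by (simp add: d_def)
  moreover have "norm (f y - f x - (y - x) \<bullet> D) \<le> e * norm (y - x)" if "norm (y - x) < d" for y
  proof -
    have "\<bar>f y - f x - (y - x) \<bullet> D\<bar> \<le> C * (norm (y - x))\<^sup>2"
      using assms[of "y - x"] that by (simp add: d_def)
    also have "\<dots> = (C * norm (y - x)) * norm (y - x)" by (simp add: power2_eq_square)
    also have "\<dots> \<le> e * norm (y - x)"
    proof (rule mult_right_mono)
      have "C * norm (y - x) \<le> (\<bar>C\<bar> + 1) * norm (y - x)" by (intro mult_right_mono) auto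
      also have "\<dots> \<le> (\<bar>C\<bar> + 1) * (e / (\<bar>C\<bar> + 1))"
        using that by (intro mult_left_mono) (auto simp: d_def)
      finally show "C * norm (y - x) \<le> e" by simp
    qed simp
    finally show ?thesis by simp
  qed
  ultimately show "\<exists>d>0. \<forall>y. norm (y - x) < d \<longrightarrow> norm (f y - f x - (y - x) \<bullet> D) \<le> e * norm (y - x)"
    by blast
qed

lemma GDERIV_norm_le:
  fixes f :: "'a::euclidean_space \<Rightarrow> real"
  assumes "GDERIV f x :> D" "\<And>y z. \<bar>f y - f z\<bar> \<le> L * norm (y - z)"
  shows "norm D \<le> L"
proof (cases "D = 0")
  case True
  obtain b :: 'a where "b \<in> Basis" using nonempty_Basis by blast
  then show ?thesis using True order_trans[OF abs_ge_zero assms(2)[of b 0]] by simp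
next
  case False
  show ?thesis
  proof (rule field_le_epsilon)
    fix e :: real assume "e > 0"
    then obtain d where d: "d > 0" "\<And>y. norm (y - x) < d \<Longrightarrow> \<bar>f y - f x - (y - x) \<bullet> D\<bar> \<le> e * norm (y - x)"
      using assms(1) unfolding gderiv_def has_derivative_at_alt by auto
    \<comment> \<open>A step of length \<open>d / 2\<close> along \<open>D\<close> itself: the
      increment of \<open>f\<close> is there almost \<open>s * (norm D)\<^sup>2\<close>, while the
      Lipschitz bound allows at most \<open>L * (s * norm D)\<close>.\<close>
    define s where "s = d / (2 * norm D)"
    have s: "s > 0" "s * norm D < d" using d(1) False by (auto simp: s_def)
    have "s * (norm D)\<^sup>2 \<le> \<bar>f (x + s *\<^sub>R D) - f x\<bar> + \<bar>f (x + s *\<^sub>R D) - f x - (s *\<^sub>R D) \<bullet> D\<bar>"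
      using s by (simp add: power2_norm_eq_inner)
    also have "\<dots> \<le> L * (s * norm D) + e * (s * norm D)"
      using assms(2)[of "x + s *\<^sub>R D" x] d(2)[of "x + s *\<^sub>R D"] s by simp
    also have "\<dots> = (L + e) * (s * norm D)" by (simp add: algebra_simps)
    finally have "norm D * (s * norm D) \<le> (L + e) * (s * norm D)"
      by (simp add: power2_eq_square mult_ac)
    then show "norm D \<le> L + e"
      using s False by (simp add: mult_le_cancel_right)
  qed
qed

section \<open>Mollification and differentiation under the integral\<close>

definition mollify ::
    "real \<Rightarrow> ('a::euclidean_space \<Rightarrow> 'b::euclidean_space) \<Rightarrow> 'a \<Rightarrow> 'b" where
  "mollify r f x = (LBINT y. moll r (x - y) *\<^sub>R f y)"

lemma moll_measurable: "r > 0 \<Longrightarrow> moll r \<in> borel_measurable borel"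
  by (rule borel_measurable_continuous_onI[OF test_functions_continuous[OF moll_test_function]])

lemma moll_integrable: "r > 0 \<Longrightarrow> integrable lborel (moll r)"
  by (rule continuous_vanishing_integrable[OF test_functions_continuous[OF moll_test_function] moll_eq_0])

lemma mollify_integrable:
  assumes "r > 0" "locally_integrable f"
  shows "integrable lborel (\<lambda>y. moll r (x - y) *\<^sub>R f y)"
proof (rule locally_integrable_mult[OF assms(2), of _ "norm x + r"])
  show "continuous_on UNIV (\<lambda>y. moll r (x - y))"
    using test_functions_reflect[OF moll_test_function[OF assms(1)]] by (rule test_functions_continuous)
  show "moll r (x - y) = 0" if "y \<notin> cball 0 (norm x + r)" for y
  proof (rule moll_eq_0[OF assms(1)])
    show "x - y \<notin> cball 0 r" using that norm_triangle_ineq3[of x y] by (auto simp: norm_minus_commute)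
  qed
qed

lemma mollify_reflect:
  assumes "r > 0" "f \<in> borel_measurable borel"
  shows "mollify r f x = (LBINT y. moll r y *\<^sub>R f (x - y))"
proof -
  have [measurable]: "moll r \<in> borel_measurable borel" "f \<in> borel_measurable borel"
    using assms moll_measurable by auto
  show ?thesis
    using integral_lborel_reflect[of "\<lambda>y. moll r y *\<^sub>R f (x - y)" x] by (simp add: mollify_def)
qed

lemma mollify_reflect_integrable:
  assumes "r > 0" "locally_integrable f"
  shows "integrable lborel (\<lambda>y. moll r y *\<^sub>R f (x - y))"
proof -
  have [measurable]: "moll r \<in> borel_measurable borel" "f \<in> borel_measurable borel"
    using assms moll_measurable locally_integrable_measurable by auto
  show ?thesis
    using integrable_lborel_reflect[of "\<lambda>y. moll r y *\<^sub>R f (x - y)" x] mollify_integrable[OF assms] by simp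
qed

lemma mollify_const:
  fixes c :: "'b::euclidean_space"
  assumes "r > 0"
  shows "(\<integral>y. moll r y *\<^sub>R c \<partial>(lborel :: 'a::euclidean_space measure)) = c"
  using moll_integral[OF assms, where 'a='a] moll_integrable[OF assms, where 'a='a] by simp

text \<open>The kernel is a probability density, so \<open>c\<close> is its own average, and the
  kernel sees only arguments of norm at most \<open>r\<close>.\<close>

lemma moll_average_close:
  fixes g :: "'a::euclidean_space \<Rightarrow> 'b::euclidean_space"
  assumes "r > 0" "integrable lborel (\<lambda>y. moll r y *\<^sub>R g y)" "\<And>y. norm y \<le> r \<Longrightarrow> norm (g y - c) \<le> e"
  shows "norm ((LBINT y. moll r y *\<^sub>R g y) - c) \<le> e"
proof -
  have ic: "integrable lborel (\<lambda>y::'a. moll r y *\<^sub>R c)" using moll_integrable[OF assms(1), where 'a='a] by simp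
  have "(LBINT y. moll r y *\<^sub>R g y) - c = (LBINT y. moll r y *\<^sub>R g y - moll r y *\<^sub>R c)"
    using assms(2) ic mollify_const[OF assms(1), of c, where 'a='a] by simp
  also have "\<dots> = (LBINT y. moll r y *\<^sub>R (g y - c))"
    by (simp add: scaleR_diff_right)
  also have "norm \<dots> \<le> (LBINT y. norm (moll r y *\<^sub>R (g y - c)))"
    by (rule integral_norm_bound)
  also have "\<dots> \<le> (\<integral>y. moll r y * e \<partial>(lborel :: 'a measure))"
  proof (rule integral_mono)
    show "integrable lborel (\<lambda>y. norm (moll r y *\<^sub>R (g y - c)))"
      using assms(2) ic by (simp only: scaleR_diff_right integrable_norm Bochner_Integration.integrable_diff)
    show "norm (moll r y *\<^sub>R (g y - c)) \<le> moll r y * e" for y :: 'a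
      using moll_nonneg[OF assms(1), of y] moll_eq_0[OF assms(1), of y] assms(3)[of y]
      by (cases "y \<in> cball 0 r") (auto intro!: mult_left_mono)
  qed (use moll_integrable[OF assms(1), where 'a='a] in simp)
  also have "\<dots> = e"
    using moll_integral[OF assms(1), where 'a='a] by simp
  finally show ?thesis .
qed

lemma mollify_close:
  fixes f :: "'a::euclidean_space \<Rightarrow> 'b::euclidean_space"
  assumes "r > 0" "locally_integrable f" "\<And>y. norm (x - y) \<le> r \<Longrightarrow> norm (f y - c) \<le> e"
  shows "norm (mollify r f x - c) \<le> e"
proof -
  have "norm (f (x - y) - c) \<le> e" if "norm y \<le> r" for y
    using assms(3)[of "x - y"] that by simp
  then show ?thesis
    using moll_average_close[OF assms(1) mollify_reflect_integrable[OF assms(1,2)]]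
    by (simp add: mollify_reflect assms(1) locally_integrable_measurable[OF assms(2)])
qed

text \<open>The derivative falls on the kernel, so the formula makes sense for every locally
  integrable \<open>f\<close>; for weakly differentiable \<open>f\<close>,
  \<open>mollify_grad_weak\<close> moves it back to the weak gradient.\<close>

definition mollify_grad :: "real \<Rightarrow> ('a::euclidean_space \<Rightarrow> real) \<Rightarrow> 'a \<Rightarrow> 'a" where
  "mollify_grad r f x = (LBINT y. f y *\<^sub>R grad (moll r) (x - y))"

lemma grad_moll_measurable: "r > 0 \<Longrightarrow> grad (moll r) \<in> borel_measurable borel"
  by (rule borel_measurable_continuous_onI[OF test_functions_grad_continuous[OF moll_test_function]])

lemma grad_moll_eq_0:
  fixes x :: "'a::euclidean_space"
  assumes "r > 0" "x \<notin> cball 0 r"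
  shows "grad (moll r) x = 0"
proof (rule grad_eq_0_outside_support)
  have "closure {x::'a. moll r x \<noteq> 0} \<subseteq> cball 0 r"
    by (rule closure_minimal) (use moll_eq_0[OF assms(1), where 'a='a] in fastforce)+
  then show "x \<notin> closure {x. moll r x \<noteq> 0}" using assms by auto
qed

lemma mollify_grad_integrable:
  fixes f :: "'a::euclidean_space \<Rightarrow> real"
  assumes "r > 0" "locally_integrable f"
  shows "integrable lborel (\<lambda>y. f y *\<^sub>R grad (moll r) (x - y))"
proof -
  obtain B where B: "\<And>x::'a. norm (grad (moll r) x) \<le> B"
    using continuous_vanishing_bounded[OF test_functions_grad_continuous[OF moll_test_function[OF assms(1)]] grad_moll_eq_0[OF assms(1)]] by blast
  have [measurable]: "f \<in> borel_measurable borel" "grad (moll r) \<in> borel_measurable (borel :: 'a measure)"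
    using assms locally_integrable_measurable grad_moll_measurable by auto
  show ?thesis
  proof (rule locally_integrable_dominates(1)[OF assms(2), of _ B "norm x + r"])
    show "norm (f y *\<^sub>R grad (moll r) (x - y)) \<le> B * norm (f y)" for y
      using mult_left_mono[OF B[of "x - y"], of "\<bar>f y\<bar>"] by (simp add: mult.commute)
    show "f y *\<^sub>R grad (moll r) (x - y) = 0" if "y \<notin> cball 0 (norm x + r)" for y
      using that norm_triangle_ineq3[of x y] by (subst grad_moll_eq_0[OF assms(1)]) auto
  qed simp
qed

text \<open>The gradient of the kernel is Lipschitz, which gives the kernel a uniform quadratic
  Taylor remainder; integrated against \<open>f\<close>, it becomes a quadratic remainder for the
  mollification.\<close>

lemma mollify_GDERIV:
  fixes f :: "'a::euclidean_space \<Rightarrow> real"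
  assumes r: "r > 0" and f: "locally_integrable f"
  shows "GDERIV (mollify r f) x :> mollify_grad r f x"
proof -
  obtain M where M: "M > 0" "\<And>x y::'a. norm (grad (moll r) x - grad (moll r) y) \<le> M * norm (x - y)"
    using test_functions_grad_lipschitz[OF moll_test_function[OF r]] by blast
  have [measurable]: "f \<in> borel_measurable borel" "grad (moll r) \<in> borel_measurable (borel :: 'a measure)"
    "moll r \<in> borel_measurable (borel :: 'a measure)"
    using assms locally_integrable_measurable grad_moll_measurable moll_measurable by auto
  \<comment> \<open>This ball contains the supports of the kernels centred at \<open>x\<close> and
    at \<open>x + v\<close>, for all \<open>v\<close> of norm at most 1.\<close>
  define C where "C = (LBINT y. indicator (cball 0 (norm x + r + 1)) y * norm (f y))"
  show ?thesis
  proof (rule GDERIV_quadraticI)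
    fix v :: 'a assume v: "norm v \<le> 1"
    define q where "q y = f y * (moll r (x + v - y) - moll r (x - y) - v \<bullet> grad (moll r) (x - y))" for y
    note i = mollify_integrable[OF r f, of "x + v"] mollify_integrable[OF r f, of x]
      mollify_grad_integrable[OF r f, of x]
    have i3: "integrable lborel (\<lambda>y. v \<bullet> (f y *\<^sub>R grad (moll r) (x - y)))"
      by (rule integrable_inner_right) (rule i(3))
    have i4: "v \<bullet> (LBINT y. f y *\<^sub>R grad (moll r) (x - y)) = (LBINT y. v \<bullet> (f y *\<^sub>R grad (moll r) (x - y)))"
      by (rule integral_inner_right[symmetric]) (rule i(3))
    have "mollify r f (x + v) - mollify r f x - v \<bullet> mollify_grad r f x =
      (LBINT y. moll r (x + v - y) *\<^sub>R f y - moll r (x - y) *\<^sub>R f y - v \<bullet> (f y *\<^sub>R grad (moll r) (x - y)))"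
      unfolding mollify_def mollify_grad_def
      using i i3 by (simp only: Bochner_Integration.integral_diff Bochner_Integration.integrable_diff i4)
    also have "\<dots> = integral\<^sup>L lborel q"
      by (intro Bochner_Integration.integral_cong) (auto simp: q_def algebra_simps)
    finally have "\<bar>mollify r f (x + v) - mollify r f x - v \<bullet> mollify_grad r f x\<bar> = norm (integral\<^sup>L lborel q)"
      by simp
    also have "\<dots> \<le> (M * (norm v)\<^sup>2) * C"
      unfolding C_def
    proof (rule locally_integrable_dominates(2)[OF f])
      show "q \<in> borel_measurable borel" unfolding q_def by measurable
      fix y
      have "\<bar>moll r (x - y + v) - moll r (x - y) - v \<bullet> grad (moll r) (x - y)\<bar> \<le> M * (norm v)\<^sup>2"
        by (rule GDERIV_quadratic_remainder[OF test_functions_GDERIV[OF moll_test_function[OF r]] M(2)])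
      moreover have "x - y + v = x + v - y" by simp
      ultimately have "\<bar>moll r (x + v - y) - moll r (x - y) - v \<bullet> grad (moll r) (x - y)\<bar> \<le> M * (norm v)\<^sup>2"
        by simp
      from mult_left_mono[OF this, of "\<bar>f y\<bar>"]
      show "norm (q y) \<le> M * (norm v)\<^sup>2 * norm (f y)"
        unfolding q_def by (simp only: real_norm_def abs_mult abs_ge_zero mult.commute[of _ "\<bar>f y\<bar>"])
      assume "y \<notin> cball 0 (norm x + r + 1)"
      then have "norm x + r + 1 < norm y" by simp
      moreover have "norm y \<le> norm (x - y) + norm x" "norm y \<le> norm (x + v - y) + norm x + norm v"
        using norm_triangle_ineq2[of y x] norm_triangle_ineq2[of y "x + v"] norm_triangle_ineq[of x v]
        by (simp_all add: norm_minus_commute[of y])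
      ultimately have "x + v - y \<notin> cball 0 r" "x - y \<notin> cball 0 r"
        using v by auto
      then show "q y = 0"
        by (simp add: q_def moll_eq_0[OF r] grad_moll_eq_0[OF r])
    qed
    finally show "\<bar>mollify r f (x + v) - mollify r f x - v \<bullet> mollify_grad r f x\<bar> \<le> (M * C) * (norm v)\<^sup>2"
      by (simp add: mult_ac)
  qed
qed

text \<open>Common source of continuity for \<open>mollify\<close> and \<open>mollify_grad\<close>.
  For parameters in \<open>cball 0 R\<close> and kernels of range \<open>r\<close>, only the mass of
  \<open>f\<close> in \<open>cball 0 (R + r)\<close> enters.\<close>

lemma parametric_integral_locally_lipschitz:
  fixes f :: "'a::euclidean_space \<Rightarrow> 'b::euclidean_space" and q :: "'a \<Rightarrow> 'a \<Rightarrow> 'c::euclidean_space"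
  assumes f: "locally_integrable f" and q: "\<And>x. integrable lborel (q x)"
    "\<And>x z. norm (x - z) > r \<Longrightarrow> q x z = 0"
    "\<And>x y z. norm (q x z - q y z) \<le> M * norm (x - y) * norm (f z)"
  obtains L where "\<And>x y. x \<in> cball 0 R \<Longrightarrow> y \<in> cball 0 R \<Longrightarrow>
    norm ((LBINT z. q x z) - (LBINT z. q y z)) \<le> L * norm (x - y)"
proof -
  define C where "C = (LBINT z. indicator (cball 0 (R + r)) z * norm (f z))"
  show ?thesis
  proof (rule that[of "M * C"])
    fix x y :: 'a assume xy: "x \<in> cball 0 R" "y \<in> cball 0 R"
    have "(LBINT z. q x z) - (LBINT z. q y z) = (LBINT z. q x z - q y z)"
      using q(1) by simp
    also have "norm \<dots> \<le> (M * norm (x - y)) * C"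
      unfolding C_def
    proof (rule locally_integrable_dominates(2)[OF f])
      show "(\<lambda>z. q x z - q y z) \<in> borel_measurable borel"
        using borel_measurable_integrable[OF q(1)] by auto
      fix z :: 'a assume "z \<notin> cball 0 (R + r)"
      then have "norm (x - z) > r" "norm (y - z) > r"
        using xy norm_triangle_ineq2[of z x] norm_triangle_ineq2[of z y]
        by (auto simp: norm_minus_commute[of z])
      then show "q x z - q y z = 0" by (simp add: q(2))
    qed (rule q(3))
    finally show "norm ((LBINT z. q x z) - (LBINT z. q y z)) \<le> M * C * norm (x - y)"
      by (simp add: mult_ac)
  qed
qed

lemma locally_lipschitz_continuous_on:
  fixes f :: "'a::euclidean_space \<Rightarrow> 'b::euclidean_space"
  assumes "\<And>R. \<exists>L. \<forall>x\<in>cball 0 R. \<forall>y\<in>cball 0 R. norm (f x - f y) \<le> L * norm (x - y)"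
  shows "continuous_on A f"
proof -
  have "isCont f x" for x
  proof -
    obtain L where L: "\<And>u y. u \<in> cball 0 (norm x + 1) \<Longrightarrow> y \<in> cball 0 (norm x + 1) \<Longrightarrow> norm (f u - f y) \<le> L * norm (u - y)"
      using assms by blast
    have "(max L 0)-lipschitz_on (ball 0 (norm x + 1)) f"
    proof (rule lipschitz_onI)
      fix u y :: 'a assume "u \<in> ball 0 (norm x + 1)" "y \<in> ball 0 (norm x + 1)"
      then have "norm (f u - f y) \<le> L * norm (u - y)" by (intro L) auto
      also have "\<dots> \<le> max L 0 * norm (u - y)" by (intro mult_right_mono) auto
      finally show "dist (f u) (f y) \<le> max L 0 * dist u y" by (simp add: dist_norm)
    qed simp
    then have "continuous_on (ball 0 (norm x + 1)) f"
      by (rule lipschitz_on_continuous_on)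
    then show ?thesis by (simp add: continuous_on_eq_continuous_at)
  qed
  then show ?thesis by (simp add: continuous_at_imp_continuous_on)
qed

lemma mollify_locally_lipschitz:
  fixes f :: "'a::euclidean_space \<Rightarrow> 'b::euclidean_space"
  assumes r: "r > 0" and f: "locally_integrable f"
  obtains L where "\<And>x y. x \<in> cball 0 R \<Longrightarrow> y \<in> cball 0 R \<Longrightarrow> norm (mollify r f x - mollify r f y) \<le> L * norm (x - y)"
proof -
  obtain L where L: "L > 0" "\<And>x y::'a. \<bar>moll r x - moll r y\<bar> \<le> L * norm (x - y)"
    using test_functions_lipschitz[OF moll_test_function[OF r]] by blast
  show ?thesis
  proof (rule parametric_integral_locally_lipschitz[OF f mollify_integrable[OF r f], folded mollify_def])
    fix x y z :: 'a
    show "moll r (x - z) *\<^sub>R f z = 0" if "norm (x - z) > r"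
      using that moll_eq_0[OF r, of "x - z"] by simp
    show "norm (moll r (x - z) *\<^sub>R f z - moll r (y - z) *\<^sub>R f z) \<le> L * norm (x - y) * norm (f z)"
      using L(2)[of "x - z" "y - z"] by (auto simp: scaleR_diff_left[symmetric] intro!: mult_right_mono)
  qed (rule that)
qed

lemma mollify_continuous:
  fixes f :: "'a::euclidean_space \<Rightarrow> 'b::euclidean_space"
  assumes "r > 0" "locally_integrable f"
  shows "continuous_on A (mollify r f)"
  by (rule locally_lipschitz_continuous_on) (metis mollify_locally_lipschitz[OF assms])

lemma mollify_grad_continuous:
  fixes f :: "'a::euclidean_space \<Rightarrow> real"
  assumes r: "r > 0" and f: "locally_integrable f"
  shows "continuous_on A (mollify_grad r f)"
proof (rule locally_lipschitz_continuous_on)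
  fix R
  obtain M where M: "M > 0" "\<And>x y::'a. norm (grad (moll r) x - grad (moll r) y) \<le> M * norm (x - y)"
    using test_functions_grad_lipschitz[OF moll_test_function[OF r]] by blast
  obtain L where "\<And>x y. x \<in> cball 0 R \<Longrightarrow> y \<in> cball 0 R \<Longrightarrow> norm (mollify_grad r f x - mollify_grad r f y) \<le> L * norm (x - y)"
  proof (rule parametric_integral_locally_lipschitz[OF f mollify_grad_integrable[OF r f], folded mollify_grad_def])
    fix x y z :: 'a
    show "f z *\<^sub>R grad (moll r) (x - z) = 0" if "norm (x - z) > r"
      using that grad_moll_eq_0[OF r, of "x - z"] by simp
    show "norm (f z *\<^sub>R grad (moll r) (x - z) - f z *\<^sub>R grad (moll r) (y - z)) \<le> M * norm (x - y) * norm (f z)"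
      using mult_left_mono[OF M(2)[of "x - z" "y - z"], of "\<bar>f z\<bar>"]
      by (simp add: scaleR_diff_right[symmetric] mult_ac)
  qed (rule that)
  then show "\<exists>L. \<forall>x\<in>cball 0 R. \<forall>y\<in>cball 0 R. norm (mollify_grad r f x - mollify_grad r f y) \<le> L * norm (x - y)"
    by blast
qed

lemma has_weak_gradient_on_UNIV_locally_integrable:
  assumes "has_weak_gradient_on f G UNIV"
  shows "locally_integrable f" "locally_integrable G"
  using assms by (auto simp: has_weak_gradient_on_def locally_integrable_def)

text \<open>For fixed \<open>x\<close> the reflected kernel is a test function in \<open>y\<close>.
  The sign from the reflection cancels the sign in the definition of the weak gradient.\<close>

lemma mollify_grad_weak:
  assumes "r > 0" "has_weak_gradient_on f G UNIV"
  shows "mollify_grad r f x = mollify r G x"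
proof -
  have "(LBINT y. f y *\<^sub>R grad (\<lambda>y. moll r (x - y)) y) = - (LBINT y. moll r (x - y) *\<^sub>R G y)"
    using assms(2) test_functions_reflect[OF moll_test_function[OF assms(1)]]
    unfolding has_weak_gradient_on_def by blast
  then show ?thesis
    by (simp add: mollify_grad_def mollify_def grad_reflect[OF moll_test_function[OF assms(1)]])
qed

text \<open>All bounds depend on \<open>r\<close> alone and not on \<open>h\<close>; in particular
  the Lipschitz constant of the gradient is the L1 norm of the gradient of the kernel. This is what
  makes the later estimates uniform over Lipschitz functions.\<close>

lemma
  fixes h :: "'a::euclidean_space \<Rightarrow> real"
  assumes r: "r > 0" and h: "\<And>x y. \<bar>h x - h y\<bar> \<le> norm (x - y)"
  shows mollify_lipschitz: "\<bar>mollify r h x - mollify r h y\<bar> \<le> norm (x - y)"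
    and mollify_lipschitz_close: "\<bar>mollify r h x - h x\<bar> \<le> r"
    and mollify_grad_lipschitz_norm: "norm (mollify_grad r h x) \<le> 1"
    and mollify_grad_lipschitz:
      "norm (mollify_grad r h x - mollify_grad r h y) \<le> (\<integral>z. norm (grad (moll r) z) \<partial>(lborel :: 'a measure)) * norm (x - y)"
    and lipschitz_mollify_GDERIV: "GDERIV (mollify r h) x :> mollify_grad r h x"
proof -
  have "1-lipschitz_on UNIV h" by (rule lipschitz_onI) (use h in \<open>auto simp: dist_norm\<close>)
  then have cont: "continuous_on UNIV h" by (rule lipschitz_on_continuous_on)
  then have li: "locally_integrable h" by (rule continuous_locally_integrable)
  have [measurable]: "h \<in> borel_measurable borel" "moll r \<in> borel_measurable (borel :: 'a measure)"
    "grad (moll r) \<in> borel_measurable (borel :: 'a measure)"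
    using locally_integrable_measurable[OF li] moll_measurable[OF r] grad_moll_measurable[OF r] by auto
  show L: "\<bar>mollify r h x - mollify r h y\<bar> \<le> norm (x - y)" for x y
  proof -
    note i = mollify_reflect_integrable[OF r li, of x] mollify_reflect_integrable[OF r li, of y]
    have "mollify r h x - mollify r h y = (LBINT z. moll r z * (h (x - z) - h (y - z)))"
      using i by (simp add: mollify_reflect[OF r] right_diff_distrib)
    also have "\<bar>\<dots>\<bar> \<le> (LBINT z. \<bar>moll r z * (h (x - z) - h (y - z))\<bar>)"
      by (rule integral_abs_bound)
    also have "\<dots> \<le> (\<integral>z. moll r z * norm (x - y) \<partial>(lborel :: 'a measure))"
    proof (rule integral_mono)
      show "integrable lborel (\<lambda>z. \<bar>moll r z * (h (x - z) - h (y - z))\<bar>)"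
        using i by (simp add: right_diff_distrib)
      show "\<bar>moll r z * (h (x - z) - h (y - z))\<bar> \<le> moll r z * norm (x - y)" for z
        using h[of "x - z" "y - z"] moll_nonneg[OF r, of z] by (simp add: abs_mult mult_left_mono)
    qed (use moll_integrable[OF r, where 'a='a] in simp)
    finally show ?thesis using moll_integral[OF r, where 'a='a] by simp
  qed
  show G: "GDERIV (mollify r h) x :> mollify_grad r h x" for x
    by (rule mollify_GDERIV[OF r li])
  show "norm (mollify_grad r h x) \<le> 1"
    by (rule GDERIV_norm_le[OF G]) (use L in simp)
  show "\<bar>mollify r h x - h x\<bar> \<le> r"
  proof -
    have "norm (h y - h x) \<le> r" if "norm (x - y) \<le> r" for y
      using h[of x y] that by simp
    then show ?thesis using mollify_close[OF r li, of x "h x" r] by simp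
  qed
  \<comment> \<open>Reflection moves the dependence on \<open>x\<close> from the kernel to
    \<open>h\<close>, where the Lipschitz bound can be used.\<close>
  have refl: "mollify_grad r h x = (LBINT z. h (x - z) *\<^sub>R grad (moll r) z)"
    "integrable lborel (\<lambda>z. h (x - z) *\<^sub>R grad (moll r) z)" for x
    using integral_lborel_reflect[of "\<lambda>z. h (x - z) *\<^sub>R grad (moll r) z" x]
      integrable_lborel_reflect[of "\<lambda>z. h (x - z) *\<^sub>R grad (moll r) z" x] mollify_grad_integrable[OF r li]
    by (simp_all add: mollify_grad_def)
  have gi: "integrable lborel (\<lambda>z::'a. norm (grad (moll r) z))"
    by (intro integrable_norm continuous_vanishing_integrable[OF test_functions_grad_continuous[OF moll_test_function[OF r]] grad_moll_eq_0[OF r]])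
  have "mollify_grad r h x - mollify_grad r h y = (LBINT z. (h (x - z) - h (y - z)) *\<^sub>R grad (moll r) z)"
    using refl by (simp add: scaleR_diff_left)
  also have "norm \<dots> \<le> (LBINT z. norm ((h (x - z) - h (y - z)) *\<^sub>R grad (moll r) z))"
    by (rule integral_norm_bound)
  also have "\<dots> \<le> (\<integral>z. norm (grad (moll r) z) * norm (x - y) \<partial>(lborel :: 'a measure))"
  proof (rule integral_mono)
    show "integrable lborel (\<lambda>z. norm ((h (x - z) - h (y - z)) *\<^sub>R grad (moll r) z))"
      unfolding scaleR_diff_left using refl by (intro integrable_norm Bochner_Integration.integrable_diff)
    show "norm ((h (x - z) - h (y - z)) *\<^sub>R grad (moll r) z) \<le> norm (grad (moll r) z) * norm (x - y)" for z
      using mult_left_mono[OF h[of "x - z" "y - z"], of "norm (grad (moll r) z)"] by (simp add: mult.commute)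
  qed (use gi in simp)
  finally show "norm (mollify_grad r h x - mollify_grad r h y) \<le> (\<integral>z. norm (grad (moll r) z) \<partial>(lborel :: 'a measure)) * norm (x - y)"
    using gi by simp
qed

section \<open>A transport inequality for monotone drifts\<close>

lemma continuous_vanishing_pair_Fubini:
  fixes f :: "'a::euclidean_space \<Rightarrow> 'a \<Rightarrow> real"
  assumes "continuous_on UNIV (case_prod f)" "\<And>x y. x \<notin> cball 0 R \<or> y \<notin> cball 0 r \<Longrightarrow> f x y = 0"
  shows "(LBINT y. (LBINT x. f x y)) = (LBINT x. (LBINT y. f x y))"
    and "integrable lborel (\<lambda>y. LBINT x. f x y)"
proof -
  have "integrable lborel (case_prod f)"
  proof (rule continuous_vanishing_integrable[OF assms(1)])
    fix z :: "'a \<times> 'a" assume z: "z \<notin> cball 0 (R + r)"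
    obtain x y where xy: "z = (x, y)" by (cases z)
    have "norm z \<le> norm x + norm y" unfolding xy by (rule norm_Pair_le)
    then show "case_prod f z = 0" using z assms(2)[of x y] by (auto simp: xy)
  qed
  then have i: "integrable (lborel \<Otimes>\<^sub>M lborel) (case_prod f)" by (simp add: lborel_prod)
  show "(LBINT y. (LBINT x. f x y)) = (LBINT x. (LBINT y. f x y))"
    by (rule lborel_pair.Fubini_integral[OF i])
  show "integrable lborel (\<lambda>y. LBINT x. f x y)"
    by (rule lborel_pair.integrable_snd[OF i])
qed

lemma integral_bound_on_cball:
  fixes g :: "'a::euclidean_space \<Rightarrow> real"
  assumes "\<And>x. x \<in> cball 0 R \<Longrightarrow> \<bar>g x\<bar> \<le> c" "\<And>x. x \<notin> cball 0 R \<Longrightarrow> g x = 0" "0 \<le> c"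
  shows "\<bar>LBINT x. g x\<bar> \<le> c * measure lborel (cball (0::'a) R)"
proof (cases "integrable lborel g")
  case True
  have "\<bar>LBINT x. g x\<bar> \<le> (LBINT x. \<bar>g x\<bar>)" by (rule integral_abs_bound)
  also have "\<dots> \<le> (\<integral>x. c * indicator (cball 0 R) x \<partial>(lborel :: 'a measure))"
  proof (rule integral_mono)
    show "integrable lborel (\<lambda>x::'a. c * indicator (cball 0 R) x)"
      using emeasure_lborel_cball_finite[of "0::'a" R] by auto
    show "\<bar>g x\<bar> \<le> c * indicator (cball 0 R) x" for x
      using assms(1)[of x] assms(2)[of x] by (auto simp: indicator_def)
  qed (use True in simp)
  also have "\<dots> = c * measure lborel (cball (0::'a) R)" by simp
  finally show ?thesis .
next
  \<comment> \<open>The Bochner integral of a non-integrable function is 0, so the bound still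
    holds.\<close>
  case False
  then show ?thesis using assms(3) by (simp add: not_integrable_integral_eq)
qed

abbreviation lip1 :: "('a::real_normed_vector \<Rightarrow> real) \<Rightarrow> bool" where
  "lip1 h \<equiv> \<forall>x y. \<bar>h x - h y\<bar> \<le> norm (x - y)"

lemma lip1_continuous: "lip1 h \<Longrightarrow> continuous_on A h"
  by (rule lipschitz_on_continuous_on[of 1], rule lipschitz_onI) (auto simp: dist_norm)

text \<open>The estimate is uniform in \<open>h\<close>, which need not be differentiable. Translating \<open>h\<close> by at most \<open>r\<close> changes the
  first integral by a small multiple of \<open>t\<close>, since the translation can be moved to \<open>V\<close> and \<open>v\<close>. So \<open>h\<close> may be
  replaced by the average of its translates, whose gradient has a Lipschitz constant depending only on \<open>r\<close>.\<close>

lemma displacement_estimate: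
  fixes V :: "'a::euclidean_space \<Rightarrow> real" and v :: "'a \<Rightarrow> 'a"
  assumes V: "continuous_on UNIV V" "\<And>x. x \<notin> cball 0 R \<Longrightarrow> V x = 0"
    and v: "continuous_on UNIV v" and e: "e > 0"
  shows "\<forall>\<^sub>F r in at_right 0. \<forall>\<^sub>F t in at_right 0. \<forall>h. lip1 h \<longrightarrow>
    \<bar>(LBINT x. (h (x + t *\<^sub>R v x) - h x) * V x) -
     t * (LBINT x. (mollify_grad r h x \<bullet> v x) * V x)\<bar> \<le> t * e"
proof -
  obtain B where B: "B > 0" "\<And>x. \<bar>V x\<bar> \<le> B"
    using continuous_vanishing_bounded[OF V] by (metis real_norm_def)
  \<comment> \<open>Points of \<open>cball 0 (R + 1)\<close> stay in \<open>cball 0 (R + 2)\<close>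
    under translations by at most \<open>r < 1\<close>.\<close>
  obtain M where M: "M > 0" "\<And>x. x \<in> cball 0 (R + 2) \<Longrightarrow> norm (v x) \<le> M"
    using continuous_bounded_on_cball[OF v] by blast
  define m where "m = measure lborel (cball (0::'a) (R + 1))"
  have m: "m \<ge> 0" by (simp add: m_def)
  \<comment> \<open>At each point, translating costs \<open>t * M * e1\<close> through the change of
    \<open>V\<close> and \<open>t * e1 * B\<close> through the change of \<open>v\<close>; over a
    ball of volume \<open>m\<close> the total has to be at most \<open>t * (e / 2)\<close>.\<close>
  define e1 where "e1 = e / (2 * (M + B) * (m + 1))"
  have e1: "e1 > 0" using e M B m by (simp add: e1_def)
  have e1m: "(M + B) * e1 * m \<le> e / 2"
  proof -
    have "q * (e / (2 * q * (m + 1))) * m = e / 2 * (m / (m + 1))" if "q > 0" for q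
      using that by simp
    from this[of "M + B"] have "(M + B) * e1 * m = e / 2 * (m / (m + 1))"
      using M B by (simp add: e1_def)
    also have "\<dots> \<le> e / 2 * 1" using e m by (intro mult_left_mono) auto
    finally show ?thesis by simp
  qed
  have "uniformly_continuous_on (cball 0 (R + 2)) V" "uniformly_continuous_on (cball 0 (R + 2)) v"
    using V(1) v by (auto intro!: compact_uniformly_continuous intro: continuous_on_subset)
  note uc = this[unfolded uniformly_continuous_on_def, rule_format, OF e1]
  obtain d1 where d1: "d1 > 0"
     "\<And>x y. x \<in> cball 0 (R + 2) \<Longrightarrow> y \<in> cball 0 (R + 2) \<Longrightarrow> dist y x < d1 \<Longrightarrow> dist (V y) (V x) < e1"
    using uc(1) by blast
  obtain d2 where d2: "d2 > 0"
     "\<And>x y. x \<in> cball 0 (R + 2) \<Longrightarrow> y \<in> cball 0 (R + 2) \<Longrightarrow> dist y x < d2 \<Longrightarrow> dist (v y) (v x) < e1"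
    using uc(2) by blast
  note d = d1(1) d2(1) d1(2) d2(2)
  define r0 where "r0 = min 1 (min d1 d2)"
  have r0: "r0 > 0" using d by (simp add: r0_def)
  \<comment> \<open>The upper bound on \<open>t\<close> makes the quadratic Taylor error of the
    mollified \<open>h\<close> at most \<open>t * (e / 2)\<close>. It depends on \<open>r\<close>,
    through the L1 norm of the gradient of the kernel, but not on \<open>h\<close>.\<close>
  have main: "\<bar>(LBINT x. (h (x + t *\<^sub>R v x) - h x) * V x) -
     t * (LBINT x. (mollify_grad r h x \<bullet> v x) * V x)\<bar> \<le> t * e"
    if r: "0 < r" "r < r0" and t: "0 < t" "t < e / (2 * ((\<integral>z. norm (grad (moll r) z) \<partial>(lborel :: 'a measure)) * M\<^sup>2 * B * m + 1))"
      and h: "lip1 h" for r t h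
  proof -
    define C where "C = (\<integral>z. norm (grad (moll r) z) \<partial>(lborel :: 'a measure))"
    have C: "C \<ge> 0" by (simp add: C_def)
    have hc: "continuous_on A h" for A by (rule lip1_continuous[OF h])
    have hli: "locally_integrable h" by (rule continuous_locally_integrable[OF hc])
    have mc: "continuous_on A (moll r)" for A :: "'a set" by (rule test_functions_continuous[OF moll_test_function[OF r(1)]])
    define \<Phi> where "\<Phi> x y = moll r y * ((h (x - y + t *\<^sub>R v x) - h (x - y)) * V x)" for x y
    define I where "I y = (LBINT x. (h (x - y + t *\<^sub>R v x) - h (x - y)) * V x)" for y
    have iI: "integrable lborel (\<lambda>x. (h (x - y + t *\<^sub>R v x) - h (x - y)) * V x)" for y
      using V v by (intro continuous_vanishing_integrable[of _ R])
        (auto intro!: continuous_intros continuous_on_compose2[OF hc[of UNIV]])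
    have iI': "integrable lborel (\<lambda>x. (h (x - y + t *\<^sub>R v (x - y)) - h (x - y)) * V (x - y))"
      "(LBINT x. (h (x - y + t *\<^sub>R v (x - y)) - h (x - y)) * V (x - y)) = I 0" for y
      using integrable_lborel_shift[of "\<lambda>x. (h (x + t *\<^sub>R v x) - h x) * V x" "- y"]
        integral_lborel_shift[of "\<lambda>x. (h (x + t *\<^sub>R v x) - h x) * V x" "- y"] iI[of 0]
      by (simp_all add: I_def borel_measurable_integrable)
    \<comment> \<open>Substituting \<open>x - y\<close> for \<open>x\<close> in \<open>I 0\<close>
      gives \<open>h\<close> the same base point \<open>x - y\<close> as in \<open>I y\<close>, so
      the integrands differ only through the arguments of \<open>V\<close> and
      \<open>v\<close>.\<close>
    have I_close: "\<bar>I y - I 0\<bar> \<le> t * (e / 2)" if y: "norm y \<le> r" for y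
    proof -
      have "I 0 - I y = (LBINT x. (h (x - y + t *\<^sub>R v (x - y)) - h (x - y)) * V (x - y)
          - (h (x - y + t *\<^sub>R v x) - h (x - y)) * V x)"
        using iI iI' by (simp add: I_def)
      also have "\<bar>\<dots>\<bar> \<le> (t * ((M + B) * e1)) * m"
        unfolding m_def
      proof (rule integral_bound_on_cball)
        fix x :: 'a
        assume x: "x \<in> cball 0 (R + 1)"
        have y1: "norm y \<le> 1" "norm y < d1" "norm y < d2" using y r by (auto simp: r0_def)
        have x2: "x \<in> cball 0 (R + 2)" "x - y \<in> cball 0 (R + 2)"
          using x y1 norm_triangle_ineq4[of x y] by auto
        define a where "a = h (x - y + t *\<^sub>R v (x - y)) - h (x - y)"
        define a' where "a' = h (x - y + t *\<^sub>R v x) - h (x - y)"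
        have "\<bar>a\<bar> \<le> t * norm (v (x - y))"
          using h[rule_format, of "x - y + t *\<^sub>R v (x - y)" "x - y"] t by (simp add: a_def)
        also have "\<dots> \<le> t * M" using M(2)[OF x2(2)] t by simp
        finally have a: "\<bar>a\<bar> \<le> t * M" .
        have "\<bar>a - a'\<bar> \<le> norm (t *\<^sub>R v (x - y) - t *\<^sub>R v x)"
          using h[rule_format, of "x - y + t *\<^sub>R v (x - y)" "x - y + t *\<^sub>R v x"] by (simp add: a_def a'_def)
        also have "\<dots> = t * norm (v (x - y) - v x)"
          using t by (simp add: scaleR_diff_right[symmetric])
        also have "\<dots> \<le> t * e1"
          using d(4)[OF x2] y1 t by (simp add: dist_norm less_imp_le)
        finally have a': "\<bar>a - a'\<bar> \<le> t * e1" .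
        have "\<bar>V (x - y) - V x\<bar> \<le> e1"
          using d(3)[OF x2] y1 by (simp add: dist_norm less_imp_le)
        then have "\<bar>a\<bar> * \<bar>V (x - y) - V x\<bar> + \<bar>a - a'\<bar> * \<bar>V x\<bar> \<le> (t * M) * e1 + (t * e1) * B"
          using a a' B(2)[of x] M B e1 t by (intro add_mono mult_mono) auto
        moreover have "a * V (x - y) - a' * V x = a * (V (x - y) - V x) + (a - a') * V x"
          by (simp add: algebra_simps)
        ultimately have "\<bar>a * V (x - y) - a' * V x\<bar> \<le> (t * M) * e1 + (t * e1) * B"
          using abs_triangle_ineq[of "a * (V (x - y) - V x)" "(a - a') * V x"] by (simp add: abs_mult)
        then show "\<bar>(h (x - y + t *\<^sub>R v (x - y)) - h (x - y)) * V (x - y)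
          - (h (x - y + t *\<^sub>R v x) - h (x - y)) * V x\<bar> \<le> t * ((M + B) * e1)"
          by (simp add: a_def a'_def algebra_simps)
      next
        fix x :: 'a
        assume x: "x \<notin> cball 0 (R + 1)"
        have "norm y \<le> 1" using y r by (auto simp: r0_def)
        then have "x \<notin> cball 0 R" "x - y \<notin> cball 0 R"
          using x norm_triangle_ineq2[of x y] by auto
        then show "(h (x - y + t *\<^sub>R v (x - y)) - h (x - y)) * V (x - y)
          - (h (x - y + t *\<^sub>R v x) - h (x - y)) * V x = 0" using V(2) by simp
      qed (use t M B e1 in auto)
      also have "\<dots> \<le> t * (e / 2)" using e1m t by (simp add: mult.assoc)
      finally show ?thesis by (simp add: abs_minus_commute)
    qed
    have \<Phi>c: "continuous_on UNIV (case_prod \<Phi>)"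
      unfolding \<Phi>_def case_prod_unfold
      by (intro continuous_intros continuous_on_compose2[OF hc[of UNIV]] continuous_on_compose2[OF mc[of UNIV]]
          continuous_on_compose2[OF V(1)] continuous_on_compose2[OF v]) auto
    have \<Phi>0: "\<Phi> x y = 0" if "x \<notin> cball 0 R \<or> y \<notin> cball 0 r" for x y
      using that V(2) moll_eq_0[OF r(1), of y] by (auto simp: \<Phi>_def)
    note Fub = continuous_vanishing_pair_Fubini[OF \<Phi>c \<Phi>0]
    have \<Phi>I: "(LBINT x. \<Phi> x y) = moll r y *\<^sub>R I y" for y
      unfolding \<Phi>_def I_def by simp
    \<comment> \<open>Averaging \<open>I y\<close> against the kernel replaces \<open>h\<close> by
      its mollification, once the two integrals are exchanged.\<close>
    have "norm ((LBINT y. moll r y *\<^sub>R I y) - I 0) \<le> t * (e / 2)"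
      using Fub(2) I_close by (intro moll_average_close[OF r(1)]) (simp_all add: \<Phi>I)
    moreover have "(LBINT y. moll r y *\<^sub>R I y) =
       (LBINT x. (mollify r h (x + t *\<^sub>R v x) - mollify r h x) * V x)"
    proof -
      have "(LBINT y. \<Phi> x y) = (mollify r h (x + t *\<^sub>R v x) - mollify r h x) * V x" for x
      proof -
        note i = mollify_reflect_integrable[OF r(1) hli]
        have "(LBINT y. \<Phi> x y) = (LBINT y. (moll r y *\<^sub>R h (x + t *\<^sub>R v x - y) - moll r y *\<^sub>R h (x - y)) * V x)"
          by (rule Bochner_Integration.integral_cong) (auto simp: \<Phi>_def algebra_simps)
        also have "\<dots> = (LBINT y. moll r y *\<^sub>R h (x + t *\<^sub>R v x - y) - moll r y *\<^sub>R h (x - y)) * V x"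
          by (rule integral_mult_left_zero)
        also have "\<dots> = (mollify r h (x + t *\<^sub>R v x) - mollify r h x) * V x"
          using i[of "x + t *\<^sub>R v x"] i[of x]
          by (simp add: mollify_reflect[OF r(1) locally_integrable_measurable[OF hli]])
        finally show ?thesis .
      qed
      then show ?thesis using Fub(1) by (simp add: \<Phi>I)
    qed
    ultimately have part1: "\<bar>(LBINT x. (mollify r h (x + t *\<^sub>R v x) - mollify r h x) * V x) - I 0\<bar> \<le> t * (e / 2)"
      by simp
    have hm: "\<And>x y. \<bar>h x - h y\<bar> \<le> norm (x - y)" using h by blast
    note L = mollify_lipschitz[OF r(1) hm] mollify_grad_lipschitz[OF r(1) hm, folded C_def]
      lipschitz_mollify_GDERIV[OF r(1) hm]
    have gc: "continuous_on UNIV (mollify_grad r h)"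
      by (rule mollify_grad_continuous[OF r(1) hli])
    have mhc: "continuous_on UNIV (mollify r h)"
      by (rule mollify_continuous[OF r(1) hli])
    have "(LBINT x. (mollify r h (x + t *\<^sub>R v x) - mollify r h x) * V x) - t * (LBINT x. (mollify_grad r h x \<bullet> v x) * V x)
      = (LBINT x. (mollify r h (x + t *\<^sub>R v x) - mollify r h x - (t *\<^sub>R v x) \<bullet> mollify_grad r h x) * V x)"
    proof -
      have "integrable lborel (\<lambda>x. (mollify r h (x + t *\<^sub>R v x) - mollify r h x) * V x)"
        using V v mhc by (intro continuous_vanishing_integrable[of _ R])
          (auto intro!: continuous_intros continuous_on_compose2[OF mhc])
      moreover have "integrable lborel (\<lambda>x. (mollify_grad r h x \<bullet> v x) * V x)"
        using V v gc by (intro continuous_vanishing_integrable[of _ R]) (auto intro!: continuous_intros)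
      ultimately show ?thesis
        by (simp add: left_diff_distrib inner_commute mult.assoc)
    qed
    also have "\<bar>\<dots>\<bar> \<le> (C * (t * M)\<^sup>2 * B) * m"
      unfolding m_def
    proof (rule integral_bound_on_cball)
      fix x :: 'a
      assume x: "x \<in> cball 0 (R + 1)"
      have "\<bar>mollify r h (x + t *\<^sub>R v x) - mollify r h x - (t *\<^sub>R v x) \<bullet> mollify_grad r h x\<bar> \<le> C * (norm (t *\<^sub>R v x))\<^sup>2"
        by (rule GDERIV_quadratic_remainder[OF L(3) L(2)])
      also have "\<dots> \<le> C * (t * M)\<^sup>2"
        using M(2)[of x] x t C by (intro mult_left_mono power_mono) auto
      finally show "\<bar>(mollify r h (x + t *\<^sub>R v x) - mollify r h x - (t *\<^sub>R v x) \<bullet> mollify_grad r h x) * V x\<bar> \<le> C * (t * M)\<^sup>2 * B"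
        unfolding abs_mult using B C by (intro mult_mono) auto
    qed (use V B C in auto)
    also have "\<dots> \<le> t * (e / 2)"
    proof -
      have K: "0 \<le> C * M\<^sup>2 * B * m" using C B m by auto
      have "t * (C * M\<^sup>2 * B * m) \<le> (e / (2 * (C * M\<^sup>2 * B * m + 1))) * (C * M\<^sup>2 * B * m)"
        using t(2) K unfolding C_def[symmetric] by (intro mult_right_mono) auto
      also have "\<dots> = e / 2 * (C * M\<^sup>2 * B * m / (C * M\<^sup>2 * B * m + 1))"
        by simp
      also have "\<dots> \<le> e / 2 * 1"
        using K e by (intro mult_left_mono) (auto simp: divide_le_eq)
      finally have "t * (t * (C * M\<^sup>2 * B * m)) \<le> t * (e / 2)"
        using t by simp
      then show ?thesis by (simp add: power2_eq_square mult_ac)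
    qed
    finally have part2: "\<bar>(LBINT x. (mollify r h (x + t *\<^sub>R v x) - mollify r h x) * V x) - t * (LBINT x. (mollify_grad r h x \<bullet> v x) * V x)\<bar> \<le> t * (e / 2)" .
    show ?thesis
    proof -
      have "I 0 = (LBINT x. (h (x + t *\<^sub>R v x) - h x) * V x)"
        by (simp add: I_def)
      moreover have "t * (e / 2) + t * (e / 2) = t * e" by simp
      ultimately show ?thesis using part1 part2 by linarith
    qed
  qed
  show ?thesis
  proof (rule eventually_at_rightI[OF _ r0])
    fix r assume r: "r \<in> {0<..<r0}"
    let ?T = "e / (2 * ((\<integral>z. norm (grad (moll r) z) \<partial>(lborel :: 'a measure)) * M\<^sup>2 * B * m + 1))"
    have "0 \<le> (\<integral>z. norm (grad (moll r) z) \<partial>(lborel :: 'a measure)) * M\<^sup>2 * B * m"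
      using B m by auto
    then have "0 < ?T" using e by (intro divide_pos_pos) auto
    then show "\<forall>\<^sub>F t in at_right 0. \<forall>h. lip1 h \<longrightarrow>
      \<bar>(LBINT x. (h (x + t *\<^sub>R v x) - h x) * V x) -
       t * (LBINT x. (mollify_grad r h x \<bullet> v x) * V x)\<bar> \<le> t * e"
      using main r by (intro eventually_at_rightI[of 0 ?T]) auto
  qed
qed

section \<open>One step of a random walk with drift, tested against a C1 function\<close>

lemma continuous_vanishing_uniform:
  fixes f :: "'a::euclidean_space \<Rightarrow> 'b::real_normed_vector"
  assumes "continuous_on UNIV f" "\<And>x. x \<notin> cball 0 R \<Longrightarrow> f x = 0" "e > 0"
  obtains d where "d > 0" "\<And>x y. norm (x - y) < d \<Longrightarrow> norm (f x - f y) < e"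
proof -
  have "uniformly_continuous_on (cball 0 (R + 1)) f"
    using assms(1) by (auto intro!: compact_uniformly_continuous intro: continuous_on_subset)
  from this[unfolded uniformly_continuous_on_def, rule_format, OF assms(3)]
  obtain d where d: "d > 0"
    "\<And>x y. x \<in> cball 0 (R + 1) \<Longrightarrow> y \<in> cball 0 (R + 1) \<Longrightarrow> dist y x < d \<Longrightarrow> dist (f y) (f x) < e"
    by blast
  show ?thesis
  proof (rule that[of "min 1 d"])
    fix x y :: 'a assume xy: "norm (x - y) < min 1 d"
    show "norm (f x - f y) < e"
    proof (cases "x \<in> cball 0 (R + 1) \<and> y \<in> cball 0 (R + 1)")
      case True
      then show ?thesis using d(2)[of y x] xy by (simp add: dist_norm)
    next
      case False
      then have "x \<notin> cball 0 R" "y \<notin> cball 0 R"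
        using xy norm_triangle_ineq3[of x y] by auto
      then show ?thesis using assms(2,3) by simp
    qed
  qed (use d in simp)
qed

text \<open>Translation by \<open>a\<close> turns the integral of \<open>g x * F (x + a)\<close>
  into that of \<open>g (x - a) * F x\<close> and leaves the integral of \<open>g * F\<close>
  unchanged; then both sides expand into the same integrals.\<close>

lemma summation_by_parts:
  fixes F g :: "'a::euclidean_space \<Rightarrow> real"
  assumes F: "continuous_on UNIV F" "\<And>x. x \<notin> cball 0 R \<Longrightarrow> F x = 0" and g: "continuous_on UNIV g"
  shows "(LBINT x. (2 * g x - g (x + a) - g (x - a)) * F x) =
         (LBINT x. (g (x + a) - g x) * (F (x + a) - F x))"
    and "integrable lborel (\<lambda>x. (2 * g x - g (x + a) - g (x - a)) * F x)"
proof -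
  have [measurable]: "F \<in> borel_measurable borel" "g \<in> borel_measurable borel"
    using F g borel_measurable_continuous_onI by auto
  have gF: "integrable lborel (\<lambda>x. w x * F x)" if "continuous_on UNIV w" for w
    using F that by (intro continuous_vanishing_integrable[of _ R]) (auto intro!: continuous_intros)
  have g1: "continuous_on UNIV (\<lambda>x. g (x + c))" for c
    by (intro continuous_on_compose2[OF g] continuous_intros) auto
  note i1 = gF[OF g] and i2 = gF[OF g1[of a]] and i3 = gF[OF g1[of "- a"]]
  have i4: "integrable lborel (\<lambda>x. g (x + a) * F (x + a))"
    "(LBINT x. g (x + a) * F (x + a)) = (LBINT x. g x * F x)"
    using integrable_lborel_shift[of "\<lambda>x. g x * F x" a] integral_lborel_shift[of "\<lambda>x. g x * F x" a] i1 by auto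
  have i5: "integrable lborel (\<lambda>x. g x * F (x + a))"
    "(LBINT x. g x * F (x + a)) = (LBINT x. g (x - a) * F x)"
    using integrable_lborel_shift[of "\<lambda>x. g (x - a) * F x" a] integral_lborel_shift[of "\<lambda>x. g (x - a) * F x" a] i3 by auto
  have e1: "(\<lambda>x. (2 * g x - g (x + a) - g (x - a)) * F x) =
    (\<lambda>x. 2 * (g x * F x) - g (x + a) * F x - g (x + - a) * F x)"
    by (simp add: algebra_simps)
  show "integrable lborel (\<lambda>x. (2 * g x - g (x + a) - g (x - a)) * F x)"
    unfolding e1 by (intro Bochner_Integration.integrable_diff integrable_mult_right i1 i2 i3)
  have "(LBINT x. (2 * g x - g (x + a) - g (x - a)) * F x) =
     2 * (LBINT x. g x * F x) - (LBINT x. g (x + a) * F x) - (LBINT x. g (x - a) * F x)"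
    unfolding e1 using i1 i2 i3 by simp
  moreover have "(LBINT x. (g (x + a) - g x) * (F (x + a) - F x)) =
     (LBINT x. g (x + a) * F (x + a) - g (x + a) * F x - g x * F (x + a) + g x * F x)"
    by (rule Bochner_Integration.integral_cong) (auto simp: algebra_simps)
  moreover have "\<dots> = (LBINT x. g (x + a) * F (x + a)) - (LBINT x. g (x + a) * F x)
     - (LBINT x. g x * F (x + a)) + (LBINT x. g x * F x)"
    using i1 i2 i4(1) i5(1) by simp
  ultimately show "(LBINT x. (2 * g x - g (x + a) - g (x - a)) * F x) =
         (LBINT x. (g (x + a) - g x) * (F (x + a) - F x))"
    using i4(2) i5(2) by simp
qed

text \<open>A finite average takes the place of a Gaussian one, and only continuity of
  \<open>g\<close> is involved. Each coordinate of the step has variance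
  \<open>s\<^sup>2 / DIM('a)\<close>.\<close>

definition walk_average :: "real \<Rightarrow> ('a::euclidean_space \<Rightarrow> real) \<Rightarrow> 'a \<Rightarrow> real" where
  "walk_average s g x = (\<Sum>u\<in>Basis. g (x + s *\<^sub>R u) + g (x - s *\<^sub>R u)) / (2 * DIM('a))"

lemma walk_average_continuous:
  fixes g :: "'a::euclidean_space \<Rightarrow> real"
  assumes "continuous_on UNIV g"
  shows "continuous_on UNIV (walk_average s g)"
  unfolding walk_average_def
  by (intro continuous_intros continuous_on_compose2[OF assms]) auto

lemma walk_average_by_parts:
  fixes F g :: "'a::euclidean_space \<Rightarrow> real"
  assumes F: "continuous_on UNIV F" "\<And>x. x \<notin> cball 0 R \<Longrightarrow> F x = 0" and g: "continuous_on UNIV g"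
  shows "(LBINT x. (g x - walk_average s g x) * F x) =
    (\<Sum>u\<in>Basis. LBINT x. (g (x + s *\<^sub>R u) - g x) * (F (x + s *\<^sub>R u) - F x)) / (2 * DIM('a))"
proof -
  note sp = summation_by_parts[OF F g]
  have e: "(g x - walk_average s g x) * F x =
    (\<Sum>u\<in>Basis. (2 * g x - g (x + s *\<^sub>R u) - g (x - s *\<^sub>R u)) * F x) / (2 * DIM('a))" for x
  proof -
    have "(\<Sum>u\<in>(Basis :: 'a set). (2 * g x - g (x + s *\<^sub>R u) - g (x - s *\<^sub>R u)) * F x) =
      (2 * DIM('a) * g x - (\<Sum>u\<in>(Basis :: 'a set). g (x + s *\<^sub>R u) + g (x - s *\<^sub>R u))) * F x"
      unfolding sum_distrib_right[symmetric] by (simp add: sum_subtractf sum.distrib)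
    then show ?thesis
      by (simp add: walk_average_def field_simps)
  qed
  show ?thesis
    unfolding e using sp by (simp add: Bochner_Integration.integral_sum)
qed

text \<open>The step size is such that the walk has covariance \<open>2 \<eta> I\<close>. As \<open>F\<close> is only C1 and \<open>h\<close> only Lipschitz, the
  second differences are split between the two by summation by parts.\<close>

lemma generator_estimate:
  fixes F :: "'a::euclidean_space \<Rightarrow> real" and b DF :: "'a \<Rightarrow> 'a"
  assumes F: "\<And>x. GDERIV F x :> DF x" "continuous_on UNIV DF" "\<And>x. x \<notin> cball 0 R \<Longrightarrow> F x = 0"
    and b: "continuous_on UNIV b" and e: "e > 0"
  shows "\<forall>\<^sub>F \<eta> in at_right (0::real). \<forall>h. lip1 h \<longrightarrow>
    (LBINT x. (h x - walk_average (sqrt (2 * DIM('a) * \<eta>)) (\<lambda>x. h (x + \<eta> *\<^sub>R b x)) x) * F x)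
     \<le> \<eta> * ((LBINT x. norm (DF x - F x *\<^sub>R b x)) + e)"
proof -
  define d where "d = real DIM('a)"
  have d: "d \<ge> 1" using DIM_positive[where 'a='a] unfolding d_def by linarith
  have Fc: "continuous_on UNIV F"
    by (rule GDERIV_imp_continuous_on[OF F(1)])
  have DF0: "DF x = 0" if "x \<notin> cball 0 R" for x
    by (rule GDERIV_eq_0_outside_cball[OF F(1,3) that])
  obtain LF where LF: "LF > 0" "\<And>x. norm (DF x) \<le> LF"
    using continuous_vanishing_bounded[OF F(2) DF0] by blast
  obtain M where M: "M > 0" "\<And>x. x \<in> cball 0 (R + 2) \<Longrightarrow> norm (b x) \<le> M"
    using continuous_bounded_on_cball[OF b] by blast
  define m where "m = measure lborel (cball (0::'a) (R + 1))"
  have m: "m \<ge> 0" by (simp add: m_def)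
  \<comment> \<open>The error \<open>e\<close> is split into quarters: \<open>e'\<close> for the
    drift, \<open>d * e'\<close> for the displacements along the axes,
    \<open>d * (\<omega> * m)\<close> for linearising \<open>F\<close>, and
    \<open>M * LF * m * \<sigma>\<close> for the interaction of drift and noise.\<close>
  define e' where "e' = e / (4 * d)"
  define \<omega> where "\<omega> = e / (4 * d * (m + 1))"
  have e': "e' > 0" "e' \<le> e / 4" "d * e' = e / 4" using e d by (auto simp: e'_def divide_le_eq field_simps)
  have \<omega>: "\<omega> > 0" using e d m by (simp add: \<omega>_def)
  have \<omega>m: "d * (\<omega> * m) \<le> e / 4"
  proof -
    have "d * (\<omega> * m) = e / 4 * (m / (m + 1))" using d by (simp add: \<omega>_def)
    also have "\<dots> \<le> e / 4 * 1" using e m by (intro mult_left_mono) auto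
    finally show ?thesis by simp
  qed
  obtain \<delta> where \<delta>: "\<delta> > 0" "\<And>x y. norm (x - y) < \<delta> \<Longrightarrow> norm (DF x - DF y) < \<omega>"
    using continuous_vanishing_uniform[OF F(2) DF0 \<omega>] by blast
  define s where "s \<eta> = sqrt (2 * DIM('a) * \<eta>)" for \<eta> :: real
  have s0: "filterlim s (at_right 0) (at_right 0)"
    unfolding filterlim_at
  proof
    show "\<forall>\<^sub>F \<eta> in at_right 0. s \<eta> \<in> {0<..} \<and> s \<eta> \<noteq> 0"
      using eventually_at_right_less[of 0] by eventually_elim (auto simp: s_def)
    have "isCont s 0" unfolding s_def by (intro continuous_intros)
    moreover have "s 0 = 0" by (simp add: s_def)
    ultimately show "(s \<longlongrightarrow> 0) (at_right 0)"
      using tendsto_mono[OF at_le[OF subset_UNIV]] by (metis isCont_def)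
  qed
  have cu: "continuous_on UNIV (\<lambda>x. DF x \<bullet> u)" for u
    using F(2) by (intro continuous_intros)
  \<comment> \<open>One radius \<open>r\<close> serves the drift and all axes, so that both leading
    terms contain the same field \<open>mollify_grad r h\<close> and can be combined into one inner
    product.\<close>
  have "\<forall>\<^sub>F r in at_right 0. (0 < r) \<and> (\<forall>\<^sub>F t in at_right 0. \<forall>h. lip1 h \<longrightarrow>
    \<bar>(LBINT x. (h (x + t *\<^sub>R b x) - h x) * F x) -
     t * (LBINT x. (mollify_grad r h x \<bullet> b x) * F x)\<bar> \<le> t * e') \<and>
    (\<forall>u\<in>Basis. \<forall>\<^sub>F t in at_right 0. \<forall>h. lip1 h \<longrightarrow>
    \<bar>(LBINT x. (h (x + t *\<^sub>R u) - h x) * (DF x \<bullet> u)) -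
     t * (LBINT x. (mollify_grad r h x \<bullet> u) * (DF x \<bullet> u))\<bar> \<le> t * e')"
    using DF0 by (intro eventually_conj eventually_at_right_less eventually_ball_finite
        displacement_estimate[OF Fc F(3) b e'(1)]
        ballI displacement_estimate[OF cu _ continuous_on_const e'(1), of R]) auto
  then obtain r where r: "0 < r"
    and D1: "\<forall>\<^sub>F t in at_right 0. \<forall>h. lip1 h \<longrightarrow>
    \<bar>(LBINT x. (h (x + t *\<^sub>R b x) - h x) * F x) -
     t * (LBINT x. (mollify_grad r h x \<bullet> b x) * F x)\<bar> \<le> t * e'"
    and D2: "\<forall>u\<in>Basis. \<forall>\<^sub>F t in at_right 0. \<forall>h. lip1 h \<longrightarrow>
    \<bar>(LBINT x. (h (x + t *\<^sub>R u) - h x) * (DF x \<bullet> u)) -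
     t * (LBINT x. (mollify_grad r h x \<bullet> u) * (DF x \<bullet> u))\<bar> \<le> t * e'"
    using eventually_happens'[OF trivial_limit_at_right_real] by blast
  have D3: "\<forall>\<^sub>F t in at_right 0. \<forall>u\<in>Basis. \<forall>h. lip1 h \<longrightarrow>
    \<bar>(LBINT x. (h (x + t *\<^sub>R u) - h x) * (DF x \<bullet> u)) -
     t * (LBINT x. (mollify_grad r h x \<bullet> u) * (DF x \<bullet> u))\<bar> \<le> t * e'"
    using D2 by (intro eventually_ball_finite) auto
  define \<delta>' where "\<delta>' = min (min \<delta> 1) (e / (4 * (M * LF * m + 1)))"
  have K: "0 \<le> M * LF * m" using M LF m by auto
  have \<delta>': "\<delta>' > 0" using \<delta> e K by (simp add: \<delta>'_def)
  have main: "(LBINT x. (h x - walk_average (s \<eta>) (\<lambda>x. h (x + \<eta> *\<^sub>R b x)) x) * F x)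
     \<le> \<eta> * ((LBINT x. norm (DF x - F x *\<^sub>R b x)) + e)"
    if \<eta>: "0 < \<eta>" "0 < s \<eta>" "s \<eta> < \<delta>'" and h: "lip1 h"
      and A1: "\<bar>(LBINT x. (h (x + \<eta> *\<^sub>R b x) - h x) * F x) -
          \<eta> * (LBINT x. (mollify_grad r h x \<bullet> b x) * F x)\<bar> \<le> \<eta> * e'"
      and A2: "\<And>u. u \<in> Basis \<Longrightarrow> \<bar>(LBINT x. (h (x + s \<eta> *\<^sub>R u) - h x) * (DF x \<bullet> u)) -
          s \<eta> * (LBINT x. (mollify_grad r h x \<bullet> u) * (DF x \<bullet> u))\<bar> \<le> s \<eta> * e'" for \<eta> h
  proof -
    define n where "n = mollify_grad r h"
    define \<sigma> where "\<sigma> = s \<eta>"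
    have \<sigma>: "0 < \<sigma>" "\<sigma> < \<delta>" "\<sigma> < 1" "\<sigma>\<^sup>2 = 2 * d * \<eta>"
      using \<eta> by (auto simp: \<sigma>_def \<delta>'_def s_def d_def)
    have \<sigma>K: "M * LF * m * \<sigma> \<le> e / 4"
    proof -
      have "M * LF * m * \<sigma> \<le> (M * LF * m) * (e / (4 * (M * LF * m + 1)))"
        using \<eta> K by (intro mult_left_mono) (auto simp: \<sigma>_def \<delta>'_def)
      also have "\<dots> = e / 4 * (M * LF * m / (M * LF * m + 1))" by simp
      also have "\<dots> \<le> e / 4 * 1" using e K by (intro mult_left_mono) auto
      finally show ?thesis by simp
    qed
    have hm: "\<And>x y. \<bar>h x - h y\<bar> \<le> norm (x - y)" using h by blast
    have hc: "continuous_on A h" for A by (rule lip1_continuous[OF h])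
    have nc: "continuous_on UNIV n"
      unfolding n_def by (rule mollify_grad_continuous[OF r continuous_locally_integrable[OF hc]])
    have n1: "norm (n x) \<le> 1" for x
      unfolding n_def by (rule mollify_grad_lipschitz_norm[OF r hm])
    define \<psi> where "\<psi> x = h (x + \<eta> *\<^sub>R b x)" for x
    have \<psi>c: "continuous_on UNIV \<psi>"
      unfolding \<psi>_def by (intro continuous_on_compose2[OF hc[of UNIV]] continuous_intros b) auto
    have gF: "integrable lborel (\<lambda>x. w x * F x)" if "continuous_on UNIV w" for w
      using Fc F(3) that by (intro continuous_vanishing_integrable[of _ R]) (auto intro!: continuous_intros)
    have gD: "integrable lborel (\<lambda>x. w x * (DF x \<bullet> u))" if "continuous_on UNIV w" for w u
      using F(2) DF0 that by (intro continuous_vanishing_integrable[of _ R]) (auto intro!: continuous_intros)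
    have hs: "continuous_on UNIV (\<lambda>x. h (x + c))" for c
      by (intro continuous_on_compose2[OF hc[of UNIV]] continuous_intros) auto
    have \<psi>h: "continuous_on UNIV (\<lambda>x. \<psi> x - h x)" by (intro continuous_intros \<psi>c hc)
    \<comment> \<open>The step is split into drift alone (\<open>T1\<close>), noise alone
      (\<open>T2\<close>) and their interaction (\<open>T3\<close>). The first two have order
      \<eta>, the last has order \<open>\<eta> * \<sigma>\<close>.\<close>
    define T1 where "T1 = (LBINT x. (h x - \<psi> x) * F x)"
    define T2 where "T2 = (LBINT x. (h x - walk_average \<sigma> h x) * F x)"
    define T3 where "T3 = (LBINT x. ((\<psi> x - h x) - walk_average \<sigma> (\<lambda>x. \<psi> x - h x) x) * F x)"
    have split: "(LBINT x. (h x - walk_average \<sigma> \<psi> x) * F x) = T1 + T2 + T3"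
    proof -
      have wd: "walk_average \<sigma> (\<lambda>x. \<psi> x - h x) x = walk_average \<sigma> \<psi> x - walk_average \<sigma> h x" for x
        unfolding walk_average_def diff_divide_distrib[symmetric] sum_subtractf[symmetric]
        by (simp add: algebra_simps)
      have "(LBINT x. (h x - walk_average \<sigma> \<psi> x) * F x) =
        (LBINT x. (h x - \<psi> x) * F x + (h x - walk_average \<sigma> h x) * F x + ((\<psi> x - h x) - walk_average \<sigma> (\<lambda>x. \<psi> x - h x) x) * F x)"
        unfolding wd by (rule Bochner_Integration.integral_cong) (auto simp: algebra_simps)
      also have "\<dots> = T1 + T2 + T3"
        unfolding T1_def T2_def T3_def
        by (subst Bochner_Integration.integral_add Bochner_Integration.integral_add,
            (intro Bochner_Integration.integrable_add gF continuous_intros \<psi>c hc walk_average_continuous \<psi>h)+)+ simp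
      finally show ?thesis .
    qed
    have T1: "T1 \<le> - \<eta> * (LBINT x. (n x \<bullet> b x) * F x) + \<eta> * e'"
    proof -
      have "T1 = - (LBINT x. (h (x + \<eta> *\<^sub>R b x) - h x) * F x)"
        unfolding T1_def \<psi>_def
        by (subst Bochner_Integration.integral_minus[symmetric]) (simp add: algebra_simps)
      then show ?thesis using A1 by (simp add: n_def)
    qed
    have T2: "T2 \<le> \<eta> * (LBINT x. n x \<bullet> DF x) + \<eta> * (d * e') + \<eta> * (d * (\<omega> * m))"
    proof -
      \<comment> \<open>Only the difference of \<open>F\<close> is linearised. The difference of
        \<open>h\<close> is treated under the integral against \<open>DF x \<bullet> u\<close>,
        where the displacement estimate applies; each supplies one factor \<sigma>.\<close>
      have one: "(LBINT x. (h (x + \<sigma> *\<^sub>R u) - h x) * (F (x + \<sigma> *\<^sub>R u) - F x))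
          \<le> \<sigma>\<^sup>2 * ((LBINT x. (n x \<bullet> u) * (DF x \<bullet> u)) + e' + \<omega> * m)" if u: "u \<in> Basis" for u
      proof -
        have nu: "norm (\<sigma> *\<^sub>R u) = \<sigma>" using u \<sigma> by simp
        define q where "q x = (h (x + \<sigma> *\<^sub>R u) - h x) * (F (x + \<sigma> *\<^sub>R u) - F x - \<sigma> * (DF x \<bullet> u))" for x
        have qb: "\<bar>integral\<^sup>L lborel q\<bar> \<le> (\<sigma> * (\<omega> * \<sigma>)) * m"
          unfolding m_def
        proof (rule integral_bound_on_cball)
          fix x :: 'a
          have "\<bar>F (x + \<sigma> *\<^sub>R u) - F x - (\<sigma> *\<^sub>R u) \<bullet> DF x\<bar> \<le> \<omega> * norm (\<sigma> *\<^sub>R u)"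
          proof (rule GDERIV_linear_remainder[OF F(1)])
            fix z assume "z \<in> closed_segment x (x + \<sigma> *\<^sub>R u)"
            then have "norm (z - x) \<le> \<sigma>"
              using segment_bound1[of z x "x + \<sigma> *\<^sub>R u"] nu by simp
            then show "norm (DF z - DF x) \<le> \<omega>" using \<delta>(2)[of z x] \<sigma> by simp
          qed
          moreover have "\<bar>h (x + \<sigma> *\<^sub>R u) - h x\<bar> \<le> \<sigma>"
            using hm[of "x + \<sigma> *\<^sub>R u" x] nu by simp
          ultimately show "\<bar>q x\<bar> \<le> \<sigma> * (\<omega> * \<sigma>)"
            unfolding q_def abs_mult using nu \<sigma> by (intro mult_mono) (auto simp: inner_commute)
          assume x: "x \<notin> cball 0 (R + 1)"
          then have "x + \<sigma> *\<^sub>R u \<notin> cball 0 R" "x \<notin> cball 0 R"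
            using norm_triangle_ineq2[of x "- (\<sigma> *\<^sub>R u)"] nu \<sigma> by auto
          then show "q x = 0" using F(3) DF0 by (simp add: q_def)
        qed (use \<sigma> \<omega> in auto)
        have i1: "integrable lborel (\<lambda>x. (h (x + \<sigma> *\<^sub>R u) - h x) * (DF x \<bullet> u))"
          by (intro gD continuous_intros hs hc)
        have i2: "integrable lborel q"
        proof (rule continuous_vanishing_integrable[of _ "R + 1"])
          show "continuous_on UNIV q"
            unfolding q_def by (intro continuous_intros hs hc cu Fc continuous_on_compose2[OF Fc]) auto
          fix x :: 'a assume x: "x \<notin> cball 0 (R + 1)"
          then have "x + \<sigma> *\<^sub>R u \<notin> cball 0 R" "x \<notin> cball 0 R"
            using norm_triangle_ineq2[of x "- (\<sigma> *\<^sub>R u)"] nu \<sigma> by auto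
          then show "q x = 0" using F(3) DF0 by (simp add: q_def)
        qed
        have "(LBINT x. (h (x + \<sigma> *\<^sub>R u) - h x) * (F (x + \<sigma> *\<^sub>R u) - F x))
          = (LBINT x. \<sigma> * ((h (x + \<sigma> *\<^sub>R u) - h x) * (DF x \<bullet> u)) + q x)"
          by (rule Bochner_Integration.integral_cong) (auto simp: q_def algebra_simps)
        also have "\<dots> = \<sigma> * (LBINT x. (h (x + \<sigma> *\<^sub>R u) - h x) * (DF x \<bullet> u)) + integral\<^sup>L lborel q"
          using i1 i2 by simp
        also have "\<dots> \<le> \<sigma> * (\<sigma> * (LBINT x. (n x \<bullet> u) * (DF x \<bullet> u)) + \<sigma> * e') + (\<sigma> * (\<omega> * \<sigma>)) * m"
          using A2[OF u, folded \<sigma>_def n_def] qb \<sigma> by (intro add_mono mult_left_mono) auto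
        finally show ?thesis by (simp add: power2_eq_square algebra_simps)
      qed
      have "T2 \<le> (\<Sum>u\<in>Basis. \<sigma>\<^sup>2 * ((LBINT x. (n x \<bullet> u) * (DF x \<bullet> u)) + e' + \<omega> * m)) / (2 * d)"
      proof -
        have "T2 = (\<Sum>u\<in>Basis. LBINT x. (h (x + \<sigma> *\<^sub>R u) - h x) * (F (x + \<sigma> *\<^sub>R u) - F x)) / (2 * d)"
          unfolding T2_def d_def using walk_average_by_parts[OF Fc F(3) hc] by simp
        then show ?thesis
          using one d by (auto intro!: divide_right_mono sum_mono)
      qed
      also have "\<dots> = \<eta> * ((\<Sum>u\<in>Basis. LBINT x. (n x \<bullet> u) * (DF x \<bullet> u)) + d * (e' + \<omega> * m))"
      proof -
        have "(\<Sum>u\<in>(Basis :: 'a set). \<sigma>\<^sup>2 * ((LBINT x. (n x \<bullet> u) * (DF x \<bullet> u)) + e' + \<omega> * m)) =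
          \<sigma>\<^sup>2 * ((\<Sum>u\<in>Basis. LBINT x. (n x \<bullet> u) * (DF x \<bullet> u)) + d * (e' + \<omega> * m))"
          unfolding sum_distrib_left[symmetric] by (simp add: sum.distrib d_def distrib_left)
        \<comment> \<open>By the choice of the step length,
          \<open>\<sigma>\<^sup>2 / (2 * d) = \<eta>\<close>.\<close>
        then show ?thesis unfolding \<sigma>(4) using d by simp
      qed
      also have "(\<Sum>u\<in>Basis. LBINT x. (n x \<bullet> u) * (DF x \<bullet> u)) = (LBINT x. n x \<bullet> DF x)"
        by (subst Bochner_Integration.integral_sum[symmetric])
          (auto intro!: gD continuous_intros nc simp: euclidean_inner[symmetric])
      finally show ?thesis by (simp add: algebra_simps)
    qed
    \<comment> \<open>Crude bounds suffice: on the relevant ball \<open>\<psi> - h\<close> is at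
      most \<open>\<eta> * M\<close>, and the difference of \<open>F\<close> is at most
      \<open>LF * \<sigma>\<close>, so the product is of smaller order than \<eta>.\<close>
    have T3: "T3 \<le> \<eta> * (M * LF * m * \<sigma>)"
    proof -
      have one: "(LBINT x. ((\<psi> (x + \<sigma> *\<^sub>R u) - h (x + \<sigma> *\<^sub>R u)) - (\<psi> x - h x)) * (F (x + \<sigma> *\<^sub>R u) - F x))
          \<le> 2 * \<eta> * (M * LF * m * \<sigma>)" if u: "u \<in> Basis" for u
      proof -
        have nu: "norm (\<sigma> *\<^sub>R u) = \<sigma>" using u \<sigma> by simp
        have "\<bar>LBINT x. ((\<psi> (x + \<sigma> *\<^sub>R u) - h (x + \<sigma> *\<^sub>R u)) - (\<psi> x - h x)) * (F (x + \<sigma> *\<^sub>R u) - F x)\<bar>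
          \<le> ((2 * (\<eta> * M)) * (LF * \<sigma>)) * m"
          unfolding m_def
        proof (rule integral_bound_on_cball)
          fix x :: 'a
          assume x: "x \<in> cball 0 (R + 1)"
          have \<psi>h: "\<bar>\<psi> y - h y\<bar> \<le> \<eta> * M" if "y \<in> cball 0 (R + 2)" for y
          proof -
            have "\<eta> * norm (b y) \<le> \<eta> * M" using \<eta> by (intro mult_left_mono M(2)[OF that]) simp
            moreover have "\<bar>\<psi> y - h y\<bar> \<le> \<eta> * norm (b y)"
              using hm[of "y + \<eta> *\<^sub>R b y" y] \<eta> by (simp add: \<psi>_def)
            ultimately show ?thesis by linarith
          qed
          have "x + \<sigma> *\<^sub>R u \<in> cball 0 (R + 2)" "x \<in> cball 0 (R + 2)"
            using x norm_triangle_ineq[of x "\<sigma> *\<^sub>R u"] nu \<sigma> by auto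
          then have "\<bar>(\<psi> (x + \<sigma> *\<^sub>R u) - h (x + \<sigma> *\<^sub>R u)) - (\<psi> x - h x)\<bar> \<le> 2 * (\<eta> * M)"
            using \<psi>h[of "x + \<sigma> *\<^sub>R u"] \<psi>h[of x] by linarith
          moreover have "\<bar>F (x + \<sigma> *\<^sub>R u) - F x\<bar> \<le> LF * \<sigma>"
            using GDERIV_lipschitz_bound[OF F(1) LF(2), of "x + \<sigma> *\<^sub>R u" x] nu by simp
          ultimately show "\<bar>((\<psi> (x + \<sigma> *\<^sub>R u) - h (x + \<sigma> *\<^sub>R u)) - (\<psi> x - h x)) * (F (x + \<sigma> *\<^sub>R u) - F x)\<bar>
            \<le> 2 * (\<eta> * M) * (LF * \<sigma>)"
            unfolding abs_mult using \<eta> M by (intro mult_mono) auto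
        next
          fix x :: 'a
          assume x: "x \<notin> cball 0 (R + 1)"
          then have "x + \<sigma> *\<^sub>R u \<notin> cball 0 R" "x \<notin> cball 0 R"
            using norm_triangle_ineq2[of x "- (\<sigma> *\<^sub>R u)"] nu \<sigma> by auto
          then show "((\<psi> (x + \<sigma> *\<^sub>R u) - h (x + \<sigma> *\<^sub>R u)) - (\<psi> x - h x)) * (F (x + \<sigma> *\<^sub>R u) - F x) = 0"
            using F(3) by simp
        qed (use \<sigma> \<eta> M LF in auto)
        then show ?thesis by (simp add: mult_ac)
      qed
      have "T3 \<le> (\<Sum>u\<in>(Basis :: 'a set). 2 * \<eta> * (M * LF * m * \<sigma>)) / (2 * d)"
      proof -
        have "T3 = (\<Sum>u\<in>Basis. LBINT x. ((\<psi> (x + \<sigma> *\<^sub>R u) - h (x + \<sigma> *\<^sub>R u)) - (\<psi> x - h x)) * (F (x + \<sigma> *\<^sub>R u) - F x)) / (2 * d)"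
          unfolding T3_def d_def using walk_average_by_parts[OF Fc F(3) \<psi>h] by simp
        then show ?thesis
          using d by (simp only:) (intro divide_right_mono sum_mono one; simp)
      qed
      also have "\<dots> = \<eta> * (M * LF * m * \<sigma>)"
        using d by (simp add: d_def[symmetric])
      finally show ?thesis .
    qed
    \<comment> \<open>The leading terms form the integral of
      \<open>n x \<bullet> (DF x - F x *\<^sub>R b x)\<close>, and \<open>n\<close> has norm at most
      1 because \<open>h\<close> is 1-Lipschitz.\<close>
    have "(LBINT x. n x \<bullet> DF x) - (LBINT x. (n x \<bullet> b x) * F x) \<le> (LBINT x. norm (DF x - F x *\<^sub>R b x))"
    proof -
      have i: "integrable lborel (\<lambda>x. DF x - F x *\<^sub>R b x)" "integrable lborel (\<lambda>x. n x \<bullet> DF x)"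
        using F DF0 Fc b nc by (auto intro!: continuous_vanishing_integrable[of _ R] continuous_intros)
      have j: "integrable lborel (\<lambda>x. (n x \<bullet> b x) * F x)"
        by (intro gF continuous_intros nc b)
      have "(LBINT x. n x \<bullet> DF x) - (LBINT x. (n x \<bullet> b x) * F x) =
        (LBINT x. n x \<bullet> DF x - (n x \<bullet> b x) * F x)"
        using i j by simp
      also have "\<dots> \<le> (LBINT x. norm (DF x - F x *\<^sub>R b x))"
      proof (rule integral_mono)
        show "integrable lborel (\<lambda>x. n x \<bullet> DF x - (n x \<bullet> b x) * F x)" using i j by simp
        show "n x \<bullet> DF x - (n x \<bullet> b x) * F x \<le> norm (DF x - F x *\<^sub>R b x)" for x
        proof -
          have "n x \<bullet> DF x - (n x \<bullet> b x) * F x = n x \<bullet> (DF x - F x *\<^sub>R b x)"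
            by (simp add: inner_diff_right)
          also have "\<dots> \<le> norm (n x) * norm (DF x - F x *\<^sub>R b x)" by (rule norm_cauchy_schwarz)
          also have "\<dots> \<le> 1 * norm (DF x - F x *\<^sub>R b x)" using n1[of x] by (intro mult_right_mono) auto
          finally show ?thesis by simp
        qed
      qed (use i in simp)
      finally show ?thesis .
    qed
    from mult_left_mono[OF this, of \<eta>]
    have "\<eta> * (LBINT x. n x \<bullet> DF x) - \<eta> * (LBINT x. (n x \<bullet> b x) * F x) \<le> \<eta> * (LBINT x. norm (DF x - F x *\<^sub>R b x))"
      using \<eta> by (simp add: right_diff_distrib)
    moreover have "\<eta> * e' + \<eta> * (d * e') + \<eta> * (d * (\<omega> * m)) + \<eta> * (M * LF * m * \<sigma>) \<le> \<eta> * e"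
    proof -
      have "e' + d * e' + d * (\<omega> * m) + M * LF * m * \<sigma> \<le> e"
        using e' \<omega>m \<sigma>K by linarith
      from mult_left_mono[OF this, of \<eta>] show ?thesis using \<eta> by (simp add: distrib_left)
    qed
    ultimately have "T1 + T2 + T3 \<le> \<eta> * (LBINT x. norm (DF x - F x *\<^sub>R b x)) + \<eta> * e"
      using T1 T2 T3 by linarith
    then show ?thesis
      using split unfolding \<sigma>_def \<psi>_def by (simp add: distrib_left)
  qed
  have "\<forall>\<^sub>F \<eta> in at_right 0. 0 < \<eta> \<and> (0 < s \<eta> \<and> s \<eta> < \<delta>') \<and> (\<forall>h. lip1 h \<longrightarrow>
    \<bar>(LBINT x. (h (x + \<eta> *\<^sub>R b x) - h x) * F x) -
     \<eta> * (LBINT x. (mollify_grad r h x \<bullet> b x) * F x)\<bar> \<le> \<eta> * e') \<and>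
    (\<forall>u\<in>Basis. \<forall>h. lip1 h \<longrightarrow>
    \<bar>(LBINT x. (h (x + s \<eta> *\<^sub>R u) - h x) * (DF x \<bullet> u)) -
     s \<eta> * (LBINT x. (mollify_grad r h x \<bullet> u) * (DF x \<bullet> u))\<bar> \<le> s \<eta> * e')"
  proof (intro eventually_conj)
    show "\<forall>\<^sub>F \<eta> in at_right 0. 0 < s \<eta>"
      by (rule eventually_compose_filterlim[OF eventually_at_right_less s0])
    have "\<forall>\<^sub>F t in at_right 0. t < \<delta>'"
      using \<delta>' by (intro eventually_at_rightI[of 0 \<delta>']) auto
    then show "\<forall>\<^sub>F \<eta> in at_right 0. s \<eta> < \<delta>'"
      by (rule eventually_compose_filterlim[OF _ s0])
  qed (use D1 eventually_compose_filterlim[OF D3 s0] eventually_at_right_less[of 0] in auto)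
  then show ?thesis
    by eventually_elim (use main in \<open>auto simp: s_def\<close>)
qed

text \<open>The contraction argument. A local Lipschitz bound on \<open>b\<close> is enough for it:
  from \<open>cball 0 R\<close>, where \<open>F\<close> lives, a noise step shorter than 1 leads
  into \<open>cball 0 (R + 1)\<close>, and there the drift is evaluated.\<close>

lemma transport_bound_lipschitz_drift:
  fixes F :: "'a::euclidean_space \<Rightarrow> real" and b DF :: "'a \<Rightarrow> 'a"
  assumes F: "\<And>x. GDERIV F x :> DF x" "continuous_on UNIV DF" "\<And>x. x \<notin> cball 0 R \<Longrightarrow> F x = 0"
    "(LBINT x. F x) = 0"
    and b: "continuous_on UNIV b" "\<And>x y. (y - x) \<bullet> (b y - b x) \<le> - k * (norm (y - x))\<^sup>2"
    "\<And>x y. x \<in> cball 0 (R + 1) \<Longrightarrow> y \<in> cball 0 (R + 1) \<Longrightarrow> norm (b x - b y) \<le> L * norm (x - y)"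
    and R: "R > 0" and k: "k \<ge> 0" and h: "lip1 h"
  shows "k * (LBINT x. h x * F x) \<le> (LBINT x. norm (DF x - F x *\<^sub>R b x))"
proof -
  define D where "D = (LBINT x. norm (DF x - F x *\<^sub>R b x))"
  have Fc: "continuous_on UNIV F"
    by (rule GDERIV_imp_continuous_on[OF F(1)])
  obtain B where B: "B > 0" "\<And>x. \<bar>F x\<bar> \<le> B"
    using continuous_vanishing_bounded[OF Fc F(3)] by (metis real_norm_def)
  have gF: "integrable lborel (\<lambda>x. w x * F x)" if "continuous_on UNIV w" for w
    using Fc F(3) that by (intro continuous_vanishing_integrable[of _ R]) (auto intro!: continuous_intros)
  define A where "A = {h :: 'a \<Rightarrow> real. lip1 h}"
  have A0: "(\<lambda>_. 0) \<in> A" by (simp add: A_def)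
  define S where "S = (SUP h\<in>A. LBINT x. h x * F x)"
  \<comment> \<open>Because \<open>F\<close> has integral 0, \<open>h\<close> may be replaced by
    \<open>h x - h 0\<close>, which is at most \<open>R\<close> in absolute value on the support of
    \<open>F\<close>.\<close>
  have bdd: "bdd_above ((\<lambda>h. LBINT x. h x * F x) ` A)"
  proof (rule bdd_aboveI2)
    fix h assume "h \<in> A"
    then have h: "lip1 h" by (simp add: A_def)
    have hc: "continuous_on UNIV h" by (rule lip1_continuous[OF h])
    have "(LBINT x. (h x - h 0) * F x) = (LBINT x. h x * F x) - (LBINT x. h 0 * F x)"
      unfolding left_diff_distrib by (rule Bochner_Integration.integral_diff) (intro gF hc continuous_on_const)+
    also have "\<dots> = (LBINT x. h x * F x)"
    proof -
      have "(LBINT x. h 0 * F x) = h 0 * (LBINT x. F x)" by (rule integral_mult_right_zero)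
      then show ?thesis using F(4) by simp
    qed
    finally have eq: "(LBINT x. h x * F x) = (LBINT x. (h x - h 0) * F x)" by simp
    have "\<bar>LBINT x. (h x - h 0) * F x\<bar> \<le> (R * B) * measure lborel (cball (0::'a) R)"
    proof (rule integral_bound_on_cball)
      fix x :: 'a assume x: "x \<in> cball 0 R"
      have "\<bar>h x - h 0\<bar> \<le> R" using h[rule_format, of x 0] x by simp
      then show "\<bar>(h x - h 0) * F x\<bar> \<le> R * B"
        unfolding abs_mult using B R by (intro mult_mono) auto
    qed (use F(3) R B in auto)
    then show "(LBINT x. h x * F x) \<le> (R * B) * measure lborel (cball (0::'a) R)"
      using eq by simp
  qed
  have le_S: "(LBINT x. h x * F x) \<le> S" if "lip1 h" for h
    unfolding S_def using that bdd by (intro cSUP_upper) (auto simp: A_def)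
  have S0: "0 \<le> S" using le_S[of "\<lambda>_. 0"] by simp
  have "S * k \<le> D + e" if e: "e > 0" for e
  proof -
    define s where "s \<eta> = sqrt (2 * DIM('a) * \<eta>)" for \<eta> :: real
    have "((\<lambda>\<eta>. s \<eta>) \<longlongrightarrow> s 0) (at_right 0)"
      unfolding s_def by (intro tendsto_intros)
    then have "\<forall>\<^sub>F \<eta> in at_right 0. s \<eta> < 1"
      by (rule order_tendstoD) (simp add: s_def)
    moreover have "((\<lambda>\<eta>. 1 - k * \<eta> + L\<^sup>2 * \<eta>\<^sup>2 / 2) \<longlongrightarrow> 1 - k * 0 + L\<^sup>2 * 0\<^sup>2 / 2) (at_right (0::real))"
      by (intro tendsto_intros) simp
    then have "\<forall>\<^sub>F \<eta> in at_right 0. 0 < 1 - k * \<eta> + L\<^sup>2 * \<eta>\<^sup>2 / 2"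
      by (rule order_tendstoD) simp
    moreover have "\<forall>\<^sub>F \<eta> in at_right 0. \<forall>h. lip1 h \<longrightarrow>
      (LBINT x. (h x - walk_average (s \<eta>) (\<lambda>x. h (x + \<eta> *\<^sub>R b x)) x) * F x) \<le> \<eta> * (D + e)"
      unfolding D_def s_def by (rule generator_estimate[OF F(1,2,3) b(1) e])
    moreover have "\<forall>\<^sub>F \<eta>::real in at_right 0. 0 < \<eta>" by (rule eventually_at_right_less)
    ultimately have "\<forall>\<^sub>F \<eta> in at_right 0. S * (k - L\<^sup>2 * \<eta> / 2) \<le> D + e"
    proof eventually_elim
      case (elim \<eta>)
      \<comment> \<open>With \<open>u = - k * \<eta> + L\<^sup>2 * \<eta>\<^sup>2 / 2\<close>,
        expanding the square gives the factor \<open>1 + 2 * u\<close>, which is at most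
        \<open>(1 + u)\<^sup>2\<close>.\<close>
      define \<kappa> where "\<kappa> = 1 - k * \<eta> + L\<^sup>2 * \<eta>\<^sup>2 / 2"
      have \<kappa>: "0 < \<kappa>" using elim by (simp add: \<kappa>_def)
      have \<eta>: "0 < \<eta>" using elim by simp
      have s1: "0 \<le> s \<eta>" "s \<eta> < 1" using elim \<eta> by (auto simp: s_def)
      define T where "T x = x + \<eta> *\<^sub>R b x" for x
      have T: "norm (T x - T y) \<le> \<kappa> * norm (x - y)" if xy: "x \<in> cball 0 (R + 1)" "y \<in> cball 0 (R + 1)" for x y
      proof (rule power2_le_imp_le)
        have "T x - T y = (x - y) + \<eta> *\<^sub>R (b x - b y)" by (simp add: T_def algebra_simps)
        moreover have "(norm (u + \<eta> *\<^sub>R v))\<^sup>2 = (norm u)\<^sup>2 + 2 * \<eta> * (u \<bullet> v) + \<eta>\<^sup>2 * (norm v)\<^sup>2" for u v :: 'a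
          unfolding power2_norm_eq_inner inner_add_left inner_add_right inner_scaleR_left inner_scaleR_right
          by (simp add: inner_commute[of v u] power2_eq_square algebra_simps)
        ultimately have "(norm (T x - T y))\<^sup>2 = (norm (x - y))\<^sup>2 + 2 * \<eta> * ((x - y) \<bullet> (b x - b y)) + \<eta>\<^sup>2 * (norm (b x - b y))\<^sup>2"
          by simp
        also have "\<dots> \<le> (norm (x - y))\<^sup>2 + 2 * \<eta> * (- k * (norm (x - y))\<^sup>2) + \<eta>\<^sup>2 * (L * norm (x - y))\<^sup>2"
          using b(2)[of x y] b(3)[OF xy] \<eta> by (intro add_mono mult_left_mono power_mono) auto
        also have "\<dots> = (1 + 2 * (- k * \<eta> + L\<^sup>2 * \<eta>\<^sup>2 / 2)) * (norm (x - y))\<^sup>2"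
          by (simp add: power_mult_distrib algebra_simps)
        also have "\<dots> \<le> \<kappa>\<^sup>2 * (norm (x - y))\<^sup>2"
        proof (rule mult_right_mono)
          have "\<kappa>\<^sup>2 = 1 + 2 * (- k * \<eta> + L\<^sup>2 * \<eta>\<^sup>2 / 2) + (- k * \<eta> + L\<^sup>2 * \<eta>\<^sup>2 / 2)\<^sup>2"
            unfolding \<kappa>_def by (simp add: power2_eq_square algebra_simps)
          then show "1 + 2 * (- k * \<eta> + L\<^sup>2 * \<eta>\<^sup>2 / 2) \<le> \<kappa>\<^sup>2" by simp
        qed simp
        finally show "(norm (T x - T y))\<^sup>2 \<le> (\<kappa> * norm (x - y))\<^sup>2" by (simp add: power_mult_distrib)
      qed (use \<kappa> in simp)
      have "(LBINT x. h x * F x) \<le> \<eta> * (D + e) + \<kappa> * S" if h: "h \<in> A" for h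
      proof -
        have hl: "lip1 h" using h by (simp add: A_def)
        have hc: "continuous_on UNIV h" by (rule lip1_continuous[OF hl])
        define P where "P = walk_average (s \<eta>) (\<lambda>x. h (T x))"
        have Pc: "continuous_on UNIV P"
          unfolding P_def T_def
          by (intro walk_average_continuous continuous_on_compose2[OF hc] continuous_intros b(1)) auto
        have P_lip: "\<bar>P x - P y\<bar> \<le> \<kappa> * norm (x - y)" if xy: "x \<in> cball 0 R" "y \<in> cball 0 R" for x y
        proof -
          have one: "\<bar>h (T (x + a)) - h (T (y + a))\<bar> \<le> \<kappa> * norm (x - y)" if "norm a \<le> 1" for a
          proof -
            have "x + a \<in> cball 0 (R + 1)" "y + a \<in> cball 0 (R + 1)"
              using xy that norm_triangle_ineq[of x a] norm_triangle_ineq[of y a] by auto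
            then have "norm (T (x + a) - T (y + a)) \<le> \<kappa> * norm (x - y)"
              using T[of "x + a" "y + a"] by simp
            then show ?thesis using hl[rule_format, of "T (x + a)" "T (y + a)"] by linarith
          qed
          have "P x - P y = (\<Sum>u\<in>Basis. (h (T (x + s \<eta> *\<^sub>R u)) - h (T (y + s \<eta> *\<^sub>R u)))
             + (h (T (x + - (s \<eta> *\<^sub>R u))) - h (T (y + - (s \<eta> *\<^sub>R u))))) / (2 * DIM('a))"
            unfolding P_def walk_average_def diff_divide_distrib[symmetric] sum_subtractf[symmetric]
            by (simp add: algebra_simps)
          also have "\<bar>\<dots>\<bar> \<le> (\<Sum>u\<in>(Basis::'a set). 2 * (\<kappa> * norm (x - y))) / (2 * DIM('a))"
            unfolding abs_divide
          proof (rule divide_mono)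
            show "\<bar>\<Sum>u\<in>Basis. (h (T (x + s \<eta> *\<^sub>R u)) - h (T (y + s \<eta> *\<^sub>R u)))
             + (h (T (x + - (s \<eta> *\<^sub>R u))) - h (T (y + - (s \<eta> *\<^sub>R u))))\<bar> \<le> (\<Sum>u\<in>(Basis::'a set). 2 * (\<kappa> * norm (x - y)))"
            proof (rule order_trans[OF sum_abs], rule sum_mono)
              fix u :: 'a assume u: "u \<in> Basis"
              show "\<bar>(h (T (x + s \<eta> *\<^sub>R u)) - h (T (y + s \<eta> *\<^sub>R u)))
                + (h (T (x + - (s \<eta> *\<^sub>R u))) - h (T (y + - (s \<eta> *\<^sub>R u))))\<bar> \<le> 2 * (\<kappa> * norm (x - y))"
                using one[of "s \<eta> *\<^sub>R u"] one[of "- (s \<eta> *\<^sub>R u)"] u s1 by (simp del: add_uminus_conv_diff)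
            qed
          qed auto
          also have "\<dots> = \<kappa> * norm (x - y)" by simp
          finally show ?thesis .
        qed
        \<comment> \<open>\<open>P\<close> contracts only on the ball; projecting first makes the bound global and changes nothing where \<open>F \<noteq> 0\<close>.\<close>
        define h' where "h' x = P (closest_point (cball 0 R) x) / \<kappa>" for x
        have cp: "closest_point (cball 0 R) x \<in> cball 0 R" for x :: 'a
          using R by (intro closest_point_in_set) auto
        have "lip1 h'"
        proof (intro allI)
          fix x y
          have "\<bar>P (closest_point (cball 0 R) x) - P (closest_point (cball 0 R) y)\<bar> \<le>
             \<kappa> * norm (closest_point (cball 0 R) x - closest_point (cball 0 R) y)"
            by (rule P_lip[OF cp cp])
          also have "\<dots> \<le> \<kappa> * norm (x - y)"
            using closest_point_lipschitz[of "cball 0 R" x y] R \<kappa> by (intro mult_left_mono) (auto simp: dist_norm)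
          finally show "\<bar>h' x - h' y\<bar> \<le> norm (x - y)"
            using \<kappa> by (simp add: h'_def diff_divide_distrib[symmetric] field_simps)
        qed
        have "(LBINT x. P x * F x) = (LBINT x. \<kappa> * (h' x * F x))"
        proof (rule Bochner_Integration.integral_cong)
          show "P x * F x = \<kappa> * (h' x * F x)" for x
            using F(3)[of x] closest_point_self[of x "cball 0 R"] \<kappa> by (cases "x \<in> cball 0 R") (auto simp: h'_def)
        qed simp
        also have "\<dots> \<le> \<kappa> * S" using le_S[OF \<open>lip1 h'\<close>] \<kappa> by simp
        finally have PS: "(LBINT x. P x * F x) \<le> \<kappa> * S" .
        have "(LBINT x. h x * F x) = (LBINT x. (h x - P x) * F x + P x * F x)"
          by (rule Bochner_Integration.integral_cong) (auto simp: algebra_simps)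
        also have "\<dots> = (LBINT x. (h x - P x) * F x) + (LBINT x. P x * F x)"
          by (rule Bochner_Integration.integral_add) (intro gF continuous_intros hc Pc)+
        also have "(LBINT x. (h x - P x) * F x) \<le> \<eta> * (D + e)"
          using elim(3) hl unfolding P_def T_def by blast
        finally show ?thesis using PS by simp
      qed
      \<comment> \<open>Here \<open>\<kappa> * S\<close> is absorbed on the left, leaving a multiple
        of \<eta> on both sides; after division the second-order term disappears as \<eta> tends to
        0.\<close>
      then have "S \<le> \<eta> * (D + e) + \<kappa> * S"
        unfolding S_def[symmetric] by (subst (1) S_def) (rule cSUP_least; use A0 in auto)
      then have "\<eta> * (S * (k - L\<^sup>2 * \<eta> / 2)) \<le> \<eta> * (D + e)"
        by (simp add: \<kappa>_def power2_eq_square algebra_simps)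
      then show ?case using \<eta> by simp
    qed
    moreover have "((\<lambda>\<eta>. S * (k - L\<^sup>2 * \<eta> / 2)) \<longlongrightarrow> S * (k - L\<^sup>2 * 0 / 2)) (at_right (0::real))"
      by (intro tendsto_intros) simp
    ultimately have "S * (k - L\<^sup>2 * 0 / 2) \<le> D + e"
      by (intro tendsto_upperbound) auto
    then show ?thesis by simp
  qed
  then have SD: "S * k \<le> D" by (rule field_le_epsilon)
  have "k * (LBINT x. h x * F x) \<le> k * S" using le_S[OF h] k by (intro mult_left_mono)
  then show ?thesis using SD by (simp add: D_def mult.commute)
qed

text \<open>Monotonicity compares \<open>b\<close> at two points whose difference is unchanged by a
  common translation, so it survives averaging with the same \<open>k\<close>.\<close>

lemma mollify_monotone:
  fixes b :: "'a::euclidean_space \<Rightarrow> 'a"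
  assumes r: "r > 0" and b: "continuous_on UNIV b" "\<And>x y. (y - x) \<bullet> (b y - b x) \<le> - k * (norm (y - x))\<^sup>2"
  shows "(y - x) \<bullet> (mollify r b y - mollify r b x) \<le> - k * (norm (y - x))\<^sup>2"
proof -
  have li: "locally_integrable b" by (rule continuous_locally_integrable[OF b(1)])
  note i = mollify_reflect_integrable[OF r li]
  have "mollify r b y - mollify r b x = (LBINT z. moll r z *\<^sub>R (b (y - z) - b (x - z)))"
    using i[of y] i[of x]
    by (simp add: mollify_reflect[OF r locally_integrable_measurable[OF li]] scaleR_diff_right)
  then have "(y - x) \<bullet> (mollify r b y - mollify r b x) = (LBINT z. (y - x) \<bullet> (moll r z *\<^sub>R (b (y - z) - b (x - z))))"
    using i[of y] i[of x] by (subst integral_inner_right) (auto simp: scaleR_diff_right)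
  also have "\<dots> \<le> (\<integral>z. moll r z * (- k * (norm (y - x))\<^sup>2) \<partial>(lborel :: 'a measure))"
  proof (rule integral_mono)
    have "integrable lborel (\<lambda>z. moll r z *\<^sub>R (b (y - z) - b (x - z)))"
      unfolding scaleR_diff_right using i by (intro Bochner_Integration.integrable_diff)
    then show "integrable lborel (\<lambda>z. (y - x) \<bullet> (moll r z *\<^sub>R (b (y - z) - b (x - z))))"
      by (intro integrable_inner_right)
    show "integrable lborel (\<lambda>z::'a. moll r z * (- k * (norm (y - x))\<^sup>2))"
      using moll_integrable[OF r, where 'a='a] by (intro integrable_mult_left)
    show "(y - x) \<bullet> (moll r z *\<^sub>R (b (y - z) - b (x - z))) \<le> moll r z * (- k * (norm (y - x))\<^sup>2)" for z
      using mult_left_mono[OF b(2)[of "y - z" "x - z"] moll_nonneg[OF r, of z]] by simp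
  qed
  also have "\<dots> = - k * (norm (y - x))\<^sup>2"
    using moll_integral[OF r, where 'a='a] by simp
  finally show ?thesis .
qed

text \<open>A mollified drift is locally Lipschitz, equally monotone and uniformly close to
  \<open>b\<close> on the support of \<open>F\<close>; the right-hand side changes by at most
  \<open>e'\<close> times the L1 norm of \<open>F\<close>.\<close>

lemma transport_bound:
  fixes F :: "'a::euclidean_space \<Rightarrow> real" and b DF :: "'a \<Rightarrow> 'a"
  assumes F: "\<And>x. GDERIV F x :> DF x" "continuous_on UNIV DF" "\<And>x. x \<notin> cball 0 R \<Longrightarrow> F x = 0"
    "(LBINT x. F x) = 0"
    and b: "continuous_on UNIV b" "\<And>x y. (y - x) \<bullet> (b y - b x) \<le> - k * (norm (y - x))\<^sup>2"
    and R: "R > 0" and k: "k \<ge> 0" and h: "lip1 h"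
  shows "k * (LBINT x. h x * F x) \<le> (LBINT x. norm (DF x - F x *\<^sub>R b x))"
proof (rule field_le_epsilon)
  fix e :: real assume e: "e > 0"
  have Fc: "continuous_on UNIV F"
    by (rule GDERIV_imp_continuous_on[OF F(1)])
  have DF0: "DF x = 0" if "x \<notin> cball 0 R" for x
    by (rule GDERIV_eq_0_outside_cball[OF F(1,3) that])
  have li: "locally_integrable b" by (rule continuous_locally_integrable[OF b(1)])
  define I where "I = (LBINT x. \<bar>F x\<bar>)"
  have I: "I \<ge> 0" by (simp add: I_def)
  define e' where "e' = e / (I + 1)"
  have e': "e' > 0" "e' * I \<le> e"
    using e I by (auto simp: e'_def divide_le_eq mult_left_mono)
  have "uniformly_continuous_on (cball 0 (R + 1)) b"
    using b(1) by (auto intro!: compact_uniformly_continuous intro: continuous_on_subset)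
  from this[unfolded uniformly_continuous_on_def, rule_format, OF e'(1)]
  obtain d where d: "d > 0"
    "\<And>x y. x \<in> cball 0 (R + 1) \<Longrightarrow> y \<in> cball 0 (R + 1) \<Longrightarrow> dist y x < d \<Longrightarrow> dist (b y) (b x) < e'"
    by blast
  define r where "r = min 1 d / 2"
  have r: "r > 0" "r < d" "r \<le> 1" using d by (auto simp: r_def)
  define b' where "b' = mollify r b"
  have b'c: "continuous_on UNIV b'"
    unfolding b'_def by (rule mollify_continuous[OF r(1) li])
  obtain L where L: "\<And>x y. x \<in> cball 0 (R + 1) \<Longrightarrow> y \<in> cball 0 (R + 1) \<Longrightarrow> norm (b' x - b' y) \<le> L * norm (x - y)"
    unfolding b'_def using mollify_locally_lipschitz[OF r(1) li] by blast
  have close: "norm (b' x - b x) \<le> e'" if x: "x \<in> cball 0 R" for x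
    unfolding b'_def
  proof (rule mollify_close[OF r(1) li])
    fix y assume y: "norm (x - y) \<le> r"
    have "norm y \<le> R + 1" using x y r norm_triangle_ineq2[of y x] by (simp add: norm_minus_commute)
    then show "norm (b y - b x) \<le> e'"
      using d(2)[of x y] x y r by (simp add: dist_norm norm_minus_commute less_imp_le)
  qed
  have i: "integrable lborel (\<lambda>x. norm (DF x - F x *\<^sub>R b x))" "integrable lborel (\<lambda>x. norm (DF x - F x *\<^sub>R b' x))"
     "integrable lborel (\<lambda>x. \<bar>F x\<bar>)"
    using F DF0 Fc b b'c by (auto intro!: continuous_vanishing_integrable[of _ R] continuous_intros)
  have "k * (LBINT x. h x * F x) \<le> (LBINT x. norm (DF x - F x *\<^sub>R b' x))"
    by (rule transport_bound_lipschitz_drift[OF F b'c mollify_monotone[OF r(1) b, folded b'_def] L R k h])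
  also have "\<dots> \<le> (LBINT x. norm (DF x - F x *\<^sub>R b x) + e' * \<bar>F x\<bar>)"
  proof (rule integral_mono)
    fix x
    show "norm (DF x - F x *\<^sub>R b' x) \<le> norm (DF x - F x *\<^sub>R b x) + e' * \<bar>F x\<bar>"
    proof (cases "x \<in> cball 0 R")
      case True
      have "DF x - F x *\<^sub>R b' x = (DF x - F x *\<^sub>R b x) - F x *\<^sub>R (b' x - b x)"
        by (simp add: algebra_simps)
      then have "norm (DF x - F x *\<^sub>R b' x) \<le> norm (DF x - F x *\<^sub>R b x) + \<bar>F x\<bar> * norm (b' x - b x)"
        using norm_triangle_ineq4[of "DF x - F x *\<^sub>R b x" "F x *\<^sub>R (b' x - b x)"] by (simp only: norm_scaleR)
      moreover have "\<bar>F x\<bar> * norm (b' x - b x) \<le> \<bar>F x\<bar> * e'"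
        using close[OF True] by (intro mult_left_mono) auto
      ultimately show ?thesis by (simp add: mult.commute)
    qed (use F(3) DF0 in auto)
  qed (use i in auto)
  also have "\<dots> = (LBINT x. norm (DF x - F x *\<^sub>R b x)) + e' * I"
    using i by (simp add: I_def)
  finally show "k * (LBINT x. h x * F x) \<le> (LBINT x. norm (DF x - F x *\<^sub>R b x)) + e"
    using e' by simp
qed

text \<open>Fubini moves the kernel to the weight \<open>w\<close>, whose averages converge
  uniformly; for \<open>f\<close> only its mass on a ball enters.\<close>

lemma mollify_weak_limit:
  fixes f w :: "'a::euclidean_space \<Rightarrow> real"
  assumes f: "locally_integrable f" and w: "continuous_on UNIV w" "\<And>x. x \<notin> cball 0 R \<Longrightarrow> w x = 0"
  shows "((\<lambda>r. LBINT x. w x * mollify r f x) \<longlongrightarrow> (LBINT x. w x * f x)) (at_right 0)"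
proof (rule tendstoI)
  fix e :: real assume e: "e > 0"
  define C where "C = (LBINT z. indicator (cball 0 (R + 1)) z * norm (f z))"
  have C: "C \<ge> 0" by (simp add: C_def)
  define e1 where "e1 = e / (C + 1)"
  have e1: "e1 > 0" using e C by (simp add: e1_def)
  have e1C: "e1 * C < e"
  proof -
    have "e1 * C < e1 * (C + 1)" using e1 by (intro mult_strict_left_mono) auto
    then show ?thesis using C by (simp add: e1_def)
  qed
  obtain d where d: "d > 0" "\<And>x y. norm (x - y) < d \<Longrightarrow> norm (w x - w y) < e1"
    using continuous_vanishing_uniform[OF w e1] by blast
  have [measurable]: "f \<in> borel_measurable borel" "w \<in> borel_measurable borel"
    using f w locally_integrable_measurable borel_measurable_continuous_onI by auto
  have main: "dist (LBINT x. w x * mollify r f x) (LBINT x. w x * f x) < e"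
    if r: "0 < r" "r < min 1 d" for r
  proof -
    have [measurable]: "moll r \<in> borel_measurable (borel :: 'a measure)" by (rule moll_measurable[OF r(1)])
    define \<Phi> where "\<Phi> x y = w x * (moll r (x - y) * f y)" for x y
    have [measurable]: "case_prod \<Phi> \<in> borel_measurable (lborel \<Otimes>\<^sub>M lborel)"
      unfolding \<Phi>_def by measurable
    have i: "integrable lborel (\<lambda>y. moll r (x - y) * f y)" for x
      using mollify_integrable[OF r(1) f, of x] by simp
    have nf: "locally_integrable (\<lambda>x. norm (f x))" by (rule locally_integrable_norm[OF f])
    have int: "integrable (lborel \<Otimes>\<^sub>M lborel) (case_prod \<Phi>)"
    proof (rule lborel_pair.Fubini_integrable)
      have "(\<lambda>x. LBINT y. norm (case (x, y) of (x, y) \<Rightarrow> \<Phi> x y)) = (\<lambda>x. \<bar>w x\<bar> * mollify r (\<lambda>y. norm (f y)) x)"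
        using abs_of_nonneg[OF moll_nonneg[OF r(1), where 'a='a]] by (simp add: \<Phi>_def abs_mult mollify_def fun_eq_iff)
      moreover have "integrable lborel (\<lambda>x. \<bar>w x\<bar> * mollify r (\<lambda>y. norm (f y)) x)"
        using w mollify_continuous[OF r(1) nf]
        by (intro continuous_vanishing_integrable[of _ R]) (auto intro!: continuous_intros)
      ultimately show "integrable lborel (\<lambda>x. LBINT y. norm (case (x, y) of (x, y) \<Rightarrow> \<Phi> x y))" by simp
      show "AE x in lborel. integrable lborel (\<lambda>y. case (x, y) of (x, y) \<Rightarrow> \<Phi> x y)"
        using i by (simp add: \<Phi>_def)
    qed measurable
    define W where "W y = (LBINT x. w x * moll r (x - y))" for y
    have [measurable]: "W \<in> borel_measurable borel" unfolding W_def by measurable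
    have Wz: "W y = (LBINT z. moll r z *\<^sub>R w (z + y))" for y
      using integral_lborel_shift[of "\<lambda>x. w x * moll r (x - y)" y] by (simp add: W_def mult.commute)
    have Wi: "integrable lborel (\<lambda>z. moll r z *\<^sub>R w (z + y))" for y
    proof (rule continuous_vanishing_integrable[of _ r])
      show "continuous_on UNIV (\<lambda>z. moll r z *\<^sub>R w (z + y))"
        by (intro continuous_intros test_functions_continuous[OF moll_test_function[OF r(1)]] continuous_on_compose2[OF w(1)]) auto
    qed (use moll_eq_0[OF r(1)] in auto)
    have Ww: "norm (W y - w y) \<le> e1" for y
      unfolding Wz
    proof (rule moll_average_close[OF r(1) Wi])
      fix z :: 'a assume "norm z \<le> r"
      then show "norm (w (z + y) - w y) \<le> e1" using d(2)[of "z + y" y] r by simp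
    qed
    have W0: "W y = 0" "w y = 0" if y: "y \<notin> cball 0 (R + 1)" for y
    proof -
      have "w x * moll r (x - y) = 0" for x
      proof (cases "x \<in> cball 0 R")
        case True
        then have "x - y \<notin> cball 0 r"
          using y r norm_triangle_ineq2[of y x] by (auto simp: norm_minus_commute)
        then show ?thesis using moll_eq_0[OF r(1), of "x - y"] by simp
      qed (use w in simp)
      then have "(\<lambda>x. w x * moll r (x - y)) = (\<lambda>_. 0)" by (intro ext)
      then show "W y = 0" by (simp only: W_def Bochner_Integration.integral_zero)
      show "w y = 0" using y w(2) by simp
    qed
    have "(LBINT x. w x * mollify r f x) = (LBINT x. (LBINT y. \<Phi> x y))"
      by (simp add: \<Phi>_def mollify_def)
    also have "\<dots> = (LBINT y. (LBINT x. \<Phi> x y))"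
      by (rule lborel_pair.Fubini_integral[OF int, symmetric])
    also have "\<dots> = (LBINT y. W y * f y)"
      unfolding \<Phi>_def W_def mult.assoc[symmetric] by simp
    finally have eq: "(LBINT x. w x * mollify r f x) = (LBINT y. W y * f y)" .
    define q where "q y = (W y - w y) * f y" for y
    have qb: "norm (q y) \<le> e1 * norm (f y)" for y
      using mult_right_mono[OF Ww[of y], of "\<bar>f y\<bar>"] by (simp add: q_def abs_mult)
    have q0: "q y = 0" if "y \<notin> cball 0 (R + 1)" for y using W0[OF that] by (simp add: q_def)
    have qm: "q \<in> borel_measurable borel" unfolding q_def by measurable
    have wf: "integrable lborel (\<lambda>y. w y * f y)"
      using locally_integrable_mult[OF f w] by simp
    have q: "integrable lborel q" "norm (integral\<^sup>L lborel q) \<le> e1 * C"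
      unfolding C_def by (rule locally_integrable_dominates[OF f qm qb q0], assumption)+
    have "(LBINT y. W y * f y) = (LBINT y. q y + w y * f y)"
      by (rule Bochner_Integration.integral_cong) (auto simp: q_def algebra_simps)
    also have "\<dots> = integral\<^sup>L lborel q + (LBINT y. w y * f y)"
      using q(1) wf by simp
    finally show ?thesis
      using q(2) e1C unfolding eq dist_real_def by simp
  qed
  have "0 < min 1 d" using d by simp
  then show "\<forall>\<^sub>F r in at_right 0. dist (LBINT x. w x * mollify r f x) (LBINT x. w x * f x) < e"
    using main by (intro eventually_at_rightI[of 0 "min 1 d"]) auto
qed

section \<open>Strongly log-concave densities\<close>

text \<open>Squaring the positive part makes the function C1 across the sphere of radius
  \<open>R\<close>, and the explicit formula gives the gradient bound \<open>4 / R\<close>, which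
  tends to 0 as \<open>R\<close> grows.\<close>

definition cutoff :: "real \<Rightarrow> 'a::euclidean_space \<Rightarrow> real" where
  "cutoff R x = (max 0 (1 - (x \<bullet> x) / R\<^sup>2))\<^sup>2"

definition cutoff_grad :: "real \<Rightarrow> 'a::euclidean_space \<Rightarrow> 'a" where
  "cutoff_grad R x = (- 4 / R\<^sup>2 * max 0 (1 - (x \<bullet> x) / R\<^sup>2)) *\<^sub>R x"

lemma positive_part_square_deriv:
  "((\<lambda>t. (max 0 t)\<^sup>2) has_real_derivative 2 * max 0 t) (at t)"
proof -
  have "GDERIV (\<lambda>t::real. (max 0 t)\<^sup>2) t :> 2 * max 0 t"
  proof (rule GDERIV_quadraticI)
    fix v :: real
    have "\<bar>(max 0 (t + v))\<^sup>2 - (max 0 t)\<^sup>2 - v * (2 * max 0 t)\<bar> \<le> v\<^sup>2"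
    proof (cases "t \<ge> 0"; cases "t + v \<ge> 0")
      assume "t \<ge> 0" "t + v \<ge> 0"
      then show ?thesis by (simp add: power2_eq_square algebra_simps)
    next
      assume a: "t \<ge> 0" "\<not> t + v \<ge> 0"
      have "0 \<le> (t + v)\<^sup>2" by simp
      moreover have "0 \<le> t * (- (t + v) - v)" using a by (intro mult_nonneg_nonneg) auto
      ultimately show ?thesis using a by (simp add: power2_eq_square algebra_simps abs_le_iff)
    next
      assume a: "\<not> t \<ge> 0" "t + v \<ge> 0"
      have "(t + v)\<^sup>2 \<le> v\<^sup>2" using a by (intro power_mono) auto
      then show ?thesis using a by simp
    qed auto
    then show "\<bar>(max 0 (t + v))\<^sup>2 - (max 0 t)\<^sup>2 - v \<bullet> (2 * max 0 t)\<bar> \<le> 1 * (norm v)\<^sup>2" by simp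
  qed
  then show ?thesis by (simp add: gderiv_def has_field_derivative_def mult.commute)
qed

lemma cutoff_GDERIV:
  fixes x :: "'a::euclidean_space"
  shows "GDERIV (cutoff R) x :> cutoff_grad R x"
proof -
  have "((\<lambda>x::'a. 1 - inverse (R\<^sup>2) * (x \<bullet> x)) has_derivative (\<lambda>h. - (inverse (R\<^sup>2) * (2 * (h \<bullet> x))))) (at x)"
    by (auto intro!: derivative_eq_intros simp: inner_commute)
  from has_derivative_compose[OF this positive_part_square_deriv[unfolded has_field_derivative_def]]
  show ?thesis
    unfolding gderiv_def cutoff_def cutoff_grad_def by (simp add: divide_inverse mult_ac)
qed

lemma cutoff_bounds: "0 \<le> cutoff R x" "cutoff R x \<le> 1"
  by (auto simp: cutoff_def power_le_one)

lemma cutoff_vanish: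
  assumes "R > 0" "x \<notin> cball 0 R"
  shows "cutoff R x = 0" "cutoff_grad R x = 0"
proof -
  have "R\<^sup>2 \<le> (norm x)\<^sup>2" using assms by (intro power_mono) auto
  then have "1 - (x \<bullet> x) / R\<^sup>2 \<le> 0" using assms by (simp add: power2_norm_eq_inner)
  then show "cutoff R x = 0" "cutoff_grad R x = 0" by (auto simp: cutoff_def cutoff_grad_def)
qed

lemma cutoff_continuous: "continuous_on A (cutoff R)"
  unfolding cutoff_def by (cases "R = 0") (auto intro!: continuous_intros)

lemma cutoff_grad_continuous: "continuous_on A (cutoff_grad R)"
  unfolding cutoff_grad_def by (cases "R = 0") (auto intro!: continuous_intros)

lemma cutoff_grad_norm:
  assumes "R > 0"
  shows "norm (cutoff_grad R x) \<le> 4 / R"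
proof (cases "x \<in> cball 0 R")
  case True
  have "\<bar>max 0 (1 - (x \<bullet> x) / R\<^sup>2)\<bar> \<le> 1" using assms by simp
  then have "norm (cutoff_grad R x) \<le> 4 / R\<^sup>2 * 1 * R"
    unfolding cutoff_grad_def norm_scaleR abs_mult using True by (intro mult_mono) auto
  also have "\<dots> = 4 / R" using assms by (simp add: power2_eq_square)
  finally show ?thesis .
qed (use assms cutoff_vanish(2)[of R x] in auto)

lemma cutoff_tendsto: "(\<lambda>n. cutoff (real (Suc n)) x) \<longlonglongrightarrow> 1"
proof -
  have "(\<lambda>n. (x \<bullet> x) / (real (Suc n))\<^sup>2) \<longlonglongrightarrow> 0"
    by (intro tendsto_divide_0[OF tendsto_const] filterlim_at_top_imp_at_infinity
        filterlim_pow_at_top filterlim_compose[OF filterlim_real_sequentially filterlim_Suc]) auto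
  then have "(\<lambda>n. (max 0 (1 - (x \<bullet> x) / (real (Suc n))\<^sup>2))\<^sup>2) \<longlonglongrightarrow> (max 0 (1 - 0))\<^sup>2"
    by (intro tendsto_intros)
  then show ?thesis by (simp add: cutoff_def)
qed

lemma integrable_mult_bounded:
  fixes w g :: "'a::euclidean_space \<Rightarrow> real"
  assumes "integrable lborel g" "w \<in> borel_measurable borel" "\<And>x. \<bar>w x\<bar> \<le> B"
  shows "integrable lborel (\<lambda>x. w x * g x)"
proof (rule Bochner_Integration.integrable_bound)
  show "integrable lborel (\<lambda>x. B * g x)" using assms(1) by simp
  have "0 \<le> B" using assms(3)[of undefined] by linarith
  then show "AE x in lborel. norm (w x * g x) \<le> norm (B * g x)"
    using assms(3) by (auto simp: abs_mult intro!: mult_right_mono)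
  show "(\<lambda>x. w x * g x) \<in> borel_measurable lborel"
    using assms(2) borel_measurable_integrable[OF assms(1)] by (auto intro!: borel_measurable_times)
qed

text \<open>Part 1 without random variables: \<open>f\<close> is the density ratio, \<open>G\<close>
  its weak gradient, and \<open>Dp x /\<^sub>R p x\<close> is the drift, the gradient of
  \<open>ln p\<close>.\<close>

locale log_concave_density_ratio =
  fixes p f :: "'a::euclidean_space \<Rightarrow> real" and Dp G :: "'a \<Rightarrow> 'a" and k :: real
  assumes p: "\<And>x. GDERIV p x :> Dp x" "continuous_on UNIV Dp" "\<And>x. 0 < p x"
    "integrable lborel p" "(LBINT x. p x) = 1"
  and log_concave: "\<And>x y. (y - x) \<bullet> (Dp y /\<^sub>R p y - Dp x /\<^sub>R p x) \<le> - k * (norm (y - x))\<^sup>2"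
  and k: "k > 0"
  and f: "has_weak_gradient_on f G UNIV" "\<And>x. 0 \<le> f x" "integrable lborel (\<lambda>x. f x * p x)"
    "(LBINT x. f x * p x) = 1"
  and G: "integrable lborel (\<lambda>x. norm (G x) * p x)"
begin

lemma p_continuous: "continuous_on A p"
  by (rule GDERIV_imp_continuous_on[OF p(1)])

lemma f_locally_integrable: "locally_integrable f"
  and G_locally_integrable: "locally_integrable G"
  using has_weak_gradient_on_UNIV_locally_integrable[OF f(1)] by auto

lemma measurable_facts [measurable]:
  "f \<in> borel_measurable borel" "G \<in> borel_measurable borel" "p \<in> borel_measurable borel"
  using locally_integrable_measurable[OF f_locally_integrable] locally_integrable_measurable[OF G_locally_integrable]
    borel_measurable_continuous_onI[OF p_continuous] by auto

text \<open>The condition on \<open>c\<close> recentres the cut-off of \<open>f - 1\<close>, so that its integral against \<open>p\<close> vanishes.\<close>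

lemma cutoff_mollified_bound:
  assumes R: "R > 0" and r: "r > 0" and h: "lip1 h"
    and c: "c * (LBINT x. cutoff 1 x * p x) =
      (LBINT x. (cutoff R x * p x) * mollify r f x) - (LBINT x. cutoff R x * p x)"
  shows "k * ((LBINT x. (h x * cutoff R x * p x) * mollify r f x)
              - (LBINT x. h x * cutoff R x * p x) - c * (LBINT x. h x * cutoff 1 x * p x))
    \<le> (LBINT x. (norm (cutoff_grad R x) * p x) * mollify r f x) + (LBINT x. norm (cutoff_grad R x) * p x)
      + (LBINT x. (cutoff R x * p x) * mollify r (\<lambda>x. norm (G x)) x) + \<bar>c\<bar> * (LBINT x. norm (cutoff_grad 1 x) * p x)"
proof -
  define fr where "fr = mollify r f"
  define g where "g x = cutoff R x * (fr x - 1) - c * cutoff 1 x" for x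
  define Dg where "Dg x = (fr x - 1) *\<^sub>R cutoff_grad R x + cutoff R x *\<^sub>R mollify r G x - c *\<^sub>R cutoff_grad 1 x" for x
  define F where "F x = g x * p x" for x
  define DF where "DF x = g x *\<^sub>R Dp x + p x *\<^sub>R Dg x" for x
  have frD: "GDERIV fr x :> mollify r G x" for x
    using mollify_GDERIV[OF r f_locally_integrable] mollify_grad_weak[OF r f(1)] by (simp add: fr_def)
  have Gc: "continuous_on UNIV (mollify r G)"
    by (rule mollify_continuous[OF r G_locally_integrable])
  have frc: "continuous_on UNIV fr"
    unfolding fr_def by (rule mollify_continuous[OF r f_locally_integrable])
  have nGc: "continuous_on UNIV (mollify r (\<lambda>x. norm (G x)))"
    by (rule mollify_continuous[OF r locally_integrable_norm[OF G_locally_integrable]])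
  have hc: "continuous_on UNIV h" by (rule lip1_continuous[OF h])
  note cc = continuous_intros hc p_continuous cutoff_continuous cutoff_grad_continuous frc Gc nGc p(2)
  have gD: "GDERIV g x :> Dg x" for x
    using GDERIV_diff[OF GDERIV_mult[OF cutoff_GDERIV[of R x] GDERIV_diff[OF frD[of x] GDERIV_const[of 1]]]
        GDERIV_mult[OF GDERIV_const[of c] cutoff_GDERIV[of 1 x]]]
    unfolding g_def Dg_def by (simp add: algebra_simps)
  have FD: "GDERIV F x :> DF x" for x
    using GDERIV_mult[OF gD[of x] p(1)[of x]] unfolding F_def DF_def by simp
  have DFc: "continuous_on UNIV DF"
    unfolding DF_def g_def Dg_def by (intro cc)
  \<comment> \<open>Outside this ball both cut-offs vanish, the one of radius \<open>R\<close> and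
    the one of radius 1 used for recentring.\<close>
  define R' where "R' = max R 1"
  have R': "R' > 0" by (simp add: R'_def)
  have v: "cutoff R x = 0" "cutoff_grad R x = 0" "cutoff 1 x = 0" "cutoff_grad 1 x = 0" if "x \<notin> cball 0 R'" for x :: 'a
    using that cutoff_vanish[OF R, of x] cutoff_vanish[of 1 x] by (auto simp: R'_def)
  have F0: "F x = 0" if "x \<notin> cball 0 R'" for x
    using v[OF that] by (simp add: F_def g_def)
  have int: "integrable lborel (\<lambda>x. q x * w x)" if "continuous_on UNIV w" "continuous_on UNIV q" "\<And>x. x \<notin> cball 0 R' \<Longrightarrow> q x = 0" for w q :: "'a \<Rightarrow> real"
    using that by (intro continuous_vanishing_integrable[of _ R']) (auto intro!: continuous_intros)
  have iR: "integrable lborel (\<lambda>x. cutoff R x * w x)" "integrable lborel (\<lambda>x. norm (cutoff_grad R x) * w x)"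
    "integrable lborel (\<lambda>x. cutoff 1 x * w x)" "integrable lborel (\<lambda>x. norm (cutoff_grad 1 x) * w x)"
    if "continuous_on UNIV w" for w :: "'a \<Rightarrow> real"
    by (intro int that cc; use v in simp)+
  have split: "(LBINT x. w x * F x) = (LBINT x. (w x * cutoff R x * p x) * fr x)
       - (LBINT x. w x * cutoff R x * p x) - c * (LBINT x. w x * cutoff 1 x * p x)"
    if w: "continuous_on UNIV w" for w
  proof -
    have "(LBINT x. w x * F x) = (LBINT x. cutoff R x * (w x * p x * fr x) - cutoff R x * (w x * p x) - c * (cutoff 1 x * (w x * p x)))"
      by (rule Bochner_Integration.integral_cong) (auto simp: F_def g_def algebra_simps)
    also have "\<dots> = (LBINT x. cutoff R x * (w x * p x * fr x)) - (LBINT x. cutoff R x * (w x * p x))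
      - (LBINT x. c * (cutoff 1 x * (w x * p x)))"
      by (subst Bochner_Integration.integral_diff Bochner_Integration.integral_diff,
          (intro Bochner_Integration.integrable_diff integrable_mult_right iR cc w)+)+ simp
    also have "(LBINT x. c * (cutoff 1 x * (w x * p x))) = c * (LBINT x. cutoff 1 x * (w x * p x))"
      by (rule integral_mult_right_zero)
    finally show ?thesis by (simp add: mult_ac)
  qed
  have F_int: "(LBINT x. F x) = 0"
    using split[of "\<lambda>_. 1"] c by (simp add: fr_def)
  have "k * (LBINT x. h x * F x) \<le> (LBINT x. norm (DF x - F x *\<^sub>R (Dp x /\<^sub>R p x)))"
  proof (rule transport_bound[OF FD DFc F0 F_int _ log_concave R' less_imp_le[OF k] h])
    show "continuous_on UNIV (\<lambda>x. Dp x /\<^sub>R p x)"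
      using p(3) by (intro continuous_intros p p_continuous) (auto simp: less_imp_neq[symmetric])
  qed
  also have "\<dots> \<le> (LBINT x. norm (cutoff_grad R x) * (p x * fr x) + norm (cutoff_grad R x) * p x
     + cutoff R x * (p x * mollify r (\<lambda>x. norm (G x)) x) + \<bar>c\<bar> * (norm (cutoff_grad 1 x) * p x))"
  proof (rule integral_mono)
    \<comment> \<open>The part \<open>g x *\<^sub>R Dp x\<close> of the product rule is exactly
      \<open>F\<close> times the drift, so only the gradient of \<open>g\<close> remains, weighted
      by \<open>p\<close>.\<close>
    have eq: "DF x - F x *\<^sub>R (Dp x /\<^sub>R p x) = p x *\<^sub>R Dg x" for x
      using p(3)[of x] by (simp add: DF_def F_def)
    show "integrable lborel (\<lambda>x. norm (DF x - F x *\<^sub>R (Dp x /\<^sub>R p x)))"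
      unfolding eq Dg_def using v
      by (intro integrable_norm continuous_vanishing_integrable[of _ R'] cc) auto
    show "integrable lborel (\<lambda>x. norm (cutoff_grad R x) * (p x * fr x) + norm (cutoff_grad R x) * p x
     + cutoff R x * (p x * mollify r (\<lambda>x. norm (G x)) x) + \<bar>c\<bar> * (norm (cutoff_grad 1 x) * p x))"
      by (intro Bochner_Integration.integrable_add integrable_mult_right iR cc)
    fix x
    have fr0: "0 \<le> fr x"
      unfolding fr_def mollify_def using moll_nonneg[OF r, where 'a='a] f(2)
      by (intro Bochner_Integration.integral_nonneg) auto
    have Gn: "norm (mollify r G x) \<le> mollify r (\<lambda>x. norm (G x)) x"
      unfolding mollify_def
      using integral_norm_bound[of lborel "\<lambda>y. moll r (x - y) *\<^sub>R G y"] abs_of_nonneg[OF moll_nonneg[OF r, where 'a='a]]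
      by simp
    have "norm (Dg x) \<le> norm ((fr x - 1) *\<^sub>R cutoff_grad R x) + norm (cutoff R x *\<^sub>R mollify r G x) + norm (c *\<^sub>R cutoff_grad 1 x)"
      unfolding Dg_def by (rule order_trans[OF norm_triangle_ineq4 add_right_mono[OF norm_triangle_ineq]])
    also have "\<dots> \<le> (fr x + 1) * norm (cutoff_grad R x) + cutoff R x * mollify r (\<lambda>x. norm (G x)) x + \<bar>c\<bar> * norm (cutoff_grad 1 x)"
      unfolding norm_scaleR using fr0 Gn cutoff_bounds[of R x]
      by (intro add_mono mult_mono) auto
    finally have "p x * norm (Dg x) \<le> p x * ((fr x + 1) * norm (cutoff_grad R x) + cutoff R x * mollify r (\<lambda>x. norm (G x)) x + \<bar>c\<bar> * norm (cutoff_grad 1 x))"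
      using p(3)[of x] by (intro mult_left_mono) auto
    then show "norm (DF x - F x *\<^sub>R (Dp x /\<^sub>R p x)) \<le> norm (cutoff_grad R x) * (p x * fr x) + norm (cutoff_grad R x) * p x
     + cutoff R x * (p x * mollify r (\<lambda>x. norm (G x)) x) + \<bar>c\<bar> * (norm (cutoff_grad 1 x) * p x)"
      unfolding eq norm_scaleR using p(3)[of x] by (simp add: algebra_simps)
  qed
  also have "\<dots> = (LBINT x. norm (cutoff_grad R x) * (p x * fr x)) + (LBINT x. norm (cutoff_grad R x) * p x)
     + (LBINT x. cutoff R x * (p x * mollify r (\<lambda>x. norm (G x)) x)) + (LBINT x. \<bar>c\<bar> * (norm (cutoff_grad 1 x) * p x))"
    by (subst Bochner_Integration.integral_add Bochner_Integration.integral_add Bochner_Integration.integral_add,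
       (intro Bochner_Integration.integrable_add integrable_mult_right iR cc)+)+ simp
  also have "(LBINT x. \<bar>c\<bar> * (norm (cutoff_grad 1 x) * p x)) = \<bar>c\<bar> * (LBINT x. norm (cutoff_grad 1 x) * p x)"
    by (rule integral_mult_right_zero)
  finally show ?thesis
    unfolding split[OF hc] by (simp add: fr_def mult.assoc)
qed

end

text \<open>Dominated convergence: the cut-offs are at most 1 and the norms of their gradients are
  at most \<open>4 / real (Suc n)\<close>. Taking \<open>Suc n\<close> keeps the radius
  positive.\<close>

lemma cutoff_dominated_limit:
  fixes g :: "'a::euclidean_space \<Rightarrow> real"
  assumes g: "integrable lborel g"
  shows "(\<lambda>n. LBINT x. cutoff (real (Suc n)) x * g x) \<longlonglongrightarrow> (LBINT x. g x)"
    and "(\<lambda>n. LBINT x. norm (cutoff_grad (real (Suc n)) x) * g x) \<longlonglongrightarrow> 0"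
proof -
  have [measurable]: "g \<in> borel_measurable borel" using borel_measurable_integrable[OF g] by simp
  have [measurable]: "cutoff R \<in> borel_measurable (borel :: 'a measure)" "cutoff_grad R \<in> borel_measurable (borel :: 'a measure)" for R
    by (auto intro!: borel_measurable_continuous_onI cutoff_continuous cutoff_grad_continuous)
  show "(\<lambda>n. LBINT x. cutoff (real (Suc n)) x * g x) \<longlonglongrightarrow> (LBINT x. g x)"
  proof (rule integral_dominated_convergence)
    show "integrable lborel (\<lambda>x. \<bar>g x\<bar>)" using g by simp
    show "AE x in lborel. (\<lambda>n. cutoff (real (Suc n)) x * g x) \<longlonglongrightarrow> g x"
    proof (rule AE_I2)
      fix x
      show "(\<lambda>n. cutoff (real (Suc n)) x * g x) \<longlonglongrightarrow> g x"
        using tendsto_mult[OF cutoff_tendsto[of x] tendsto_const[of "g x"]] by simp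
    qed
    show "AE x in lborel. norm (cutoff (real (Suc n)) x * g x) \<le> \<bar>g x\<bar>" for n
    proof (rule AE_I2)
      fix x
      show "norm (cutoff (real (Suc n)) x * g x) \<le> \<bar>g x\<bar>"
        using mult_right_mono[OF cutoff_bounds(2)[of "real (Suc n)" x], of "\<bar>g x\<bar>"] cutoff_bounds(1)[of "real (Suc n)" x]
        by (simp add: abs_mult)
    qed
  qed measurable
  have "(\<lambda>n. LBINT x. norm (cutoff_grad (real (Suc n)) x) * g x) \<longlonglongrightarrow> (\<integral>x. 0 \<partial>(lborel :: 'a measure))"
  proof (rule integral_dominated_convergence)
    show "integrable lborel (\<lambda>x. 4 * \<bar>g x\<bar>)" using g by simp
    show "AE x in lborel. (\<lambda>n. norm (cutoff_grad (real (Suc n)) x) * g x) \<longlonglongrightarrow> 0"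
    proof (rule AE_I2)
      fix x :: 'a
      have "(\<lambda>n. norm (cutoff_grad (real (Suc n)) x)) \<longlonglongrightarrow> 0"
      proof (rule tendsto_sandwich[of "\<lambda>_. 0" _ _ "\<lambda>n. 4 / real (Suc n)"])
        show "(\<lambda>n. 4 / real (Suc n)) \<longlonglongrightarrow> 0"
          using tendsto_mult[OF tendsto_const[of 4] LIMSEQ_inverse_real_of_nat] by (simp add: divide_inverse)
        show "\<forall>\<^sub>F n in sequentially. norm (cutoff_grad (real (Suc n)) x) \<le> 4 / real (Suc n)"
          by (intro always_eventually allI cutoff_grad_norm) simp
      qed auto
      from tendsto_mult[OF this tendsto_const[of "g x"]]
      show "(\<lambda>n. norm (cutoff_grad (real (Suc n)) x) * g x) \<longlonglongrightarrow> 0" by simp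
    qed
    show "AE x in lborel. norm (norm (cutoff_grad (real (Suc n)) x) * g x) \<le> 4 * \<bar>g x\<bar>" for n
    proof (rule AE_I2)
      fix x :: 'a
      have "norm (cutoff_grad (real (Suc n)) x) \<le> 4 / real (Suc n)" by (rule cutoff_grad_norm) simp
      also have "\<dots> \<le> 4" by (simp add: divide_le_eq)
      finally show "norm (norm (cutoff_grad (real (Suc n)) x) * g x) \<le> 4 * \<bar>g x\<bar>"
        by (simp add: abs_mult mult_right_mono)
    qed
  qed measurable
  then show "(\<lambda>n. LBINT x. norm (cutoff_grad (real (Suc n)) x) * g x) \<longlonglongrightarrow> 0" by simp
qed

context log_concave_density_ratio
begin

text \<open>The recentring constant is a quotient by this mass, which is positive because cut-off
  and density are both positive on the unit ball.\<close>

lemma cutoff_mass_pos: "0 < (LBINT x. cutoff 1 x * p x)"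
proof (rule ccontr)
  assume "\<not> 0 < (LBINT x. cutoff 1 x * p x)"
  moreover have nn: "0 \<le> cutoff 1 x * p x" for x using cutoff_bounds(1)[of 1 x] p(3)[of x] by simp
  ultimately have "(LBINT x. cutoff 1 x * p x) = 0"
    using Bochner_Integration.integral_nonneg[of lborel "\<lambda>x. cutoff 1 x * p x"] by (simp add: order_antisym)
  moreover have "integrable lborel (\<lambda>x. cutoff 1 x * p x)"
    using cutoff_vanish(1)[of 1] by (intro continuous_vanishing_integrable[of _ 1] continuous_intros cutoff_continuous p_continuous) auto
  ultimately have "AE x in lborel. cutoff 1 x * p x = 0"
    using integral_nonneg_eq_0_iff_AE nn by blast
  moreover have "cutoff 1 x * p x \<noteq> 0" if "x \<in> ball 0 1" for x
  proof -
    have "(norm x)\<^sup>2 < 1" using that by (simp add: power_less_one_iff)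
    then show ?thesis using p(3)[of x] by (simp add: cutoff_def power2_norm_eq_inner)
  qed
  ultimately have "AE x in lborel. x \<notin> ball (0::'a) 1" by auto
  then have "ball (0::'a) 1 \<in> null_sets lborel"
    by (subst AE_iff_null_sets) auto
  then have "negligible (ball (0::'a) 1)"
    by (simp add: negligible_iff_null_sets null_sets_completionI)
  then show False using open_not_negligible[of "ball (0::'a) 1"] by simp
qed

text \<open>The limit of vanishing mollification. All weights are continuous with compact support,
  so each integral converges by \<open>mollify_weak_limit\<close>, and the recentring constants
  converge with them.\<close>

lemma cutoff_bound:
  fixes R :: real
  assumes R: "R > 0" and h: "lip1 h"
  defines "c \<equiv> ((LBINT x. (cutoff R x * p x) * f x) - (LBINT x. cutoff R x * p x)) / (LBINT x. cutoff 1 x * p x)"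
  shows "k * ((LBINT x. (h x * cutoff R x * p x) * f x)
              - (LBINT x. h x * cutoff R x * p x) - c * (LBINT x. h x * cutoff 1 x * p x))
    \<le> (LBINT x. (norm (cutoff_grad R x) * p x) * f x) + (LBINT x. norm (cutoff_grad R x) * p x)
      + (LBINT x. (cutoff R x * p x) * norm (G x)) + \<bar>c\<bar> * (LBINT x. norm (cutoff_grad 1 x) * p x)"
proof -
  define cr where "cr r = ((LBINT x. (cutoff R x * p x) * mollify r f x) - (LBINT x. cutoff R x * p x)) / (LBINT x. cutoff 1 x * p x)" for r
  have hc: "continuous_on UNIV h" by (rule lip1_continuous[OF h])
  note cc = continuous_intros hc p_continuous cutoff_continuous cutoff_grad_continuous
  have lim: "((\<lambda>r. LBINT x. w x * mollify r g x) \<longlongrightarrow> (LBINT x. w x * g x)) (at_right 0)"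
    if "locally_integrable g" "continuous_on UNIV w" "\<And>x. cutoff R x = 0 \<Longrightarrow> cutoff_grad R x = 0 \<Longrightarrow> w x = 0" for g w :: "'a \<Rightarrow> real"
    by (rule mollify_weak_limit[OF that(1,2), of R]) (use that(3) cutoff_vanish[OF R] in auto)
  note L = lim[OF f_locally_integrable] lim[OF locally_integrable_norm[OF G_locally_integrable]]
  have cl: "(cr \<longlongrightarrow> c) (at_right 0)"
    unfolding cr_def c_def using cutoff_mass_pos by (intro tendsto_intros L cc) auto
  show ?thesis
  proof (rule tendsto_le)
    show "at_right (0::real) \<noteq> bot" by simp
    show "((\<lambda>r. (LBINT x. (norm (cutoff_grad R x) * p x) * mollify r f x) + (LBINT x. norm (cutoff_grad R x) * p x)
      + (LBINT x. (cutoff R x * p x) * mollify r (\<lambda>x. norm (G x)) x) + \<bar>cr r\<bar> * (LBINT x. norm (cutoff_grad 1 x) * p x))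
      \<longlongrightarrow> (LBINT x. (norm (cutoff_grad R x) * p x) * f x) + (LBINT x. norm (cutoff_grad R x) * p x)
      + (LBINT x. (cutoff R x * p x) * norm (G x)) + \<bar>c\<bar> * (LBINT x. norm (cutoff_grad 1 x) * p x)) (at_right 0)"
      by (intro tendsto_intros L cc cl) auto
    show "((\<lambda>r. k * ((LBINT x. (h x * cutoff R x * p x) * mollify r f x)
              - (LBINT x. h x * cutoff R x * p x) - cr r * (LBINT x. h x * cutoff 1 x * p x)))
      \<longlongrightarrow> k * ((LBINT x. (h x * cutoff R x * p x) * f x)
              - (LBINT x. h x * cutoff R x * p x) - c * (LBINT x. h x * cutoff 1 x * p x))) (at_right 0)"
      by (intro tendsto_intros L cc cl) auto
    show "\<forall>\<^sub>F r in at_right 0. k * ((LBINT x. (h x * cutoff R x * p x) * mollify r f x)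
              - (LBINT x. h x * cutoff R x * p x) - cr r * (LBINT x. h x * cutoff 1 x * p x))
       \<le> (LBINT x. (norm (cutoff_grad R x) * p x) * mollify r f x) + (LBINT x. norm (cutoff_grad R x) * p x)
      + (LBINT x. (cutoff R x * p x) * mollify r (\<lambda>x. norm (G x)) x) + \<bar>cr r\<bar> * (LBINT x. norm (cutoff_grad 1 x) * p x)"
      using eventually_at_right_less[of 0]
    proof eventually_elim
      case (elim r)
      show ?case
        by (rule cutoff_mollified_bound[OF R elim h]) (use cutoff_mass_pos in \<open>simp add: cr_def\<close>)
    qed
  qed
qed

text \<open>The limit of growing cut-off radius. Both densities have mass 1, so the recentring
  constant tends to 0, as do the terms with the gradient of the cut-off; boundedness of
  \<open>h\<close> provides the integrable majorants on the left.\<close>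

lemma bounded_lipschitz_bound:
  assumes h: "lip1 h" and H: "\<And>x. \<bar>h x\<bar> \<le> H"
  shows "k * ((LBINT x. h x * (f x * p x)) - (LBINT x. h x * p x)) \<le> (LBINT x. norm (G x) * p x)"
proof -
  have [measurable]: "h \<in> borel_measurable borel"
    by (rule borel_measurable_continuous_onI[OF lip1_continuous[OF h]])
  have i: "integrable lborel (\<lambda>x. h x * (f x * p x))" "integrable lborel (\<lambda>x. h x * p x)"
    using H by (auto intro!: integrable_mult_bounded[OF f(3)] integrable_mult_bounded[OF p(4)])
  define A where "A = (LBINT x. cutoff 1 x * p x)"
  define c where "c n = ((LBINT x. cutoff (real (Suc n)) x * (f x * p x)) - (LBINT x. cutoff (real (Suc n)) x * p x)) / A" for n
  note L = cutoff_dominated_limit(1) cutoff_dominated_limit(2)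
  have cl: "c \<longlonglongrightarrow> ((LBINT x. f x * p x) - (LBINT x. p x)) / A"
    unfolding c_def using cutoff_mass_pos by (intro tendsto_intros L f(3) p(4)) (simp add: A_def)
  show ?thesis
  proof (rule tendsto_le)
    show "sequentially \<noteq> bot" by simp
    show "(\<lambda>n. (LBINT x. norm (cutoff_grad (real (Suc n)) x) * (f x * p x)) + (LBINT x. norm (cutoff_grad (real (Suc n)) x) * p x)
      + (LBINT x. cutoff (real (Suc n)) x * (norm (G x) * p x)) + \<bar>c n\<bar> * (LBINT x. norm (cutoff_grad 1 x) * p x))
      \<longlonglongrightarrow> (LBINT x. norm (G x) * p x)"
    proof (rule tendsto_eq_rhs)
      show "(\<lambda>n. (LBINT x. norm (cutoff_grad (real (Suc n)) x) * (f x * p x)) + (LBINT x. norm (cutoff_grad (real (Suc n)) x) * p x)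
      + (LBINT x. cutoff (real (Suc n)) x * (norm (G x) * p x)) + \<bar>c n\<bar> * (LBINT x. norm (cutoff_grad 1 x) * p x))
      \<longlonglongrightarrow> 0 + 0 + (LBINT x. norm (G x) * p x) + \<bar>((LBINT x. f x * p x) - (LBINT x. p x)) / A\<bar> * (LBINT x. norm (cutoff_grad 1 x) * p x)"
        by (intro tendsto_intros L cl f(3) p(4) G)
    qed (simp add: f(4) p(5))
    show "(\<lambda>n. k * ((LBINT x. cutoff (real (Suc n)) x * (h x * (f x * p x)))
              - (LBINT x. cutoff (real (Suc n)) x * (h x * p x)) - c n * (LBINT x. h x * cutoff 1 x * p x)))
      \<longlonglongrightarrow> k * ((LBINT x. h x * (f x * p x)) - (LBINT x. h x * p x))"
    proof (rule tendsto_eq_rhs)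
      show "(\<lambda>n. k * ((LBINT x. cutoff (real (Suc n)) x * (h x * (f x * p x)))
              - (LBINT x. cutoff (real (Suc n)) x * (h x * p x)) - c n * (LBINT x. h x * cutoff 1 x * p x)))
      \<longlonglongrightarrow> k * ((LBINT x. h x * (f x * p x)) - (LBINT x. h x * p x)
        - ((LBINT x. f x * p x) - (LBINT x. p x)) / A * (LBINT x. h x * cutoff 1 x * p x))"
        by (intro tendsto_intros L cl i)
    qed (simp add: f(4) p(5))
    show "\<forall>\<^sub>F n in sequentially. k * ((LBINT x. cutoff (real (Suc n)) x * (h x * (f x * p x)))
              - (LBINT x. cutoff (real (Suc n)) x * (h x * p x)) - c n * (LBINT x. h x * cutoff 1 x * p x))
      \<le> (LBINT x. norm (cutoff_grad (real (Suc n)) x) * (f x * p x)) + (LBINT x. norm (cutoff_grad (real (Suc n)) x) * p x)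
      + (LBINT x. cutoff (real (Suc n)) x * (norm (G x) * p x)) + \<bar>c n\<bar> * (LBINT x. norm (cutoff_grad 1 x) * p x)"
      using cutoff_bound[OF _ h, of "real (Suc n)" for n]
      by (intro always_eventually allI) (simp add: c_def A_def mult_ac)
  qed
qed

end

section \<open>First moments of strongly log-concave densities\<close>

lemma integrable_lborel_scale:
  fixes g :: "'a::euclidean_space \<Rightarrow> real"
  assumes g: "integrable lborel g"
  shows "integrable lborel (\<lambda>x. g (x /\<^sub>R 2))"
proof -
  have [measurable]: "g \<in> borel_measurable borel" using borel_measurable_integrable[OF g] by simp
  have eq: "(lborel :: 'a measure) = density (distr lborel borel (\<lambda>x. 0 + 2 *\<^sub>R x)) (\<lambda>_. ennreal (\<bar>2\<bar> ^ DIM('a)))"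
    using lborel_affine[of 2 "0::'a"] by (simp add: ennreal_power[symmetric])
  have "integrable (distr (lborel :: 'a measure) borel (\<lambda>x. 0 + 2 *\<^sub>R x)) (\<lambda>x. \<bar>2\<bar> ^ DIM('a) *\<^sub>R g (x /\<^sub>R 2))"
    using g by (subst integrable_distr_eq) auto
  then show ?thesis
    by (subst eq, subst integrable_density) auto
qed

context log_concave_density_ratio
begin

text \<open>Strong log-concavity on the segment from \<open>x / 2\<close> to \<open>x\<close> bounds \<open>norm x * p x\<close> by a multiple of
  \<open>p (x / 2)\<close>.\<close>

lemma integrable_norm_density: "integrable lborel (\<lambda>x. norm x * p x)"
proof -
  define b where "b x = Dp x /\<^sub>R p x" for x
  have lnD: "((\<lambda>t. ln (p (t *\<^sub>R x))) has_real_derivative x \<bullet> b (t *\<^sub>R x)) (at t)" for x t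
  proof -
    have "((\<lambda>t. t *\<^sub>R x) has_derivative (\<lambda>h. h *\<^sub>R x)) (at t)" by (auto intro!: derivative_eq_intros)
    from has_derivative_compose[OF this p(1)[unfolded gderiv_def]]
    have "((\<lambda>t. p (t *\<^sub>R x)) has_real_derivative x \<bullet> Dp (t *\<^sub>R x)) (at t)"
      by (simp add: has_field_derivative_def mult_commute_abs)
    from DERIV_chain2[OF DERIV_ln_divide[OF p(3)] this]
    show ?thesis by (simp add: b_def inverse_eq_divide)
  qed
  \<comment> \<open>The half in \<open>a\<close> is the length of the segment as a fraction of
    \<open>x\<close>. \<open>K\<close> is the maximum over \<open>t\<close> of
    \<open>exp ((a + 1) * t - k / 4 * t\<^sup>2)\<close>, found by completing the square.\<close>
  define a where "a = norm (b 0) / 2"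
  define K where "K = exp ((a + 1)\<^sup>2 / k)"
  have bound: "norm x * p x \<le> K * p (x /\<^sub>R 2)" for x
  proof -
    obtain \<xi> where \<xi>: "1/2 < \<xi>" "\<xi> < (1::real)" "ln (p (1 *\<^sub>R x)) - ln (p ((1/2) *\<^sub>R x)) = (1 - 1/2) * (x \<bullet> b (\<xi> *\<^sub>R x))"
      using MVT2[of "1/2" "1::real" "\<lambda>t. ln (p (t *\<^sub>R x))" "\<lambda>t. x \<bullet> b (t *\<^sub>R x)"] lnD by auto
    \<comment> \<open>Comparing the intermediate point with the origin; since \<xi> exceeds 1/2, the
      slope of \<open>ln p\<close> along \<open>x\<close> is at most
      \<open>x \<bullet> b 0 - k / 2 * (norm x)\<^sup>2\<close>.\<close>
    have "(\<xi> *\<^sub>R x - 0) \<bullet> (b (\<xi> *\<^sub>R x) - b 0) \<le> - k * (norm (\<xi> *\<^sub>R x - 0))\<^sup>2"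
      using log_concave[where x = 0 and y = "\<xi> *\<^sub>R x"] by (simp add: b_def)
    then have "\<xi> * (x \<bullet> b (\<xi> *\<^sub>R x) - x \<bullet> b 0) \<le> \<xi> * (- k * \<xi> * (norm x)\<^sup>2)"
      using \<xi> by (simp add: inner_diff_right power_mult_distrib power2_eq_square algebra_simps)
    then have "x \<bullet> b (\<xi> *\<^sub>R x) - x \<bullet> b 0 \<le> - k * \<xi> * (norm x)\<^sup>2"
      by (rule mult_left_le_imp_le) (use \<xi> in simp)
    then have "x \<bullet> b (\<xi> *\<^sub>R x) \<le> x \<bullet> b 0 - k * \<xi> * (norm x)\<^sup>2" by simp
    moreover have "k * (1/2) * (norm x)\<^sup>2 \<le> k * \<xi> * (norm x)\<^sup>2"
      using \<xi> k by (intro mult_right_mono mult_left_mono) auto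
    moreover have "x \<bullet> b 0 \<le> norm x * norm (b 0)" by (rule norm_cauchy_schwarz)
    ultimately have "x \<bullet> b (\<xi> *\<^sub>R x) \<le> norm x * norm (b 0) - k / 2 * (norm x)\<^sup>2" by simp
    then have ln: "ln (p x) - ln (p (x /\<^sub>R 2)) \<le> a * norm x - k / 4 * (norm x)\<^sup>2"
      using \<xi>(3) by (simp add: a_def inverse_eq_divide algebra_simps)
    \<comment> \<open>The factor \<open>norm x\<close> goes into the exponent, which turns
      \<open>a\<close> into \<open>a + 1\<close>.\<close>
    have "norm x \<le> exp (norm x)" using exp_ge_add_one_self[of "norm x"] by linarith
    moreover have "p x = exp (ln (p x) - ln (p (x /\<^sub>R 2))) * p (x /\<^sub>R 2)"
      using p(3)[of x] p(3)[of "x /\<^sub>R 2"] by (simp add: exp_diff)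
    ultimately have "norm x * p x \<le> exp (norm x) * (exp (ln (p x) - ln (p (x /\<^sub>R 2))) * p (x /\<^sub>R 2))"
      using p(3)[of x] by (metis less_imp_le mult_right_mono)
    also have "\<dots> = exp (norm x + (ln (p x) - ln (p (x /\<^sub>R 2)))) * p (x /\<^sub>R 2)"
      by (simp add: exp_add)
    also have "\<dots> \<le> K * p (x /\<^sub>R 2)"
    proof (rule mult_right_mono)
      have "0 \<le> (k / 2 * norm x - (a + 1))\<^sup>2" by simp
      then have "k * ((a + 1) * norm x - k / 4 * (norm x)\<^sup>2) \<le> (a + 1)\<^sup>2"
        by (simp add: power2_eq_square algebra_simps)
      then have "(a + 1) * norm x - k / 4 * (norm x)\<^sup>2 \<le> (a + 1)\<^sup>2 / k"
        using k by (simp add: field_simps)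
      then show "exp (norm x + (ln (p x) - ln (p (x /\<^sub>R 2)))) \<le> K"
        using ln unfolding K_def by (simp add: algebra_simps)
      show "0 \<le> p (x /\<^sub>R 2)" using p(3)[of "x /\<^sub>R 2"] by simp
    qed
    finally show ?thesis .
  qed
  show ?thesis
  proof (rule Bochner_Integration.integrable_bound)
    show "integrable lborel (\<lambda>x. K * p (x /\<^sub>R 2))"
      using integrable_lborel_scale[OF p(4)] by simp
    show "AE x in lborel. norm (norm x * p x) \<le> norm (K * p (x /\<^sub>R 2))"
    proof (rule AE_I2)
      fix x
      show "norm (norm x * p x) \<le> norm (K * p (x /\<^sub>R 2))"
        using order_trans[OF bound[of x] abs_ge_self] p(3)[of x] by (simp add: abs_mult)
    qed
  qed measurable
qed

end

text \<open>Reduction to bounded test functions. Truncated norms carry the first moment from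
  \<open>p1\<close> over to \<open>p2\<close>; then every Lipschitz \<open>h\<close> is integrable
  under both laws and is a dominated limit of its truncations. Applying the bound to
  \<open>- h\<close> as well yields the absolute value.\<close>

lemma wasserstein1_le_bounded:
  fixes p1 p2 :: "'a::euclidean_space \<Rightarrow> real"
  assumes p1: "integrable lborel p1" "\<And>x. 0 \<le> p1 x" and p2: "integrable lborel p2" "\<And>x. 0 \<le> p2 x"
    and D1: "distributed M1 lborel X1 (\<lambda>x. ennreal (p1 x))" and D2: "distributed M2 lborel X2 (\<lambda>x. ennreal (p2 x))"
    and n1: "integrable lborel (\<lambda>x. norm x * p1 x)"
    and bd: "\<And>h H. lip1 h \<Longrightarrow> (\<And>x. \<bar>h x\<bar> \<le> H) \<Longrightarrow> (LBINT x. h x * p2 x) - (LBINT x. h x * p1 x) \<le> B"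
  shows "wasserstein1 M1 X1 M2 X2 \<le> ennreal B"
proof -
  have [measurable]: "p1 \<in> borel_measurable borel" "p2 \<in> borel_measurable borel"
    using borel_measurable_integrable[OF p1(1)] borel_measurable_integrable[OF p2(1)] by auto
  have bdd: "integrable lborel (\<lambda>x. h x * p1 x)" "integrable lborel (\<lambda>x. h x * p2 x)"
    if "lip1 h" "\<And>x. \<bar>h x\<bar> \<le> H" for h H
    using integrable_mult_bounded[OF p1(1) borel_measurable_continuous_onI[OF lip1_continuous[OF that(1)]] that(2)]
      integrable_mult_bounded[OF p2(1) borel_measurable_continuous_onI[OF lip1_continuous[OF that(1)]] that(2)] by auto
  have n2: "integrable lborel (\<lambda>x. norm x * p2 x)"
  proof -
    \<comment> \<open>The hypothesis bounds the truncated moments of \<open>p2\<close> by the first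
      moment of \<open>p1\<close> plus \<open>B\<close>, uniformly in \<open>n\<close>, and monotone
      convergence concludes.\<close>
    define X where "X n = (LBINT x. min (norm x) (real n) * p2 x)" for n
    have lip: "lip1 (\<lambda>x::'a. min (norm x) (real n))" for n
    proof (intro allI)
      fix x y :: 'a
      show "\<bar>min (norm x) (real n) - min (norm y) (real n)\<bar> \<le> norm (x - y)"
        using norm_triangle_ineq3[of x y] by linarith
    qed
    have bn: "\<bar>min (norm x) (real n)\<bar> \<le> real n" for x :: 'a and n by simp
    have mono: "mono (\<lambda>n. min (norm x) (real n) * p2 x)" for x
      using p2(2)[of x] by (intro monoI mult_right_mono) auto
    have inc: "incseq X"
      unfolding X_def using mono by (intro monoI integral_mono bdd(2)[OF lip bn]) (auto simp: mono_def)
    have "X n \<le> (LBINT x. norm x * p1 x) + B" for n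
    proof -
      have "(LBINT x. min (norm x) (real n) * p1 x) \<le> (LBINT x. norm x * p1 x)"
        using p1(2) by (intro integral_mono bdd(1)[OF lip bn] n1 mult_right_mono) auto
      then show ?thesis using bd[OF lip bn, of n] by (simp add: X_def)
    qed
    then obtain L where L: "X \<longlonglongrightarrow> L" using incseq_convergent[OF inc] by blast
    show ?thesis
    proof (rule integrable_monotone_convergence)
      show "integrable lborel (\<lambda>x. min (norm x) (real n) * p2 x)" for n by (rule bdd(2)[OF lip bn])
      show "AE x in lborel. mono (\<lambda>n. min (norm x) (real n) * p2 x)" using mono by simp
      show "AE x in lborel. (\<lambda>n. min (norm x) (real n) * p2 x) \<longlonglongrightarrow> norm x * p2 x"
      proof (intro AE_I2 tendsto_eventually)
        fix x
        show "\<forall>\<^sub>F n in sequentially. min (norm x) (real n) * p2 x = norm x * p2 x"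
          using eventually_ge_at_top[of "nat \<lceil>norm x\<rceil>"] by eventually_elim (simp add: min_def; linarith)
      qed
      show "(\<lambda>n. LBINT x. min (norm x) (real n) * p2 x) \<longlonglongrightarrow> L" using L by (simp add: X_def[abs_def])
    qed measurable
  qed
  have lipi: "integrable lborel (\<lambda>x. h x * q x)"
    if h: "lip1 h" and q: "integrable lborel q" "\<And>x. 0 \<le> q x" "integrable lborel (\<lambda>x. norm x * q x)" for h q
  proof (rule Bochner_Integration.integrable_bound)
    have [measurable]: "h \<in> borel_measurable borel" "q \<in> borel_measurable borel"
      using borel_measurable_continuous_onI[OF lip1_continuous[OF h]] borel_measurable_integrable[OF q(1)] by auto
    show "integrable lborel (\<lambda>x. \<bar>h 0\<bar> * q x + norm x * q x)" using q by simp
    show "AE x in lborel. norm (h x * q x) \<le> norm (\<bar>h 0\<bar> * q x + norm x * q x)"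
    proof (rule AE_I2)
      fix x
      have "\<bar>h x\<bar> \<le> \<bar>h 0\<bar> + norm x" using h[rule_format, of x 0] by simp
      from mult_right_mono[OF this q(2)[of x]]
      show "norm (h x * q x) \<le> norm (\<bar>h 0\<bar> * q x + norm x * q x)"
        using q(2)[of x] by (simp add: abs_mult distrib_right)
    qed
    show "(\<lambda>x. h x * q x) \<in> borel_measurable lborel" by measurable
  qed
  have unb: "(LBINT x. h x * p2 x) - (LBINT x. h x * p1 x) \<le> B" if h: "lip1 h" for h
  proof -
    define hn where "hn n x = max (- real n) (min (real n) (h x))" for n x
    have lip: "lip1 (hn n)" for n
    proof (intro allI)
      fix x y
      show "\<bar>hn n x - hn n y\<bar> \<le> norm (x - y)"
        using h[rule_format, of x y] unfolding hn_def by linarith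
    qed
    have bn: "\<bar>hn n x\<bar> \<le> real n" for n x unfolding hn_def by simp
    have lim: "(\<lambda>n. LBINT x. hn n x * q x) \<longlonglongrightarrow> (LBINT x. h x * q x)"
      if q: "integrable lborel q" "\<And>x. 0 \<le> q x" "integrable lborel (\<lambda>x. norm x * q x)" for q
    proof (rule integral_dominated_convergence)
      have [measurable]: "h \<in> borel_measurable borel" "q \<in> borel_measurable borel"
        using borel_measurable_continuous_onI[OF lip1_continuous[OF h]] borel_measurable_integrable[OF q(1)] by auto
      show "integrable lborel (\<lambda>x. \<bar>h x * q x\<bar>)" using lipi[OF h q] by simp
      show "(\<lambda>x. h x * q x) \<in> borel_measurable lborel" "(\<lambda>x. hn n x * q x) \<in> borel_measurable lborel" for n
        unfolding hn_def by measurable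
      show "AE x in lborel. (\<lambda>n. hn n x * q x) \<longlonglongrightarrow> h x * q x"
      proof (intro AE_I2 tendsto_eventually)
        fix x
        show "\<forall>\<^sub>F n in sequentially. hn n x * q x = h x * q x"
          using eventually_ge_at_top[of "nat \<lceil>\<bar>h x\<bar>\<rceil>"]
        proof eventually_elim
          case (elim n)
          then have "\<bar>h x\<bar> \<le> real n" by linarith
          then have "hn n x = h x" unfolding hn_def by linarith
          then show ?case by simp
        qed
      qed
      show "AE x in lborel. norm (hn n x * q x) \<le> \<bar>h x * q x\<bar>" for n
      proof (rule AE_I2)
        fix x
        have "\<bar>hn n x\<bar> \<le> \<bar>h x\<bar>" unfolding hn_def by linarith
        then show "norm (hn n x * q x) \<le> \<bar>h x * q x\<bar>" by (simp add: abs_mult mult_right_mono)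
      qed
    qed
    show ?thesis
      by (rule tendsto_upperbound[OF tendsto_diff[OF lim[OF p2 n2] lim[OF p1 n1]]])
        (use bd[OF lip bn] in auto)
  qed
  show ?thesis
    unfolding wasserstein1_def
  proof (rule SUP_least)
    fix h :: "'a \<Rightarrow> real" assume "h \<in> {h. 1-lipschitz_on UNIV h}"
    then have h: "lip1 h" by (auto dest!: lipschitz_onD simp: dist_norm)
    then have h': "lip1 (\<lambda>x. - h x)" by (auto simp: abs_minus_commute)
    have [measurable]: "h \<in> borel_measurable borel"
      by (rule borel_measurable_continuous_onI[OF lip1_continuous[OF h]])
    have e1: "integrable M1 (\<lambda>\<omega>. h (X1 \<omega>))" "(\<integral>\<omega>. h (X1 \<omega>) \<partial>M1) = (LBINT x. h x * p1 x)"
      using distributed_integrable[OF D1, of h] distributed_integral[OF D1, of h] lipi[OF h p1 n1] p1(2)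
      by (simp_all add: mult.commute)
    have e2: "integrable M2 (\<lambda>\<omega>. h (X2 \<omega>))" "(\<integral>\<omega>. h (X2 \<omega>) \<partial>M2) = (LBINT x. h x * p2 x)"
      using distributed_integrable[OF D2, of h] distributed_integral[OF D2, of h] lipi[OF h p2 n2] p2(2)
      by (simp_all add: mult.commute)
    have "\<bar>(LBINT x. h x * p1 x) - (LBINT x. h x * p2 x)\<bar> \<le> B"
      using unb[OF h] unb[OF h'] by simp
    then show "(if integrable M1 (\<lambda>\<omega>. h (X1 \<omega>)) \<and> integrable M2 (\<lambda>\<omega>. h (X2 \<omega>))
        then ennreal \<bar>(\<integral>\<omega>. h (X1 \<omega>) \<partial>M1) - (\<integral>\<omega>. h (X2 \<omega>) \<partial>M2)\<bar> else \<infinity>) \<le> ennreal B"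
      using e1 e2 by (simp add: ennreal_leI)
  qed
qed

lemma wasserstein1_strongly_log_concave:
  fixes p1 p2 \<pi>0 :: "'a::euclidean_space \<Rightarrow> real"
  assumes p1: "integrable lborel p1" "\<And>x. 0 \<le> p1 x" "(LBINT x. p1 x) = 1"
    and p2: "integrable lborel p2" "\<And>x. 0 \<le> p2 x" "(LBINT x. p2 x) = 1" "\<And>x. p2 x = \<pi>0 x * p1 x"
    and D1: "distributed M1 lborel X1 (\<lambda>x. ennreal (p1 x))" and D2: "distributed M2 lborel X2 (\<lambda>x. ennreal (p2 x))"
    and wg: "has_weak_gradient_on \<pi>0 G (Omega p1)" and G: "integrable M1 (\<lambda>\<omega>. norm (G (X1 \<omega>)))"
    and k: "k > 0" and slc: "strongly_log_concave k p1"
  shows "wasserstein1 M1 X1 M2 X2 \<le> ennreal (1 / k * (\<integral>\<omega>. norm (G (X1 \<omega>)) \<partial>M1))"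
proof -
  \<comment> \<open>Strong log-concavity makes \<open>p1\<close> positive and C1 everywhere, so the
    weak gradient lives on the whole space, where mollification by convolution is possible.\<close>
  have wg': "has_weak_gradient_on \<pi>0 G UNIV"
    using wg strongly_log_concave_Omega[OF slc] by simp
  have [measurable]: "G \<in> borel_measurable borel"
    by (rule locally_integrable_measurable[OF has_weak_gradient_on_UNIV_locally_integrable(2)[OF wg']])
  have pos: "0 < p1 x" for x using slc by (simp add: strongly_log_concave_def)
  have Ck: "Ck_on 1 UNIV p1" using slc by (simp only: strongly_log_concave_def)
  have gD: "GDERIV p1 x :> grad p1 x" for x using Ck unfolding Ck_on_1_iff by (auto intro: GDERIV_grad)
  have ln: "grad (\<lambda>z. ln (p1 z)) x = grad p1 x /\<^sub>R p1 x" for x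
    by (rule grad_eqI, rule GDERIV_subst[OF GDERIV_DERIV_compose[OF gD[of x] DERIV_ln[OF pos]]]) simp
  have Gi: "integrable lborel (\<lambda>x. norm (G x) * p1 x)" "(\<integral>\<omega>. norm (G (X1 \<omega>)) \<partial>M1) = (LBINT x. norm (G x) * p1 x)"
    using distributed_integrable[OF D1, of "\<lambda>x. norm (G x)"] distributed_integral[OF D1, of "\<lambda>x. norm (G x)"] G p1(2)
    by (simp_all add: mult.commute)
  have "p2 = (\<lambda>x. \<pi>0 x * p1 x)" using p2(4) by auto
  then have r: "integrable lborel (\<lambda>x. \<pi>0 x * p1 x)" "(LBINT x. \<pi>0 x * p1 x) = 1"
    using p2(1,3) by auto
  interpret log_concave_density_ratio p1 \<pi>0 "grad p1" G k
  proof
    show "(y - x) \<bullet> (grad p1 y /\<^sub>R p1 y - grad p1 x /\<^sub>R p1 x) \<le> - k * (norm (y - x))\<^sup>2" for x y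
      using slc by (simp add: strongly_log_concave_def ln)
    show "0 \<le> \<pi>0 x" for x using p2(2)[of x] p2(4)[of x] pos[of x] by (simp add: zero_le_mult_iff)
    show "continuous_on UNIV (grad p1)" using Ck unfolding Ck_on_1_iff by simp
  qed (fact gD pos p1 r k wg' Gi)+
  show ?thesis
  proof (rule wasserstein1_le_bounded[OF p1(1,2) p2(1,2) D1 D2 integrable_norm_density])
    fix h :: "'a \<Rightarrow> real" and H assume h: "lip1 h" "\<And>x. \<bar>h x\<bar> \<le> H"
    have "k * ((LBINT x. h x * p2 x) - (LBINT x. h x * p1 x)) \<le> (LBINT x. norm (G x) * p1 x)"
      using bounded_lipschitz_bound[OF h] by (simp add: p2(4))
    then show "(LBINT x. h x * p2 x) - (LBINT x. h x * p1 x) \<le> 1 / k * (\<integral>\<omega>. norm (G (X1 \<omega>)) \<partial>M1)"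
      using k Gi(2) by (simp add: field_simps)
  qed
qed

section \<open>Vanishing integrals against test functions\<close>

text \<open>The positive and the negative part of \<open>u\<close> are densities of finite measures
  that agree on boxes. Boxes are an intersection-stable generator, so the measures coincide, and
  with them the densities almost everywhere.\<close>

lemma AE_zero_if_box_integrals_zero:
  fixes u :: "'a::euclidean_space \<Rightarrow> real"
  assumes u: "integrable lborel u" and zero: "\<And>a c. (LBINT x. indicator (box a c) x * u x) = 0"
  shows "AE x in lborel. u x = 0"
proof -
  have [measurable]: "u \<in> borel_measurable borel" using borel_measurable_integrable[OF u] by simp
  define P where "P x = ennreal (max 0 (u x))" for x
  define N where "N x = ennreal (max 0 (- u x))" for x
  have [measurable]: "P \<in> borel_measurable borel" "N \<in> borel_measurable borel"
    unfolding P_def N_def by measurable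
  have ip: "integrable lborel (\<lambda>x. max 0 (u x))" "integrable lborel (\<lambda>x. max 0 (- u x))"
    using u by (auto intro!: integrable_max)
  let ?E = "range (\<lambda>(a, b). box a b :: 'a set)"
  have "density lborel P = density lborel N"
  proof (rule measure_eqI_generator_eq)
    show "Int_stable ?E" by (auto simp: Int_stable_def box_Int_box)
    show "?E \<subseteq> Pow UNIV" "sets (density lborel P) = sigma_sets UNIV ?E" "sets (density lborel N) = sigma_sets UNIV ?E"
      by (simp_all add: borel_eq_box)
    let ?A = "\<lambda>n::nat. box (- (real n *\<^sub>R One)) (real n *\<^sub>R One) :: 'a set"
    show "range ?A \<subseteq> ?E" "(\<Union>i. ?A i) = UNIV" unfolding UN_box_eq_UNIV by auto
    have em: "emeasure (density lborel (\<lambda>x. ennreal (w x))) (box a c) = ennreal (LBINT x. indicator (box a c) x * w x)"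
      if w: "integrable lborel w" "\<And>x. 0 \<le> w x" for w :: "'a \<Rightarrow> real" and a c
    proof -
      have [measurable]: "w \<in> borel_measurable borel" using borel_measurable_integrable[OF w(1)] by simp
      have "emeasure (density lborel (\<lambda>x. ennreal (w x))) (box a c) = (\<integral>\<^sup>+x. ennreal (indicator (box a c) x * w x) \<partial>lborel)"
        by (subst emeasure_density) (auto intro!: nn_integral_cong simp: indicator_def)
      also have "\<dots> = ennreal (LBINT x. indicator (box a c) x * w x)"
        using w integrable_mult_indicator[OF _ w(1), of "box a c"] by (intro nn_integral_eq_integral) auto
      finally show ?thesis .
    qed
    show "emeasure (density lborel P) (?A i) \<noteq> \<infinity>" for i
      unfolding P_def by (subst em[OF ip(1)]) auto
    fix X assume "X \<in> ?E"
    then obtain a c where X: "X = box a c" by auto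
    have "(LBINT x. indicator (box a c) x * u x) = (LBINT x. indicator (box a c) x * max 0 (u x) - indicator (box a c) x * max 0 (- u x))"
      by (rule Bochner_Integration.integral_cong) (auto simp: max_def)
    also have "\<dots> = (LBINT x. indicator (box a c) x * max 0 (u x)) - (LBINT x. indicator (box a c) x * max 0 (- u x))"
      using integrable_mult_indicator[OF _ ip(1), of "box a c"] integrable_mult_indicator[OF _ ip(2), of "box a c"]
      by (intro Bochner_Integration.integral_diff) auto
    finally have "(LBINT x. indicator (box a c) x * max 0 (u x)) = (LBINT x. indicator (box a c) x * max 0 (- u x))"
      using zero[of a c] by simp
    then show "emeasure (density lborel P) X = emeasure (density lborel N) X"
      unfolding X P_def N_def by (simp only: em[OF ip(1)] em[OF ip(2)] max.cobounded1)
  qed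
  then have "AE x in lborel. P x = N x"
  proof (subst (asm) finite_density_unique)
    have "integral\<^sup>N lborel P = ennreal (LBINT x. max 0 (u x))"
      unfolding P_def by (rule nn_integral_eq_integral[OF ip(1)]) auto
    then show "integral\<^sup>N lborel P \<noteq> \<infinity>" by simp
  qed auto
  \<comment> \<open>Positive and negative part of \<open>u x\<close> are equal only if both
    vanish.\<close>
  then show ?thesis
    by eventually_elim (auto simp: P_def N_def max_def split: if_splits)
qed

lemma flat_exp_scaled_tendsto: "t > 0 \<Longrightarrow> (\<lambda>n. flat_exp 0 (real (Suc n) * t)) \<longlonglongrightarrow> 1"
proof -
  assume t: "t > 0"
  have "(\<lambda>n. exp (- inverse (real (Suc n)) / t)) \<longlonglongrightarrow> exp (- 0 / t)"
    using t by (intro tendsto_intros LIMSEQ_inverse_real_of_nat) auto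
  moreover have "flat_exp 0 (real (Suc n) * t) = exp (- inverse (real (Suc n)) / t)" for n
    using t by (simp add: flat_exp_def inverse_eq_divide mult_pos_pos)
  ultimately show ?thesis by simp
qed

lemma flat_exp_0_le_1: "flat_exp 0 t \<le> 1"
  by (simp add: flat_exp_def)

text \<open>With growing steepness \<open>real (Suc n)\<close> the bumps converge pointwise to the
  indicator of the open box, while their supports stay in the closed box and their values below
  1.\<close>

lemma box_integral_zero:
  fixes q :: "'a::euclidean_space \<Rightarrow> 'b::euclidean_space"
  assumes S: "cbox a c \<subseteq> S" and q: "set_integrable lborel (cbox a c) q"
    and zero: "\<And>\<phi>. \<phi> \<in> test_functions S \<Longrightarrow> (LBINT x. \<phi> x *\<^sub>R q x) = 0"
  shows "(LBINT x. indicator (box a c) x *\<^sub>R q x) = 0"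
proof -
  define \<phi> where "\<phi> n = box_bump (\<lambda>_. 0) (\<lambda>_. 0) a c (real (Suc n))" for n
  \<comment> \<open>\<open>q\<close> is known to be integrable on the closed box only;
    \<open>q'\<close> is globally integrable and agrees with \<open>q\<close> wherever a bump is
    nonzero.\<close>
  define q' where "q' x = indicator (cbox a c) x *\<^sub>R q x" for x
  have q': "integrable lborel q'" using q by (simp add: set_integrable_def q'_def[abs_def])
  then have [measurable]: "q' \<in> borel_measurable borel" using borel_measurable_integrable by auto
  have \<phi>: "\<phi> n \<in> test_functions S" for n
    unfolding \<phi>_def using S by (intro box_bump_test_function) auto
  have [measurable]: "\<phi> n \<in> borel_measurable borel" for n
    by (intro borel_measurable_continuous_onI test_functions_continuous[OF \<phi>])
  have nz: "\<phi> n x \<noteq> 0 \<longleftrightarrow> x \<in> box a c" for n x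
    unfolding \<phi>_def by (rule box_bump_nonzero_iff) simp
  have le: "\<bar>\<phi> n x\<bar> \<le> 1" for n x
    unfolding \<phi>_def abs_of_nonneg[OF box_bump_nonneg]
    unfolding box_bump_def by (intro prod_le_1 conjI mult_nonneg_nonneg flat_exp_nonneg mult_le_one flat_exp_0_le_1)
  have lim: "(\<lambda>n. \<phi> n x) \<longlonglongrightarrow> indicator (box a c) x" for x
  proof (cases "x \<in> box a c")
    case True
    have "(\<lambda>n. \<phi> n x) \<longlonglongrightarrow> (\<Prod>b\<in>(Basis::'a set). 1 * 1)"
      unfolding \<phi>_def box_bump_def using True
      by (intro tendsto_prod tendsto_mult flat_exp_scaled_tendsto) (auto simp: mem_box)
    then show ?thesis using True by simp
  qed (use nz[of _ x] in auto)
  have eq: "w *\<^sub>R q x = w *\<^sub>R q' x" if "w \<noteq> 0 \<Longrightarrow> x \<in> box a c" for w :: real and x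
    using that box_subset_cbox[of a c] by (cases "w = 0") (auto simp: q'_def indicator_def)
  have "(\<lambda>n. LBINT x. \<phi> n x *\<^sub>R q' x) \<longlonglongrightarrow> (LBINT x. indicator (box a c) x *\<^sub>R q' x)"
  proof (rule integral_dominated_convergence)
    show "integrable lborel (\<lambda>x. norm (q' x))" using q' by simp
    show "AE x in lborel. (\<lambda>n. \<phi> n x *\<^sub>R q' x) \<longlonglongrightarrow> indicator (box a c) x *\<^sub>R q' x"
      by (intro AE_I2 tendsto_intros lim)
    show "AE x in lborel. norm (\<phi> n x *\<^sub>R q' x) \<le> norm (q' x)" for n
    proof (rule AE_I2)
      fix x show "norm (\<phi> n x *\<^sub>R q' x) \<le> norm (q' x)"
        using mult_right_mono[OF le[of n x], of "norm (q' x)"] by simp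
    qed
  qed measurable
  moreover have "(LBINT x. \<phi> n x *\<^sub>R q' x) = 0" for n
  proof -
    have "(LBINT x. \<phi> n x *\<^sub>R q' x) = (LBINT x. \<phi> n x *\<^sub>R q x)"
      by (rule Bochner_Integration.integral_cong[OF refl], rule eq[symmetric]) (use nz in blast)
    then show ?thesis using zero[OF \<phi>] by simp
  qed
  ultimately have "(LBINT x. indicator (box a c) x *\<^sub>R q' x) = 0"
    using LIMSEQ_unique[OF _ tendsto_const] by simp
  moreover have "(LBINT x. indicator (box a c) x *\<^sub>R q' x) = (LBINT x. indicator (box a c) x *\<^sub>R q x)"
    by (rule Bochner_Integration.integral_cong[OF refl], rule eq[symmetric]) (auto simp: indicator_def split: if_splits)
  ultimately show ?thesis by simp
qed

text \<open>The fundamental lemma of the calculus of variations. \<open>S\<close> is a countable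
  union of closed boxes with null boundary, so it suffices to argue inside one box, coordinate by
  coordinate, using all its subboxes.\<close>

lemma AE_zero_if_test_integrals_zero:
  fixes q :: "'a::euclidean_space \<Rightarrow> 'b::euclidean_space"
  assumes S: "open S" and q: "\<And>K. compact K \<Longrightarrow> K \<subseteq> S \<Longrightarrow> set_integrable lborel K q"
    and zero: "\<And>\<phi>. \<phi> \<in> test_functions S \<Longrightarrow> (LBINT x. \<phi> x *\<^sub>R q x) = 0"
  shows "AE x in lborel. x \<in> S \<longrightarrow> q x = 0"
proof -
  have box: "AE x in lborel. x \<in> box a0 c0 \<longrightarrow> q x = 0" if ac: "cbox a0 c0 \<subseteq> S" for a0 c0
  proof -
    define u where "u x = indicator (box a0 c0) x *\<^sub>R q x" for x
    have iq: "set_integrable lborel (cbox a0 c0) q" by (rule q[OF compact_cbox ac])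
    then have ui: "integrable lborel u"
      unfolding u_def using set_integrable_subset[OF iq, of "box a0 c0"] box_subset_cbox[of a0 c0]
      by (auto simp: set_integrable_def)
    have uz: "(LBINT x. indicator (box a c) x *\<^sub>R u x) = 0" for a c
    proof -
      obtain a' c' where B: "box a c \<inter> box a0 c0 = box a' c'" by (rule that[OF box_Int_box])
      have "(LBINT x. indicator (box a c) x *\<^sub>R u x) = (LBINT x. indicator (box a' c') x *\<^sub>R q x)"
        unfolding B[symmetric] by (intro Bochner_Integration.integral_cong) (auto simp: u_def indicator_def)
      also have "\<dots> = 0"
      proof (cases "box a' c' = {}")
        case False
        \<comment> \<open>Nonemptiness matters: only then is the closed box the closure of the open
          one, so that it lies inside \<open>S\<close>.\<close>
        have "cbox a' c' = closure (box a' c')" using False by simp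
        also have "\<dots> \<subseteq> cbox a0 c0"
          using B box_subset_cbox[of a0 c0] by (intro closure_minimal) auto
        finally have sub: "cbox a' c' \<subseteq> cbox a0 c0" .
        show ?thesis
          by (rule box_integral_zero[OF order_trans[OF sub ac] set_integrable_subset[OF iq _ sub] zero]) auto
      qed simp
      finally show ?thesis .
    qed
    have "AE x in lborel. u x \<bullet> b = 0" for b
    proof (rule AE_zero_if_box_integrals_zero)
      show "integrable lborel (\<lambda>x. u x \<bullet> b)" by (rule integrable_inner_left) (rule ui)
      fix a c
      have "integrable lborel (\<lambda>x. indicator (box a c) x *\<^sub>R u x)"
        by (rule integrable_mult_indicator[OF _ ui]) simp
      from integral_inner_left[OF this, of b]
      show "(LBINT x. indicator (box a c) x * (u x \<bullet> b)) = 0" using uz[of a c] by simp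
    qed
    then have "AE x in lborel. \<forall>b\<in>Basis. u x \<bullet> b = 0"
      by (intro AE_finite_allI) auto
    then show ?thesis
    proof eventually_elim
      case (elim x)
      then have "u x = 0" by (simp add: euclidean_eq_iff[of "u x"])
      then show ?case by (auto simp: u_def)
    qed
  qed
  obtain \<D> where \<D>0: "countable \<D>" "\<D> \<subseteq> Pow S" "\<And>X. X \<in> \<D> \<Longrightarrow> \<exists>a b. X = cbox a b" "\<Union>\<D> = S"
    using open_countable_Union_open_cbox[OF S] by blast
  then have \<D>: "countable \<D>" "\<And>X. X \<in> \<D> \<Longrightarrow> X \<subseteq> S \<and> (\<exists>a b. X = cbox a b)" "\<Union>\<D> = S"
    by auto
  have "AE x in lborel. x \<in> X \<longrightarrow> q x = 0" if X: "X \<in> \<D>" for X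
  proof -
    obtain a c where ac: "X = cbox a c" "cbox a c \<subseteq> S" using \<D>(2)[OF X] by auto
    have "AE x in lborel. x \<notin> cbox a c - box a c"
      using null_sets_cbox_Diff_box[of a c] by (rule AE_not_in)
    with box[OF ac(2)] show ?thesis unfolding ac(1) by eventually_elim auto
  qed
  then have "AE x in lborel. \<forall>X\<in>\<D>. x \<in> X \<longrightarrow> q x = 0"
    using \<D>(1) by (subst AE_ball_countable) auto
  then show ?thesis
  proof eventually_elim
    case (elim x)
    then show ?case using \<D>(3) by blast
  qed
qed

text \<open>Difference quotients of \<open>F\<close> have integral 0 by translation invariance, and
  they converge to the partial derivative uniformly and with support in a fixed ball.\<close>

lemma integral_grad_eq_0:
  fixes F :: "'a::euclidean_space \<Rightarrow> real"
  assumes F: "\<And>x. GDERIV F x :> DF x" "continuous_on UNIV DF" "\<And>x. x \<notin> cball 0 R \<Longrightarrow> F x = 0"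
  shows "(LBINT x. DF x) = 0"
proof (rule euclidean_eqI)
  have DF0: "DF x = 0" if "x \<notin> cball 0 R" for x
    by (rule GDERIV_eq_0_outside_cball[OF F(1,3) that])
  fix u :: 'a assume u: "u \<in> Basis"
  have Fc: "continuous_on UNIV F"
    by (rule GDERIV_imp_continuous_on[OF F(1)])
  have [measurable]: "F \<in> borel_measurable borel" by (rule borel_measurable_continuous_onI[OF Fc])
  have DFi: "integrable lborel DF" by (rule continuous_vanishing_integrable[OF F(2) DF0])
  have Fi: "integrable lborel F" by (rule continuous_vanishing_integrable[OF Fc F(3)])
  define m where "m = measure lborel (cball (0::'a) (R + 1))"
  have m: "m \<ge> 0" by (simp add: m_def)
  have "\<bar>LBINT x. DF x \<bullet> u\<bar> \<le> 0 + e" if e: "e > 0" for e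
  proof -
    define \<omega> where "\<omega> = e / (m + 1)"
    have \<omega>: "\<omega> > 0" "\<omega> * m \<le> e" using e m by (auto simp: \<omega>_def field_simps)
    obtain d where d: "d > 0" "\<And>x y. norm (x - y) < d \<Longrightarrow> norm (DF x - DF y) < \<omega>"
      using continuous_vanishing_uniform[OF F(2) DF0 \<omega>(1)] by blast
    define t where "t = min d 1 / 2"
    have t: "0 < t" "t < d" "t < 1" using d by (auto simp: t_def)
    have nu: "norm (t *\<^sub>R u) = t" using u t by simp
    define q where "q x = F (x + t *\<^sub>R u) - F x - t * (DF x \<bullet> u)" for x
    have "integral\<^sup>L lborel q = (LBINT x. F (x + t *\<^sub>R u)) - (LBINT x. F x) - t * (LBINT x. DF x \<bullet> u)"
      unfolding q_def using Fi DFi integrable_lborel_shift[of F "t *\<^sub>R u"] by simp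
    then have qe: "integral\<^sup>L lborel q = - t * (LBINT x. DF x \<bullet> u)"
      using integral_lborel_shift[of F "t *\<^sub>R u"] by simp
    have "\<bar>integral\<^sup>L lborel q\<bar> \<le> (t * \<omega>) * m"
      unfolding m_def
    proof (rule integral_bound_on_cball)
      fix x :: 'a
      have "\<bar>F (x + t *\<^sub>R u) - F x - (t *\<^sub>R u) \<bullet> DF x\<bar> \<le> \<omega> * norm (t *\<^sub>R u)"
      proof (rule GDERIV_linear_remainder[OF F(1)])
        fix z assume "z \<in> closed_segment x (x + t *\<^sub>R u)"
        then have "norm (z - x) \<le> t" using segment_bound1[of z x "x + t *\<^sub>R u"] nu by simp
        then show "norm (DF z - DF x) \<le> \<omega>" using d(2)[of z x] t by simp
      qed
      then show "\<bar>q x\<bar> \<le> t * \<omega>" using nu by (simp add: q_def inner_commute mult.commute)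
      assume x: "x \<notin> cball 0 (R + 1)"
      then have "x + t *\<^sub>R u \<notin> cball 0 R" "x \<notin> cball 0 R"
        using norm_triangle_ineq2[of x "- (t *\<^sub>R u)"] nu t by auto
      then show "q x = 0" using F(3) DF0 by (simp add: q_def)
    qed (use t \<omega> in auto)
    then have "t * \<bar>LBINT x. DF x \<bullet> u\<bar> \<le> t * (\<omega> * m)"
      unfolding qe using t by (simp add: abs_mult mult.assoc)
    then have "\<bar>LBINT x. DF x \<bullet> u\<bar> \<le> \<omega> * m" using t by simp
    then show ?thesis using \<omega> by simp
  qed
  then have "\<bar>LBINT x. DF x \<bullet> u\<bar> \<le> 0" by (rule field_le_epsilon)
  then show "(LBINT x. DF x) \<bullet> u = 0 \<bullet> u" using DFi by simp
qed

lemma test_functions_integration_by_parts: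
  fixes \<phi> \<psi> :: "'a::euclidean_space \<Rightarrow> real"
  assumes \<phi>: "\<phi> \<in> test_functions S" and \<psi>: "\<psi> \<in> test_functions T"
  shows "(LBINT x. \<psi> x *\<^sub>R grad \<phi> x) = - (LBINT x. \<phi> x *\<^sub>R grad \<psi> x)"
proof -
  obtain R where R: "\<And>x. x \<notin> cball 0 R \<Longrightarrow> \<phi> x = 0" "\<And>x. x \<notin> cball 0 R \<Longrightarrow> grad \<phi> x = 0"
    by (rule test_functions_vanish[OF \<phi>]) (rule that)
  note c = test_functions_continuous[OF \<phi>] test_functions_continuous[OF \<psi>]
    test_functions_grad_continuous[OF \<phi>] test_functions_grad_continuous[OF \<psi>]
  have i: "integrable lborel (\<lambda>x. \<phi> x *\<^sub>R grad \<psi> x)" "integrable lborel (\<lambda>x. \<psi> x *\<^sub>R grad \<phi> x)"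
    by (rule continuous_vanishing_integrable[of _ R], rule continuous_on_scaleR[OF c(1,4)] continuous_on_scaleR[OF c(2,3)], simp add: R)+
  have "(LBINT x. \<phi> x *\<^sub>R grad \<psi> x + \<psi> x *\<^sub>R grad \<phi> x) = 0"
  proof (rule integral_grad_eq_0[of "\<lambda>x. \<phi> x * \<psi> x" _ R])
    show "GDERIV (\<lambda>x. \<phi> x * \<psi> x) x :> \<phi> x *\<^sub>R grad \<psi> x + \<psi> x *\<^sub>R grad \<phi> x" for x
      by (rule GDERIV_mult[OF test_functions_GDERIV[OF \<phi>] test_functions_GDERIV[OF \<psi>]])
    show "continuous_on UNIV (\<lambda>x. \<phi> x *\<^sub>R grad \<psi> x + \<psi> x *\<^sub>R grad \<phi> x)"
      by (rule continuous_on_add[OF continuous_on_scaleR[OF c(1,4)] continuous_on_scaleR[OF c(2,3)]])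
  qed (simp_all add: R)
  then show ?thesis using i by (simp add: eq_neg_iff_add_eq_0 add.commute)
qed

section \<open>Cauchy-Schwarz and Minkowski inequalities for square-integrable functions\<close>

lemma
  fixes u v :: "'a \<Rightarrow> real"
  assumes [measurable]: "u \<in> borel_measurable M" "v \<in> borel_measurable M"
    and i: "integrable M (\<lambda>x. (u x)\<^sup>2)" "integrable M (\<lambda>x. (v x)\<^sup>2)"
  shows integrable_mult_square_integrable: "integrable M (\<lambda>x. u x * v x)"
    and integral_Cauchy_Schwarz: "(\<integral>x. \<bar>u x\<bar> * \<bar>v x\<bar> \<partial>M) \<le> sqrt (\<integral>x. (u x)\<^sup>2 \<partial>M) * sqrt (\<integral>x. (v x)\<^sup>2 \<partial>M)"
proof -
  have le: "\<bar>u x\<bar> * \<bar>v x\<bar> \<le> (u x)\<^sup>2 + (v x)\<^sup>2" for x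
    using sum_squares_bound[of "\<bar>u x\<bar>" "\<bar>v x\<bar>"] mult_nonneg_nonneg[of "\<bar>u x\<bar>" "\<bar>v x\<bar>"]
    unfolding power2_abs by linarith
  show int: "integrable M (\<lambda>x. u x * v x)"
  proof (rule Bochner_Integration.integrable_bound)
    show "integrable M (\<lambda>x. (u x)\<^sup>2 + (v x)\<^sup>2)" using i by simp
    show "AE x in M. norm (u x * v x) \<le> norm ((u x)\<^sup>2 + (v x)\<^sup>2)"
      using le by (simp add: abs_mult)
  qed measurable
  have int': "integrable M (\<lambda>x. \<bar>u x\<bar> * \<bar>v x\<bar>)" using int by (simp add: abs_mult[symmetric])
  have "(\<integral>\<^sup>+x. ennreal \<bar>u x\<bar> * ennreal \<bar>v x\<bar> \<partial>M)\<^sup>2 \<le> (\<integral>\<^sup>+x. (ennreal \<bar>u x\<bar>)\<^sup>2 \<partial>M) * (\<integral>\<^sup>+x. (ennreal \<bar>v x\<bar>)\<^sup>2 \<partial>M)"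
    by (rule Cauchy_Schwarz_nn_integral) measurable
  also have "(\<integral>\<^sup>+x. ennreal \<bar>u x\<bar> * ennreal \<bar>v x\<bar> \<partial>M) = ennreal (\<integral>x. \<bar>u x\<bar> * \<bar>v x\<bar> \<partial>M)"
    using int' by (simp add: ennreal_mult[symmetric] nn_integral_eq_integral)
  also have "(\<integral>\<^sup>+x. (ennreal \<bar>u x\<bar>)\<^sup>2 \<partial>M) = ennreal (\<integral>x. (u x)\<^sup>2 \<partial>M)"
    using i(1) by (simp add: ennreal_power nn_integral_eq_integral)
  also have "(\<integral>\<^sup>+x. (ennreal \<bar>v x\<bar>)\<^sup>2 \<partial>M) = ennreal (\<integral>x. (v x)\<^sup>2 \<partial>M)"
    using i(2) by (simp add: ennreal_power nn_integral_eq_integral)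
  finally have "(\<integral>x. \<bar>u x\<bar> * \<bar>v x\<bar> \<partial>M)\<^sup>2 \<le> (\<integral>x. (u x)\<^sup>2 \<partial>M) * (\<integral>x. (v x)\<^sup>2 \<partial>M)"
    by (simp add: ennreal_power ennreal_mult[symmetric])
  from real_sqrt_le_mono[OF this]
  show "(\<integral>x. \<bar>u x\<bar> * \<bar>v x\<bar> \<partial>M) \<le> sqrt (\<integral>x. (u x)\<^sup>2 \<partial>M) * sqrt (\<integral>x. (v x)\<^sup>2 \<partial>M)"
    by (simp add: real_sqrt_mult)
qed

text \<open>Minkowski's inequality, with pointwise domination in place of a sum so that it also
  applies to norms of vector-valued functions.\<close>

lemma sqrt_integral_square_triangle:
  fixes u v :: "'a \<Rightarrow> real"
  assumes [measurable]: "u \<in> borel_measurable M" "v \<in> borel_measurable M" "w \<in> borel_measurable M"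
    and i: "integrable M (\<lambda>x. (u x)\<^sup>2)" "integrable M (\<lambda>x. (v x)\<^sup>2)"
    and le: "\<And>x. \<bar>w x\<bar> \<le> \<bar>u x\<bar> + \<bar>v x\<bar>"
  shows "integrable M (\<lambda>x. (w x)\<^sup>2)"
    and "sqrt (\<integral>x. (w x)\<^sup>2 \<partial>M) \<le> sqrt (\<integral>x. (u x)\<^sup>2 \<partial>M) + sqrt (\<integral>x. (v x)\<^sup>2 \<partial>M)"
proof -
  note uv = integrable_mult_square_integrable[OF assms(1,2) i]
  have uv': "integrable M (\<lambda>x. \<bar>u x\<bar> * \<bar>v x\<bar>)" using uv by (simp add: abs_mult[symmetric])
  have sq: "(w x)\<^sup>2 \<le> (u x)\<^sup>2 + 2 * (\<bar>u x\<bar> * \<bar>v x\<bar>) + (v x)\<^sup>2" for x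
  proof -
    have "(w x)\<^sup>2 \<le> (\<bar>u x\<bar> + \<bar>v x\<bar>)\<^sup>2" using le[of x] abs_le_square_iff[of "w x" "\<bar>u x\<bar> + \<bar>v x\<bar>"] by simp
    then show ?thesis by (simp add: power2_sum)
  qed
  show int: "integrable M (\<lambda>x. (w x)\<^sup>2)"
  proof (rule Bochner_Integration.integrable_bound)
    show "integrable M (\<lambda>x. (u x)\<^sup>2 + 2 * (\<bar>u x\<bar> * \<bar>v x\<bar>) + (v x)\<^sup>2)" using i uv' by simp
    show "AE x in M. norm ((w x)\<^sup>2) \<le> norm ((u x)\<^sup>2 + 2 * (\<bar>u x\<bar> * \<bar>v x\<bar>) + (v x)\<^sup>2)"
      using order_trans[OF sq abs_ge_self] by simp
  qed measurable
  have "(\<integral>x. (w x)\<^sup>2 \<partial>M) \<le> (\<integral>x. (u x)\<^sup>2 + 2 * (\<bar>u x\<bar> * \<bar>v x\<bar>) + (v x)\<^sup>2 \<partial>M)"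
    using int i uv' sq by (intro integral_mono) auto
  also have "\<dots> = (\<integral>x. (u x)\<^sup>2 \<partial>M) + 2 * (\<integral>x. \<bar>u x\<bar> * \<bar>v x\<bar> \<partial>M) + (\<integral>x. (v x)\<^sup>2 \<partial>M)"
    using i uv' by simp
  also have "\<dots> \<le> (\<integral>x. (u x)\<^sup>2 \<partial>M) + 2 * (sqrt (\<integral>x. (u x)\<^sup>2 \<partial>M) * sqrt (\<integral>x. (v x)\<^sup>2 \<partial>M)) + (\<integral>x. (v x)\<^sup>2 \<partial>M)"
    using integral_Cauchy_Schwarz[OF assms(1,2) i] by simp
  also have "\<dots> = (sqrt (\<integral>x. (u x)\<^sup>2 \<partial>M) + sqrt (\<integral>x. (v x)\<^sup>2 \<partial>M))\<^sup>2"
    by (simp add: power2_sum)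
  finally show "sqrt (\<integral>x. (w x)\<^sup>2 \<partial>M) \<le> sqrt (\<integral>x. (u x)\<^sup>2 \<partial>M) + sqrt (\<integral>x. (v x)\<^sup>2 \<partial>M)"
    by (simp add: real_le_lsqrt)
qed

section \<open>Densities with a Poincare constant\<close>

locale poincare_density =
  fixes p :: "'a::euclidean_space \<Rightarrow> real" and C :: real
  assumes p_measurable [measurable]: "p \<in> borel_measurable borel" and p_nonneg: "\<And>x. 0 \<le> p x"
    and p_mass: "(\<integral>\<^sup>+x. ennreal (p x) \<partial>lborel) = 1" and poincare: "poincare_constant C p"
begin

sublocale prob_space "law p"
proof
  show "emeasure (law p) (space (law p)) = 1"
    using p_mass by (simp add: law_def emeasure_density)
qed

lemma sets_law [measurable_cong]: "sets (law p) = sets borel"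
  by (simp add: law_def)

lemma space_law [simp]: "space (law p) = UNIV"
  by (simp add: law_def)

lemma prob_UNIV [simp]: "prob UNIV = 1"
  using prob_space by simp

lemma integrable_law:
  fixes f :: "'a \<Rightarrow> 'b::euclidean_space"
  assumes "f \<in> borel_measurable borel"
  shows "integrable (law p) f \<longleftrightarrow> integrable lborel (\<lambda>x. p x *\<^sub>R f x)"
  unfolding law_def using assms p_nonneg by (intro integrable_density) auto

lemma integral_law:
  fixes f :: "'a \<Rightarrow> 'b::euclidean_space"
  assumes "f \<in> borel_measurable borel"
  shows "(\<integral>x. f x \<partial>law p) = (LBINT x. p x *\<^sub>R f x)"
  unfolding law_def using assms p_nonneg by (intro integral_density) auto

text \<open>The inequality of the definition is for centred functions, hence the subtraction of the
  mean. \<open>max C 0\<close> appears because \<open>ennreal C\<close> is 0 for negative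
  \<open>C\<close>.\<close>

lemma poincare_integral:
  assumes \<phi>: "\<And>x. GDERIV \<phi> x :> D x" and [measurable]: "D \<in> borel_measurable borel"
    and i: "integrable (law p) (\<lambda>x. (\<phi> x)\<^sup>2)" "integrable (law p) (\<lambda>x. (norm (D x))\<^sup>2)"
  shows "integrable (law p) (\<lambda>x. (\<phi> x - expectation \<phi>)\<^sup>2)"
    and "(\<integral>x. (\<phi> x - expectation \<phi>)\<^sup>2 \<partial>law p) \<le> max C 0 * (\<integral>x. (norm (D x))\<^sup>2 \<partial>law p)"
proof -
  have "continuous_on UNIV \<phi>"
    by (rule GDERIV_imp_continuous_on[OF \<phi>])
  then have [measurable]: "\<phi> \<in> borel_measurable borel" by (rule borel_measurable_continuous_onI)
  have i1: "integrable (law p) \<phi>"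
    by (rule square_integrable_imp_integrable[OF _ i(1)]) measurable
  define m where "m = expectation \<phi>"
  define \<psi> where "\<psi> x = \<phi> x - m" for x
  have \<psi>D: "GDERIV \<psi> x :> D x" for x
    using GDERIV_diff[OF \<phi>[of x] GDERIV_const[of m]] by (simp add: \<psi>_def[abs_def])
  have \<psi>g: "grad \<psi> = D" using grad_eqI[OF \<psi>D] by auto
  have eq: "(\<psi> x)\<^sup>2 = (\<phi> x)\<^sup>2 - 2 * m * \<phi> x + m\<^sup>2" for x
    by (simp add: \<psi>_def power2_eq_square algebra_simps)
  have i2: "integrable (law p) (\<lambda>x. (\<psi> x)\<^sup>2)"
    unfolding eq using i(1) i1 by simp
  then show "integrable (law p) (\<lambda>x. (\<phi> x - expectation \<phi>)\<^sup>2)" by (simp add: \<psi>_def m_def)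
  have "expectation \<psi> = 0"
    unfolding \<psi>_def using i1 by (simp add: m_def prob_space)
  then have "(\<integral>\<^sup>+x. ennreal ((\<psi> x)\<^sup>2) \<partial>law p) \<le> ennreal C * (\<integral>\<^sup>+x. ennreal ((norm (grad \<psi> x))\<^sup>2) \<partial>law p)"
    using poincare i2 \<psi>D GDERIV_imp_differentiable unfolding poincare_constant_def by blast
  also have "(\<integral>\<^sup>+x. ennreal ((norm (grad \<psi> x))\<^sup>2) \<partial>law p) = ennreal (\<integral>x. (norm (D x))\<^sup>2 \<partial>law p)"
    unfolding \<psi>g by (rule nn_integral_eq_integral[OF i(2)]) simp
  also have "(\<integral>\<^sup>+x. ennreal ((\<psi> x)\<^sup>2) \<partial>law p) = ennreal (\<integral>x. (\<psi> x)\<^sup>2 \<partial>law p)"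
    by (rule nn_integral_eq_integral[OF i2]) simp
  also have "ennreal C * ennreal (\<integral>x. (norm (D x))\<^sup>2 \<partial>law p) = ennreal (max C 0 * (\<integral>x. (norm (D x))\<^sup>2 \<partial>law p))"
    by (simp add: ennreal_mult' max_def ennreal_neg)
  finally have "(\<integral>x. (\<psi> x)\<^sup>2 \<partial>law p) \<le> max C 0 * (\<integral>x. (norm (D x))\<^sup>2 \<partial>law p)"
    by (subst (asm) ennreal_le_iff) auto
  then show "(\<integral>x. (\<phi> x - expectation \<phi>)\<^sup>2 \<partial>law p) \<le> max C 0 * (\<integral>x. (norm (D x))\<^sup>2 \<partial>law p)"
    by (simp add: \<psi>_def m_def)
qed

lemma integrable_bounded:
  fixes f :: "'a \<Rightarrow> real"
  assumes "f \<in> borel_measurable borel" "\<And>x. \<bar>f x\<bar> \<le> B"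
  shows "integrable (law p) f"
  by (rule integrable_const_bound[of _ B]) (use assms in auto)

lemma expectation_bounded:
  fixes f :: "'a \<Rightarrow> real"
  assumes "f \<in> borel_measurable borel" "\<And>x. \<bar>f x\<bar> \<le> B"
  shows "\<bar>expectation f\<bar> \<le> B"
proof -
  have "\<bar>expectation f\<bar> \<le> (\<integral>x. \<bar>f x\<bar> \<partial>law p)" by (rule integral_abs_bound)
  also have "\<dots> \<le> (\<integral>x. B \<partial>law p)"
    using assms integrable_bounded[OF assms] by (intro integral_mono) auto
  finally show ?thesis by (simp add: prob_space)
qed

text \<open>The mollification of \<open>h\<close> is differentiable with gradient of norm at most 1,
  and it is within \<open>r\<close> of \<open>h\<close> everywhere; the bound on \<open>h\<close>
  converts this into closeness of the squared deviations.\<close>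

lemma lipschitz_variance:
  assumes h: "lip1 h" and H: "\<And>x. \<bar>h x\<bar> \<le> H"
  shows "(\<integral>x. (h x - expectation h)\<^sup>2 \<partial>law p) \<le> max C 0"
proof (rule field_le_epsilon)
  fix e :: real assume e: "e > 0"
  have H0: "0 \<le> H" using H[of 0] by linarith
  \<comment> \<open>The squares differ by a difference of at most \<open>2 * r\<close> times a sum
    of at most \<open>4 * H\<close>, which gives the factor \<open>8 * H\<close>.\<close>
  define r where "r = e / (8 * H + 1)"
  have r: "r > 0" "r * (8 * H) \<le> e" using e H0 by (auto simp: r_def field_simps)
  have hm: "\<And>x y. \<bar>h x - h y\<bar> \<le> norm (x - y)" using h by blast
  have hc: "continuous_on UNIV h" by (rule lip1_continuous[OF h])
  have li: "locally_integrable h" by (rule continuous_locally_integrable[OF hc])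
  define \<phi> where "\<phi> = mollify r h"
  have \<phi>D: "GDERIV \<phi> x :> mollify_grad r h x" for x
    unfolding \<phi>_def by (rule lipschitz_mollify_GDERIV[OF r(1) hm])
  have g1: "norm (mollify_grad r h x) \<le> 1" for x by (rule mollify_grad_lipschitz_norm[OF r(1) hm])
  have [measurable]: "h \<in> borel_measurable borel" "\<phi> \<in> borel_measurable borel" "mollify_grad r h \<in> borel_measurable borel"
    unfolding \<phi>_def using hc mollify_continuous[OF r(1) li] mollify_grad_continuous[OF r(1) li]
    by (auto intro: borel_measurable_continuous_onI)
  have \<phi>H: "\<bar>\<phi> x\<bar> \<le> H" for x
    using mollify_close[OF r(1) li, of x 0 H] H by (simp add: \<phi>_def)
  have close: "\<bar>\<phi> x - h x\<bar> \<le> r" for x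
    unfolding \<phi>_def by (rule mollify_lipschitz_close[OF r(1) hm])
  have sqb: "\<bar>(f x)\<^sup>2\<bar> \<le> B\<^sup>2" if "\<bar>f x\<bar> \<le> B" for f :: "'a \<Rightarrow> real" and B x
    using that abs_le_square_iff[of "f x" B] by auto
  have gi: "integrable (law p) (\<lambda>x. (norm (mollify_grad r h x))\<^sup>2)"
    using g1 by (intro integrable_bounded[of _ 1]) (auto simp: power_le_one)
  have \<phi>i: "integrable (law p) (\<lambda>x. (\<phi> x)\<^sup>2)"
    by (rule integrable_bounded[of _ "H\<^sup>2"]) (use sqb[OF \<phi>H] in auto)
  note P = poincare_integral[OF \<phi>D _ \<phi>i gi]
  have mm: "\<bar>expectation \<phi> - expectation h\<bar> \<le> r"
  proof -
    have "expectation \<phi> - expectation h = expectation (\<lambda>x. \<phi> x - h x)"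
      by (rule Bochner_Integration.integral_diff[symmetric]; rule integrable_bounded) (use \<phi>H H in auto)
    also have "\<bar>\<dots>\<bar> \<le> r" by (rule expectation_bounded[OF _ close]) measurable
    finally show ?thesis .
  qed
  have hH: "\<bar>expectation h\<bar> \<le> H" "\<bar>expectation \<phi>\<bar> \<le> H"
    by (rule expectation_bounded[OF _ H], measurable) (rule expectation_bounded[OF _ \<phi>H], measurable)
  have pt: "(h x - expectation h)\<^sup>2 \<le> (\<phi> x - expectation \<phi>)\<^sup>2 + r * (8 * H)" for x
  proof -
    define a where "a = h x - expectation h"
    define b where "b = \<phi> x - expectation \<phi>"
    have "\<bar>a - b\<bar> \<le> 2 * r" using mm close[of x] unfolding a_def b_def by linarith
    moreover have "\<bar>a + b\<bar> \<le> 4 * H" using hH H[of x] \<phi>H[of x] unfolding a_def b_def by linarith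
    ultimately have "\<bar>a - b\<bar> * \<bar>a + b\<bar> \<le> (2 * r) * (4 * H)" using r by (intro mult_mono) auto
    moreover have "a\<^sup>2 - b\<^sup>2 = (a - b) * (a + b)" by (simp add: power2_eq_square algebra_simps)
    ultimately have "a\<^sup>2 - b\<^sup>2 \<le> (2 * r) * (4 * H)" using abs_ge_self[of "(a - b) * (a + b)"] by (simp add: abs_mult)
    then show ?thesis by (simp add: a_def b_def)
  qed
  have "(\<integral>x. (h x - expectation h)\<^sup>2 \<partial>law p) \<le> (\<integral>x. (\<phi> x - expectation \<phi>)\<^sup>2 + r * (8 * H) \<partial>law p)"
  proof (rule integral_mono)
    show "integrable (law p) (\<lambda>x. (h x - expectation h)\<^sup>2)"
    proof (rule integrable_bounded[of _ "(2 * H)\<^sup>2"])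
      fix x
      have "\<bar>h x - expectation h\<bar> \<le> 2 * H" using hH H[of x] by linarith
      then show "\<bar>(h x - expectation h)\<^sup>2\<bar> \<le> (2 * H)\<^sup>2" by (rule sqb[of "\<lambda>x. h x - expectation h"])
    qed measurable
  qed (use P(1) pt in auto)
  also have "\<dots> = (\<integral>x. (\<phi> x - expectation \<phi>)\<^sup>2 \<partial>law p) + r * (8 * H)"
    using P(1) by (simp add: prob_space)
  also have "(\<integral>x. (\<phi> x - expectation \<phi>)\<^sup>2 \<partial>law p) \<le> max C 0 * (\<integral>x. (norm (mollify_grad r h x))\<^sup>2 \<partial>law p)"
    by (rule P(2)) measurable
  also have "\<dots> \<le> max C 0 * 1"
  proof (rule mult_left_mono)
    have "(\<integral>x. (norm (mollify_grad r h x))\<^sup>2 \<partial>law p) \<le> (\<integral>x. 1 \<partial>law p)"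
      using gi g1 by (intro integral_mono) (auto simp: power_le_one)
    then show "(\<integral>x. (norm (mollify_grad r h x))\<^sup>2 \<partial>law p) \<le> 1" by (simp add: prob_space)
  qed simp
  finally show "(\<integral>x. (h x - expectation h)\<^sup>2 \<partial>law p) \<le> max C 0 + e" using r by simp
qed

text \<open>The variances of \<open>min (norm x) n\<close> are at most \<open>C\<close>, and since half of the mass lies in some ball, this
  bounds the means.\<close>

lemma integrable_law_norm: "integrable (law p) norm"
proof -
  define h where "h n x = min (norm x) (real n)" for n and x :: 'a
  have lip: "lip1 (h n)" for n
  proof (intro allI)
    fix x y :: 'a
    show "\<bar>h n x - h n y\<bar> \<le> norm (x - y)"
      using norm_triangle_ineq3[of x y] unfolding h_def by linarith
  qed
  have bn: "\<bar>h n x\<bar> \<le> real n" for x n by (simp add: h_def)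
  have [measurable]: "h n \<in> borel_measurable borel" for n unfolding h_def by measurable
  have hi: "integrable (law p) (h n)" for n by (rule integrable_bounded[OF _ bn]) simp
  have "(\<lambda>n. prob (cball 0 (real n))) \<longlonglongrightarrow> prob (\<Union>n. cball 0 (real n))"
    by (rule finite_Lim_measure_incseq) (auto simp: incseq_def sets_law)
  moreover have "(\<Union>n. cball (0::'a) (real n)) = UNIV"
    using real_arch_simple by auto
  ultimately have "(\<lambda>n. prob (cball 0 (real n))) \<longlonglongrightarrow> 1"
    using prob_space by simp
  then have "\<forall>\<^sub>F n in sequentially. 1/2 < prob (cball 0 (real n))"
    by (rule order_tendstoD) simp
  then obtain R :: nat where R: "1/2 < prob (cball 0 (real R))"
    by (auto simp: eventually_sequentially)
  define m where "m n = expectation (h n)" for n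
  have bound: "m n \<le> real R + sqrt (2 * max C 0)" for n
  proof (cases "m n \<le> real R")
    case False
    have i2: "integrable (law p) (\<lambda>x. (h n x - m n)\<^sup>2)"
    proof (rule integrable_bounded[of _ "(real n + \<bar>m n\<bar>)\<^sup>2"])
      fix x
      have "\<bar>h n x - m n\<bar> \<le> real n + \<bar>m n\<bar>" using bn[of n x] by linarith
      then show "\<bar>(h n x - m n)\<^sup>2\<bar> \<le> (real n + \<bar>m n\<bar>)\<^sup>2" by (simp add: power2_le_iff_abs_le)
    qed measurable
    \<comment> \<open>A Chebyshev argument: on the ball, which carries more than half of the mass,
      \<open>h n\<close> is at most \<open>R\<close> and so deviates from its mean by at least
      \<open>m n - R\<close>.\<close>
    have "(m n - R)\<^sup>2 * (1/2) \<le> (m n - R)\<^sup>2 * prob (cball 0 (real R))"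
      using R by (intro mult_left_mono) auto
    also have "\<dots> = (\<integral>x. (m n - R)\<^sup>2 * indicator (cball 0 (real R)) x \<partial>law p)"
      by (simp add: sets_law)
    also have "\<dots> \<le> (\<integral>x. (h n x - m n)\<^sup>2 \<partial>law p)"
    proof (rule integral_mono[OF _ i2])
      show "integrable (law p) (\<lambda>x. (m n - R)\<^sup>2 * indicator (cball 0 (real R)) x)"
        by (intro integrable_mult_right integrable_bounded[of _ 1]) (auto simp: indicator_def)
      fix x
      show "(m n - R)\<^sup>2 * indicator (cball 0 (real R)) x \<le> (h n x - m n)\<^sup>2"
      proof (cases "x \<in> cball 0 (real R)")
        case True
        then have "h n x \<le> real R" by (simp add: h_def)
        then have "\<bar>m n - R\<bar> \<le> \<bar>h n x - m n\<bar>" using False by linarith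
        then show ?thesis using True by (simp add: abs_le_square_iff)
      qed simp
    qed
    also have "\<dots> \<le> max C 0" unfolding m_def by (rule lipschitz_variance[OF lip bn])
    finally have "(m n - R)\<^sup>2 \<le> 2 * max C 0" by simp
    then have "m n - R \<le> sqrt (2 * max C 0)" by (rule real_le_rsqrt)
    then show ?thesis by simp
  qed (simp add: add_increasing2)
  have inc: "incseq m"
    unfolding m_def using hi by (intro monoI integral_mono) (auto simp: h_def)
  obtain L where L: "m \<longlonglongrightarrow> L" using incseq_convergent[OF inc] bound by blast
  show ?thesis
  proof (rule integrable_monotone_convergence)
    show "integrable (law p) (h n)" for n by (rule hi)
    show "AE x in law p. mono (\<lambda>n. h n x)" by (auto simp: mono_def h_def)
    show "AE x in law p. (\<lambda>n. h n x) \<longlonglongrightarrow> norm x"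
    proof (intro AE_I2 tendsto_eventually)
      fix x
      show "\<forall>\<^sub>F n in sequentially. h n x = norm x"
        using eventually_ge_at_top[of "nat \<lceil>norm x\<rceil>"] unfolding h_def by eventually_elim (simp add: min_def; linarith)
    qed
    show "(\<lambda>n. expectation (h n)) \<longlonglongrightarrow> L" using L by (simp add: m_def[abs_def])
  qed measurable
qed

end

section \<open>Lower bounds and null sets for the positivity set \<open>Omega p\<close>\<close>

lemma open_Omega: "open (Omega p)"
  by (auto simp: Omega_def)

lemma Omega_pos: "x \<in> Omega p \<Longrightarrow> 0 < p x"
  by (auto simp: Omega_def)

lemma Omega_continuous: "continuous_on (Omega p) p"
proof -
  have "isCont p x" if "x \<in> Omega p" for x
    using that unfolding Omega_def Ck_on_1_iff
    by (auto dest!: bspec differentiable_imp_continuous_within)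
  then show ?thesis by (simp add: continuous_at_imp_continuous_on)
qed

lemma Omega_compact_lower_bound:
  assumes "compact K" "K \<subseteq> Omega p"
  obtains \<delta> where "\<delta> > 0" "\<And>x. x \<in> K \<Longrightarrow> \<delta> \<le> p x"
proof (cases "K = {}")
  case True then show ?thesis using that[of 1] by simp
next
  case False
  obtain x where "x \<in> K" "\<forall>y\<in>K. p x \<le> p y"
    using continuous_attains_inf[OF assms(1) False continuous_on_subset[OF Omega_continuous assms(2)]] by blast
  then show ?thesis using that[of "p x"] Omega_pos assms(2) by blast
qed

lemma admissible_density_AE_Omega:
  assumes "admissible_density p"
  shows "AE x in lborel. x \<notin> Omega p \<longrightarrow> p x = 0"
proof -
  obtain \<Omega> where \<Omega>: "open \<Omega>" "density_support p - \<Omega> \<in> null_sets lborel" "\<forall>x\<in>\<Omega>. 0 < p x" "Ck_on 1 \<Omega> p"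
    using assms unfolding admissible_density_def by blast
  have "\<Omega> \<subseteq> Omega p" using \<Omega> unfolding Omega_def by blast
  moreover have "p x = 0" if "x \<notin> density_support p" for x
    using that by (auto simp: density_support_def)
  moreover have "AE x in lborel. x \<notin> density_support p - \<Omega>" by (rule AE_not_in[OF \<Omega>(2)])
  ultimately show ?thesis by (auto elim!: eventually_mono)
qed

context poincare_density
begin

text \<open>Where \<open>p\<close> is at least \<delta>, a Lebesgue integral costs at most
  \<open>1 / \<delta>\<close> times the integral under \<open>law p\<close>. This turns convergence
  in L2 of \<open>law p\<close> into convergence of integrals against test functions.\<close>

lemma dominated_on_compact:
  fixes u :: "'a \<Rightarrow> 'b::euclidean_space" and q :: "'a \<Rightarrow> 'c::euclidean_space"
  assumes u: "integrable (law p) u" and [measurable]: "u \<in> borel_measurable borel"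
    and q: "q \<in> borel_measurable borel" "\<And>x. norm (q x) \<le> B * norm (u x)" "\<And>x. x \<notin> K \<Longrightarrow> q x = 0"
    and \<delta>: "\<delta> > 0" "\<And>x. x \<in> K \<Longrightarrow> \<delta> \<le> p x"
  shows "integrable lborel q" "norm (LBINT x. q x) \<le> \<bar>B\<bar> / \<delta> * (\<integral>x. norm (u x) \<partial>law p)"
proof -
  have i: "integrable lborel (\<lambda>x. p x * norm (u x))"
    using integrable_norm[OF u] by (subst (asm) integrable_law) auto
  have le: "norm (q x) \<le> \<bar>B\<bar> / \<delta> * (p x * norm (u x))" for x
  proof (cases "x \<in> K")
    case True
    have "norm (q x) \<le> \<bar>B\<bar> * norm (u x)"
      by (rule order_trans[OF q(2)]) (intro mult_right_mono, auto)
    also have "\<dots> \<le> \<bar>B\<bar> * (p x / \<delta> * norm (u x))"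
    proof -
      have "1 \<le> p x / \<delta>" using \<delta>(1) \<delta>(2)[OF True] by simp
      from mult_right_mono[OF this, of "norm (u x)"] show ?thesis by (intro mult_left_mono) auto
    qed
    finally show ?thesis by simp
  qed (use q(3) p_nonneg \<delta> in auto)
  show qi: "integrable lborel q"
  proof (rule Bochner_Integration.integrable_bound)
    show "integrable lborel (\<lambda>x. \<bar>B\<bar> / \<delta> * (p x * norm (u x)))" using i by simp
    show "AE x in lborel. norm (q x) \<le> norm (\<bar>B\<bar> / \<delta> * (p x * norm (u x)))"
      using order_trans[OF le abs_ge_self] by (intro AE_I2) (simp only: real_norm_def)
  qed (use q in simp)
  have "norm (LBINT x. q x) \<le> (LBINT x. norm (q x))" by (rule integral_norm_bound)
  also have "\<dots> \<le> (LBINT x. \<bar>B\<bar> / \<delta> * (p x * norm (u x)))"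
    using qi i le by (intro integral_mono) auto
  also have "\<dots> = \<bar>B\<bar> / \<delta> * (LBINT x. p x * norm (u x))" by (rule integral_mult_right_zero)
  also have "(LBINT x. p x * norm (u x)) = (\<integral>x. norm (u x) \<partial>law p)"
    by (subst integral_law) auto
  finally show "norm (LBINT x. q x) \<le> \<bar>B\<bar> / \<delta> * (\<integral>x. norm (u x) \<partial>law p)" .
qed

lemma expectation_norm_le_L2:
  fixes u :: "'a \<Rightarrow> 'b::euclidean_space"
  assumes [measurable]: "u \<in> borel_measurable borel" and i: "integrable (law p) (\<lambda>x. (norm (u x))\<^sup>2)"
  shows "integrable (law p) u" "(\<integral>x. norm (u x) \<partial>law p) \<le> sqrt (\<integral>x. (norm (u x))\<^sup>2 \<partial>law p)"
proof -
  have "integrable (law p) (\<lambda>x. norm (u x))"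
    by (rule square_integrable_imp_integrable[OF _ i]) measurable
  then show "integrable (law p) u" by (simp add: integrable_norm_iff)
  show "(\<integral>x. norm (u x) \<partial>law p) \<le> sqrt (\<integral>x. (norm (u x))\<^sup>2 \<partial>law p)"
    using integral_Cauchy_Schwarz[of "\<lambda>x. norm (u x)" "law p" "\<lambda>_. 1"] i by simp
qed

end

text \<open>Membership in \<open>W12\<close> with its witnesses fixed. \<open>g\<close> is the
  gradient component of the completion, at this stage only an L2 limit and not yet related to a weak
  gradient of \<open>f\<close>.\<close>

locale W12_approximation = poincare_density p C for p :: "'a::euclidean_space \<Rightarrow> real" and C +
  fixes f :: "'a \<Rightarrow> real" and g :: "'a \<Rightarrow> 'a" and \<phi> :: "nat \<Rightarrow> 'a \<Rightarrow> real"
  assumes f_measurable [measurable]: "f \<in> borel_measurable borel"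
    and g_measurable [measurable]: "g \<in> borel_measurable borel"
    and \<phi>: "\<And>n. \<phi> n \<in> test_functions UNIV"
    and nn_f: "(\<lambda>n. \<integral>\<^sup>+x. ennreal ((\<phi> n x - f x)\<^sup>2) \<partial>law p) \<longlonglongrightarrow> 0"
    and nn_g: "(\<lambda>n. \<integral>\<^sup>+x. ennreal ((norm (grad (\<phi> n) x - g x))\<^sup>2) \<partial>law p) \<longlonglongrightarrow> 0"
begin

lemma \<phi>_measurable [measurable]: "\<phi> n \<in> borel_measurable borel" "grad (\<phi> n) \<in> borel_measurable borel"
  by (rule borel_measurable_continuous_onI[OF test_functions_continuous[OF \<phi>]]
     borel_measurable_continuous_onI[OF test_functions_grad_continuous[OF \<phi>]])+

lemma \<phi>_square_integrable:
  "integrable (law p) (\<lambda>x. (\<phi> n x)\<^sup>2)" "integrable (law p) (\<lambda>x. (norm (grad (\<phi> n) x))\<^sup>2)"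
proof -
  obtain R where R: "\<And>x. x \<notin> cball 0 R \<Longrightarrow> \<phi> n x = 0" "\<And>x. x \<notin> cball 0 R \<Longrightarrow> grad (\<phi> n) x = 0"
    by (rule test_functions_vanish[OF \<phi>]) (rule that)
  obtain B where B: "\<And>x. norm (\<phi> n x) \<le> B"
    using continuous_vanishing_bounded[OF test_functions_continuous[OF \<phi>] R(1)] by blast
  obtain B' where B': "\<And>x. norm (grad (\<phi> n) x) \<le> B'"
    using continuous_vanishing_bounded[OF test_functions_grad_continuous[OF \<phi>] R(2)] by blast
  show "integrable (law p) (\<lambda>x. (\<phi> n x)\<^sup>2)"
    using B by (intro integrable_bounded[of _ "B\<^sup>2"]) (auto simp: abs_le_square_iff[symmetric] intro: order_trans[OF _ abs_ge_self])
  show "integrable (law p) (\<lambda>x. (norm (grad (\<phi> n) x))\<^sup>2)"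
    using B' by (intro integrable_bounded[of _ "B'\<^sup>2"]) (auto intro: power_mono)
qed

text \<open>The difference \<open>d n\<close> is described by two triangle inequalities only, so
  that it may be \<open>\<phi> n - f\<close> as well as the norm of a difference of gradients. One
  index with distance below 1 already yields square integrability of the limit.\<close>

lemma square_integrable_from_limit:
  assumes [measurable]: "\<And>n. v n \<in> borel_measurable borel" "w \<in> borel_measurable borel" "\<And>n. d n \<in> borel_measurable borel"
    and i: "\<And>n. integrable (law p) (\<lambda>x. (v n x)\<^sup>2)"
    and lim: "(\<lambda>n. \<integral>\<^sup>+x. ennreal ((d n x)\<^sup>2) \<partial>law p) \<longlonglongrightarrow> 0"
    and le: "\<And>n x. \<bar>w x\<bar> \<le> \<bar>v n x\<bar> + \<bar>d n x\<bar>" "\<And>n x. \<bar>d n x\<bar> \<le> \<bar>v n x\<bar> + \<bar>w x\<bar>"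
  shows "integrable (law p) (\<lambda>x. (w x)\<^sup>2)" "\<And>n. integrable (law p) (\<lambda>x. (d n x)\<^sup>2)"
    "(\<lambda>n. sqrt (\<integral>x. (d n x)\<^sup>2 \<partial>law p)) \<longlonglongrightarrow> 0"
proof -
  have "\<forall>\<^sub>F n in sequentially. (\<integral>\<^sup>+x. ennreal ((d n x)\<^sup>2) \<partial>law p) < 1"
    using lim by (rule order_tendstoD) simp
  then obtain n where n: "(\<integral>\<^sup>+x. ennreal ((d n x)\<^sup>2) \<partial>law p) < 1"
    by (auto simp: eventually_sequentially)
  have "integrable (law p) (\<lambda>x. (d n x)\<^sup>2)"
    using order_less_trans[OF n ennreal_one_less_top] by (intro integrableI_nonneg) auto
  from sqrt_integral_square_triangle(1)[OF _ _ _ i[of n] this, of w] le(1)[of _ n]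
  show w: "integrable (law p) (\<lambda>x. (w x)\<^sup>2)" by simp
  show di: "integrable (law p) (\<lambda>x. (d n x)\<^sup>2)" for n
    using sqrt_integral_square_triangle(1)[OF _ _ _ i[of n] w, of "d n"] le(2)[of n] by simp
  have "(\<lambda>n. ennreal (\<integral>x. (d n x)\<^sup>2 \<partial>law p)) \<longlonglongrightarrow> 0"
    using lim nn_integral_eq_integral[OF di] by simp
  then have "(\<lambda>n. \<integral>x. (d n x)\<^sup>2 \<partial>law p) \<longlonglongrightarrow> 0"
    by (subst (asm) ennreal_tendsto_0_iff) auto
  from tendsto_real_sqrt[OF this] show "(\<lambda>n. sqrt (\<integral>x. (d n x)\<^sup>2 \<partial>law p)) \<longlonglongrightarrow> 0" by simp
qed

lemma
  shows f_square_integrable: "integrable (law p) (\<lambda>x. (f x)\<^sup>2)"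
    and \<phi>_f_square_integrable: "\<And>n. integrable (law p) (\<lambda>x. (\<phi> n x - f x)\<^sup>2)"
    and \<phi>_f_limit: "(\<lambda>n. sqrt (\<integral>x. (\<phi> n x - f x)\<^sup>2 \<partial>law p)) \<longlonglongrightarrow> 0"
proof -
  have 1: "\<bar>f x\<bar> \<le> \<bar>\<phi> n x\<bar> + \<bar>\<phi> n x - f x\<bar>" for n x by linarith
  have 2: "\<bar>\<phi> n x - f x\<bar> \<le> \<bar>\<phi> n x\<bar> + \<bar>f x\<bar>" for n x by linarith
  note L = square_integrable_from_limit[OF _ _ _ \<phi>_square_integrable(1) nn_f 1 2]
  show "integrable (law p) (\<lambda>x. (f x)\<^sup>2)" by (rule L(1)) measurable
  show "integrable (law p) (\<lambda>x. (\<phi> n x - f x)\<^sup>2)" for n by (rule L(2)) measurable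
  show "(\<lambda>n. sqrt (\<integral>x. (\<phi> n x - f x)\<^sup>2 \<partial>law p)) \<longlonglongrightarrow> 0" by (rule L(3)) measurable
qed

lemma
  shows g_square_integrable: "integrable (law p) (\<lambda>x. (norm (g x))\<^sup>2)"
    and grad_\<phi>_g_square_integrable: "\<And>n. integrable (law p) (\<lambda>x. (norm (grad (\<phi> n) x - g x))\<^sup>2)"
    and grad_\<phi>_g_limit: "(\<lambda>n. sqrt (\<integral>x. (norm (grad (\<phi> n) x - g x))\<^sup>2 \<partial>law p)) \<longlonglongrightarrow> 0"
proof -
  have 1: "\<bar>norm (g x)\<bar> \<le> \<bar>norm (grad (\<phi> n) x)\<bar> + \<bar>norm (grad (\<phi> n) x - g x)\<bar>" for n x
    using norm_triangle_ineq4[of "grad (\<phi> n) x" "grad (\<phi> n) x - g x"] by simp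
  have 2: "\<bar>norm (grad (\<phi> n) x - g x)\<bar> \<le> \<bar>norm (grad (\<phi> n) x)\<bar> + \<bar>norm (g x)\<bar>" for n x
    using norm_triangle_ineq4[of "grad (\<phi> n) x" "g x"] by simp
  note L = square_integrable_from_limit[OF _ _ _ \<phi>_square_integrable(2) nn_g 1 2]
  show "integrable (law p) (\<lambda>x. (norm (g x))\<^sup>2)" by (rule L(1)) measurable
  show "integrable (law p) (\<lambda>x. (norm (grad (\<phi> n) x - g x))\<^sup>2)" for n by (rule L(2)) measurable
  show "(\<lambda>n. sqrt (\<integral>x. (norm (grad (\<phi> n) x - g x))\<^sup>2 \<partial>law p)) \<longlonglongrightarrow> 0" by (rule L(3)) measurable
qed

lemma f_integrable: "integrable (law p) f"
  by (rule square_integrable_imp_integrable[OF _ f_square_integrable]) measurable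

lemma lipschitz_covariance_bound:
  assumes h: "lip1 h" and H: "\<And>x. \<bar>h x\<bar> \<le> H" and f1: "expectation f = 1"
  shows "expectation (\<lambda>x. h x * f x) - expectation h \<le> max C 0 * sqrt (\<integral>x. (norm (g x))\<^sup>2 \<partial>law p)"
proof -
  define K where "K = max C 0"
  have K: "0 \<le> K" by (simp add: K_def)
  have [measurable]: "h \<in> borel_measurable borel"
    by (rule borel_measurable_continuous_onI[OF lip1_continuous[OF h]])
  have hi: "integrable (law p) h" by (rule integrable_bounded[OF _ H]) measurable
  define a where "a x = h x - expectation h" for x
  have [measurable]: "a \<in> borel_measurable borel" unfolding a_def by measurable
  have a0: "expectation a = 0" unfolding a_def using hi by simp
  have ai: "integrable (law p) a" unfolding a_def using hi by simp
  have aH: "\<bar>a x\<bar> \<le> H + \<bar>expectation h\<bar>" for x using H[of x] unfolding a_def by linarith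
  have a2i: "integrable (law p) (\<lambda>x. (a x)\<^sup>2)"
  proof (rule integrable_bounded)
    show "\<bar>(a x)\<^sup>2\<bar> \<le> (H + \<bar>expectation h\<bar>)\<^sup>2" for x
      using aH[of x] by (simp add: power2_le_iff_abs_le)
  qed measurable
  have a2: "(\<integral>x. (a x)\<^sup>2 \<partial>law p) \<le> K"
    unfolding a_def K_def by (rule lipschitz_variance[OF h H])
  define N where "N = sqrt (\<integral>x. (norm (g x))\<^sup>2 \<partial>law p)"
  have bound: "expectation (\<lambda>x. a x * f x) \<le> sqrt K * sqrt (\<integral>x. (\<phi> n x - f x)\<^sup>2 \<partial>law p)
     + K * (N + sqrt (\<integral>x. (norm (grad (\<phi> n) x - g x))\<^sup>2 \<partial>law p))" for n
  proof -
    define m where "m = expectation (\<phi> n)"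
    have CS: "expectation (\<lambda>x. a x * u x) \<le> sqrt K * sqrt (\<integral>x. (u x)\<^sup>2 \<partial>law p)"
      if [measurable]: "u \<in> borel_measurable borel" and ui: "integrable (law p) (\<lambda>x. (u x)\<^sup>2)" for u
    proof -
      have au: "integrable (law p) (\<lambda>x. a x * u x)"
        by (rule integrable_mult_square_integrable[OF _ _ a2i ui]) measurable
      have "expectation (\<lambda>x. a x * u x) \<le> expectation (\<lambda>x. \<bar>a x\<bar> * \<bar>u x\<bar>)"
        unfolding abs_mult[symmetric] using au by (intro integral_mono) auto
      also have "\<dots> \<le> sqrt (\<integral>x. (a x)\<^sup>2 \<partial>law p) * sqrt (\<integral>x. (u x)\<^sup>2 \<partial>law p)"
        by (rule integral_Cauchy_Schwarz[OF _ _ a2i ui]) measurable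
      also have "\<dots> \<le> sqrt K * sqrt (\<integral>x. (u x)\<^sup>2 \<partial>law p)"
        using a2 by (intro mult_right_mono real_sqrt_le_mono) auto
      finally show ?thesis .
    qed
    note P = poincare_integral[OF test_functions_GDERIV[OF \<phi>] \<phi>_measurable(2) \<phi>_square_integrable]
    have d2: "integrable (law p) (\<lambda>x. (f x - \<phi> n x)\<^sup>2)"
      using \<phi>_f_square_integrable[of n] by (simp add: power2_commute)
    have i1: "integrable (law p) (\<lambda>x. a x * (f x - \<phi> n x))"
      by (rule integrable_mult_square_integrable[OF _ _ a2i d2]) measurable
    have i2: "integrable (law p) (\<lambda>x. a x * (\<phi> n x - m))"
      unfolding m_def by (rule integrable_mult_square_integrable[OF _ _ a2i P(1)]) measurable
    \<comment> \<open>The first term is an approximation error that tends to 0, the second is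
      accessible to the Poincare inequality, and the third vanishes because \<open>a\<close> has
      mean zero.\<close>
    have "expectation (\<lambda>x. a x * f x) = expectation (\<lambda>x. a x * (f x - \<phi> n x) + a x * (\<phi> n x - m) + m * a x)"
      by (rule Bochner_Integration.integral_cong) (auto simp: algebra_simps)
    also have "\<dots> = expectation (\<lambda>x. a x * (f x - \<phi> n x)) + expectation (\<lambda>x. a x * (\<phi> n x - m))"
      using i1 i2 ai a0 by simp
    also have "expectation (\<lambda>x. a x * (f x - \<phi> n x)) \<le> sqrt K * sqrt (\<integral>x. (\<phi> n x - f x)\<^sup>2 \<partial>law p)"
      using CS[OF _ d2] by (simp add: power2_commute[of "f _"])
    also have "expectation (\<lambda>x. a x * (\<phi> n x - m)) \<le> K * (N + sqrt (\<integral>x. (norm (grad (\<phi> n) x - g x))\<^sup>2 \<partial>law p))"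
    proof -
      have "expectation (\<lambda>x. a x * (\<phi> n x - m)) \<le> sqrt K * sqrt (\<integral>x. (\<phi> n x - m)\<^sup>2 \<partial>law p)"
        unfolding m_def by (rule CS[OF _ P(1)]) measurable
      also have "\<dots> \<le> sqrt K * sqrt (K * (\<integral>x. (norm (grad (\<phi> n) x))\<^sup>2 \<partial>law p))"
        using P(2) K by (intro mult_left_mono real_sqrt_le_mono) (auto simp: m_def K_def)
      also have "\<dots> = K * sqrt (\<integral>x. (norm (grad (\<phi> n) x))\<^sup>2 \<partial>law p)"
        using K by (simp add: real_sqrt_mult)
      also have "\<dots> \<le> K * (N + sqrt (\<integral>x. (norm (grad (\<phi> n) x - g x))\<^sup>2 \<partial>law p))"
      proof (rule mult_left_mono[OF _ K])
        have le: "\<bar>norm (grad (\<phi> n) x)\<bar> \<le> \<bar>norm (g x)\<bar> + \<bar>norm (grad (\<phi> n) x - g x)\<bar>" for x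
          using norm_triangle_ineq[of "g x" "grad (\<phi> n) x - g x"] by simp
        show "sqrt (\<integral>x. (norm (grad (\<phi> n) x))\<^sup>2 \<partial>law p) \<le> N + sqrt (\<integral>x. (norm (grad (\<phi> n) x - g x))\<^sup>2 \<partial>law p)"
          unfolding N_def
          by (rule sqrt_integral_square_triangle(2)[OF _ _ _ g_square_integrable grad_\<phi>_g_square_integrable le]) measurable
      qed
      finally show ?thesis .
    qed
    finally show ?thesis by simp
  qed
  have "(\<lambda>n. sqrt K * sqrt (\<integral>x. (\<phi> n x - f x)\<^sup>2 \<partial>law p)
     + K * (N + sqrt (\<integral>x. (norm (grad (\<phi> n) x - g x))\<^sup>2 \<partial>law p))) \<longlonglongrightarrow> sqrt K * 0 + K * (N + 0)"
    by (intro tendsto_intros \<phi>_f_limit grad_\<phi>_g_limit)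
  then have "expectation (\<lambda>x. a x * f x) \<le> sqrt K * 0 + K * (N + 0)"
    by (rule tendsto_lowerbound) (use bound in auto)
  moreover have "expectation (\<lambda>x. a x * f x) = expectation (\<lambda>x. h x * f x) - expectation h"
  proof -
    have h2: "integrable (law p) (\<lambda>x. (h x)\<^sup>2)"
    proof (rule integrable_bounded)
      show "\<bar>(h x)\<^sup>2\<bar> \<le> H\<^sup>2" for x
        using H[of x] order_trans[OF abs_ge_zero H[of x]] by (simp add: power2_le_iff_abs_le)
    qed measurable
    have "integrable (law p) (\<lambda>x. h x * f x)"
      by (rule integrable_mult_square_integrable[OF _ _ h2 f_square_integrable]) measurable
    then show ?thesis
      unfolding a_def using f_integrable f1 by (simp add: left_diff_distrib)
  qed
  ultimately show ?thesis by (simp add: K_def N_def)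
qed

text \<open>The bound is obtained with \<open>g\<close>, whereas the claim concerns
  \<open>G\<close>. On the support of a test function in \<open>Omega p\<close> the density is
  bounded below, so integration by parts for \<open>\<phi> n\<close> passes to the limit;
  \<open>g\<close> and \<open>G\<close> then have the same integrals against all such test
  functions.\<close>

lemma weak_gradient_unique:
  assumes wg: "has_weak_gradient_on f G (Omega p)"
  shows "AE x in lborel. x \<in> Omega p \<longrightarrow> G x = g x"
proof -
  have gi: "integrable (law p) g" by (rule expectation_norm_le_L2(1)[OF _ g_square_integrable]) measurable
  have gK: "set_integrable lborel K g" if K: "compact K" "K \<subseteq> Omega p" for K
  proof -
    obtain \<delta> where \<delta>: "\<delta> > 0" "\<And>x. x \<in> K \<Longrightarrow> \<delta> \<le> p x"
      by (rule Omega_compact_lower_bound[OF K]) (rule that)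
    have [measurable]: "K \<in> sets borel" using K(1) by (rule borel_compact)
    show ?thesis
      unfolding set_integrable_def
      by (rule dominated_on_compact(1)[OF gi _ _ _ _ \<delta>, of _ 1]) (auto simp: indicator_def)
  qed
  have GK: "set_integrable lborel K G" if "compact K" "K \<subseteq> Omega p" for K
    using wg that by (auto simp: has_weak_gradient_on_def)
  have "AE x in lborel. x \<in> Omega p \<longrightarrow> G x - g x = 0"
  proof (rule AE_zero_if_test_integrals_zero[OF open_Omega])
    show "set_integrable lborel K (\<lambda>x. G x - g x)" if "compact K" "K \<subseteq> Omega p" for K
      using gK[OF that] GK[OF that] by (rule set_integral_diff(1)[rotated])
    fix \<psi> assume \<psi>: "\<psi> \<in> test_functions (Omega p)"
    define K where "K = closure {x. \<psi> x \<noteq> 0}"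
    have K: "compact K" "K \<subseteq> Omega p" using \<psi> by (auto simp: test_functions_def K_def)
    have \<psi>0: "\<psi> x = 0" "grad \<psi> x = 0" if "x \<notin> K" for x
      using that grad_eq_0_outside_support[of x \<psi>] closure_subset[of "{x. \<psi> x \<noteq> 0}"] by (auto simp: K_def)
    obtain R where R: "\<And>x. x \<notin> cball 0 R \<Longrightarrow> \<psi> x = 0" "\<And>x. x \<notin> cball 0 R \<Longrightarrow> grad \<psi> x = 0"
      by (rule test_functions_vanish[OF \<psi>]) (rule that)
    obtain B where B: "\<And>x. norm (\<psi> x) \<le> B"
      using continuous_vanishing_bounded[OF test_functions_continuous[OF \<psi>] R(1)] by blast
    obtain B' where B': "\<And>x. norm (grad \<psi> x) \<le> B'"
      using continuous_vanishing_bounded[OF test_functions_grad_continuous[OF \<psi>] R(2)] by blast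
    have [measurable]: "\<psi> \<in> borel_measurable borel" "grad \<psi> \<in> borel_measurable borel"
      by (rule borel_measurable_continuous_onI[OF test_functions_continuous[OF \<psi>]]
          borel_measurable_continuous_onI[OF test_functions_grad_continuous[OF \<psi>]])+
    obtain \<delta> where \<delta>: "\<delta> > 0" "\<And>x. x \<in> K \<Longrightarrow> \<delta> \<le> p x"
      by (rule Omega_compact_lower_bound[OF K]) (rule that)
    have scal: "integrable lborel (\<lambda>x. u x *\<^sub>R grad \<psi> x)"
      "norm (LBINT x. u x *\<^sub>R grad \<psi> x) \<le> \<bar>B'\<bar> / \<delta> * (\<integral>x. norm (u x) \<partial>law p)"
      if [measurable]: "u \<in> borel_measurable borel" and "integrable (law p) u" for u :: "'a \<Rightarrow> real"
    proof -
      have 1: "norm (u x *\<^sub>R grad \<psi> x) \<le> B' * norm (u x)" for x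
        using mult_left_mono[OF B'[of x], of "\<bar>u x\<bar>"] by (simp add: mult.commute)
      have 2: "u x *\<^sub>R grad \<psi> x = 0" if "x \<notin> K" for x using \<psi>0[OF that] by simp
      have 3: "(\<lambda>x. u x *\<^sub>R grad \<psi> x) \<in> borel_measurable borel" by measurable
      show "integrable lborel (\<lambda>x. u x *\<^sub>R grad \<psi> x)"
        by (rule dominated_on_compact(1)[OF that(2,1) 3 1 2 \<delta>])
      show "norm (LBINT x. u x *\<^sub>R grad \<psi> x) \<le> \<bar>B'\<bar> / \<delta> * (\<integral>x. norm (u x) \<partial>law p)"
        by (rule dominated_on_compact(2)[OF that(2,1) 3 1 2 \<delta>])
    qed
    have vec: "integrable lborel (\<lambda>x. \<psi> x *\<^sub>R u x)"
      "norm (LBINT x. \<psi> x *\<^sub>R u x) \<le> \<bar>B\<bar> / \<delta> * (\<integral>x. norm (u x) \<partial>law p)"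
      if [measurable]: "u \<in> borel_measurable borel" and "integrable (law p) u" for u :: "'a \<Rightarrow> 'a"
    proof -
      have 1: "norm (\<psi> x *\<^sub>R u x) \<le> B * norm (u x)" for x
        using mult_right_mono[OF B[of x], of "norm (u x)"] by simp
      have 2: "\<psi> x *\<^sub>R u x = 0" if "x \<notin> K" for x using \<psi>0[OF that] by simp
      have 3: "(\<lambda>x. \<psi> x *\<^sub>R u x) \<in> borel_measurable borel" by measurable
      show "integrable lborel (\<lambda>x. \<psi> x *\<^sub>R u x)"
        by (rule dominated_on_compact(1)[OF that(2,1) 3 1 2 \<delta>])
      show "norm (LBINT x. \<psi> x *\<^sub>R u x) \<le> \<bar>B\<bar> / \<delta> * (\<integral>x. norm (u x) \<partial>law p)"
        by (rule dominated_on_compact(2)[OF that(2,1) 3 1 2 \<delta>])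
    qed
    define E where "E n = sqrt (\<integral>x. (\<phi> n x - f x)\<^sup>2 \<partial>law p)" for n
    define \<Delta> where "\<Delta> n = sqrt (\<integral>x. (norm (grad (\<phi> n) x - g x))\<^sup>2 \<partial>law p)" for n
    \<comment> \<open>Integration by parts is exact for \<open>\<phi> n\<close>. Replacing it by
      \<open>f\<close> and its gradient by \<open>g\<close> costs L1 distances under
      \<open>law p\<close>, which are at most the L2 distances since \<open>law p\<close> has mass
      1.\<close>
    have "norm ((LBINT x. f x *\<^sub>R grad \<psi> x) + (LBINT x. \<psi> x *\<^sub>R g x)) \<le> \<bar>B'\<bar> / \<delta> * E n + \<bar>B\<bar> / \<delta> * \<Delta> n" for n
    proof -
      have m1: "(\<lambda>x. \<phi> n x - f x) \<in> borel_measurable borel" by measurable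
      have m2: "(\<lambda>x. grad (\<phi> n) x - g x) \<in> borel_measurable borel" by measurable
      have s1: "integrable (law p) (\<lambda>x. (norm (\<phi> n x - f x))\<^sup>2)" using \<phi>_f_square_integrable[of n] by simp
      note d1 = expectation_norm_le_L2[OF m1 s1]
      note d2 = expectation_norm_le_L2[OF m2 grad_\<phi>_g_square_integrable]
      have \<phi>i: "integrable (law p) (\<phi> n)" "integrable (law p) (grad (\<phi> n))"
        using Bochner_Integration.integrable_add[OF d1(1) f_integrable] Bochner_Integration.integrable_add[OF d2(1) gi] by simp_all
      have "(LBINT x. (\<phi> n x - f x) *\<^sub>R grad \<psi> x) = (LBINT x. \<phi> n x *\<^sub>R grad \<psi> x) - (LBINT x. f x *\<^sub>R grad \<psi> x)"
        unfolding scaleR_diff_left by (rule Bochner_Integration.integral_diff) (rule scal(1)[OF _ \<phi>i(1)] scal(1)[OF _ f_integrable], measurable)+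
      moreover have "(LBINT x. \<psi> x *\<^sub>R (grad (\<phi> n) x - g x)) = (LBINT x. \<psi> x *\<^sub>R grad (\<phi> n) x) - (LBINT x. \<psi> x *\<^sub>R g x)"
        unfolding scaleR_diff_right by (rule Bochner_Integration.integral_diff) (rule vec(1)[OF _ \<phi>i(2)] vec(1)[OF _ gi], measurable)+
      moreover have "(LBINT x. \<phi> n x *\<^sub>R grad \<psi> x) = - (LBINT x. \<psi> x *\<^sub>R grad (\<phi> n) x)"
        by (rule test_functions_integration_by_parts[OF \<psi> \<phi>])
      \<comment> \<open>Pure vector algebra, stated for variables so that the integrals are treated
        as opaque terms.\<close>
      moreover have "Y + Z = - S - T" if "S = X - Y" "T = W - Z" "X = - W" for S T W X Y Z :: 'a
        using that by simp
      ultimately have "(LBINT x. f x *\<^sub>R grad \<psi> x) + (LBINT x. \<psi> x *\<^sub>R g x) =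
        - (LBINT x. (\<phi> n x - f x) *\<^sub>R grad \<psi> x) - (LBINT x. \<psi> x *\<^sub>R (grad (\<phi> n) x - g x))"
        by blast
      also have "norm \<dots> \<le> norm (LBINT x. (\<phi> n x - f x) *\<^sub>R grad \<psi> x) + norm (LBINT x. \<psi> x *\<^sub>R (grad (\<phi> n) x - g x))"
        using norm_triangle_ineq4[of "- (LBINT x. (\<phi> n x - f x) *\<^sub>R grad \<psi> x)"] by (simp only: norm_minus_cancel)
      also have "\<dots> \<le> \<bar>B'\<bar> / \<delta> * E n + \<bar>B\<bar> / \<delta> * \<Delta> n"
      proof (rule add_mono)
        have "\<bar>B'\<bar> / \<delta> * (\<integral>x. norm (\<phi> n x - f x) \<partial>law p) \<le> \<bar>B'\<bar> / \<delta> * E n"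
          using d1(2) \<delta>(1) by (intro mult_left_mono) (auto simp: E_def)
        then show "norm (LBINT x. (\<phi> n x - f x) *\<^sub>R grad \<psi> x) \<le> \<bar>B'\<bar> / \<delta> * E n"
          using scal(2)[OF m1 d1(1)] by linarith
        have "\<bar>B\<bar> / \<delta> * (\<integral>x. norm (grad (\<phi> n) x - g x) \<partial>law p) \<le> \<bar>B\<bar> / \<delta> * \<Delta> n"
          using d2(2) \<delta>(1) by (intro mult_left_mono) (auto simp: \<Delta>_def)
        then show "norm (LBINT x. \<psi> x *\<^sub>R (grad (\<phi> n) x - g x)) \<le> \<bar>B\<bar> / \<delta> * \<Delta> n"
          using vec(2)[OF m2 d2(1)] by linarith
      qed
      finally show ?thesis .
    qed
    moreover have "(\<lambda>n. \<bar>B'\<bar> / \<delta> * E n + \<bar>B\<bar> / \<delta> * \<Delta> n) \<longlonglongrightarrow> \<bar>B'\<bar> / \<delta> * 0 + \<bar>B\<bar> / \<delta> * 0"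
      unfolding E_def \<Delta>_def by (intro tendsto_intros \<phi>_f_limit grad_\<phi>_g_limit)
    ultimately have "norm ((LBINT x. f x *\<^sub>R grad \<psi> x) + (LBINT x. \<psi> x *\<^sub>R g x)) \<le> \<bar>B'\<bar> / \<delta> * 0 + \<bar>B\<bar> / \<delta> * 0"
      by (intro tendsto_lowerbound) auto
    then have "(LBINT x. f x *\<^sub>R grad \<psi> x) = - (LBINT x. \<psi> x *\<^sub>R g x)"
      by (simp add: eq_neg_iff_add_eq_0)
    then have eq: "(LBINT x. \<psi> x *\<^sub>R G x) = (LBINT x. \<psi> x *\<^sub>R g x)"
      using wg \<psi> by (auto simp: has_weak_gradient_on_def)
    have Gi: "integrable lborel (\<lambda>x. \<psi> x *\<^sub>R G x)"
    proof (rule Bochner_Integration.integrable_bound)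
      have GK': "integrable lborel (\<lambda>x. indicator K x *\<^sub>R G x)" using GK[OF K] by (simp add: set_integrable_def)
      then show "integrable lborel (\<lambda>x. B *\<^sub>R (indicator K x *\<^sub>R G x))" by (rule integrable_scaleR_right)
      have eqK: "\<psi> x *\<^sub>R G x = \<psi> x *\<^sub>R (indicator K x *\<^sub>R G x)" for x using \<psi>0[of x] by (auto simp: indicator_def)
      have [measurable]: "(\<lambda>x. indicator K x *\<^sub>R G x) \<in> borel_measurable lborel" using GK' by (rule borel_measurable_integrable)
      show "(\<lambda>x. \<psi> x *\<^sub>R G x) \<in> borel_measurable lborel" by (subst eqK) measurable
      show "AE x in lborel. norm (\<psi> x *\<^sub>R G x) \<le> norm (B *\<^sub>R (indicator K x *\<^sub>R G x))"
      proof (rule AE_I2)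
        fix x
        have "\<bar>\<psi> x\<bar> \<le> \<bar>B\<bar>" using B[of x] by simp
        then show "norm (\<psi> x *\<^sub>R G x) \<le> norm (B *\<^sub>R (indicator K x *\<^sub>R G x))"
          unfolding eqK norm_scaleR by (intro mult_right_mono) auto
      qed
    qed
    show "(LBINT x. \<psi> x *\<^sub>R (G x - g x)) = 0"
      unfolding scaleR_diff_right using eq Gi vec(1)[OF g_measurable gi] by simp
  qed
  then show ?thesis by simp
qed

end

section \<open>The Wasserstein bounds for the random variables\<close>

lemma wasserstein1_poincare:
  fixes p1 p2 \<pi>0 :: "'a::euclidean_space \<Rightarrow> real" and G :: "'a \<Rightarrow> 'a"
  assumes adm: "admissible_density p1"
    and p1: "integrable lborel p1"
    and p2: "integrable lborel p2" "\<And>x. 0 \<le> p2 x" "(LBINT x. p2 x) = 1" "\<And>x. p2 x = \<pi>0 x * p1 x"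
    and D1: "distributed M1 lborel X1 (\<lambda>x. ennreal (p1 x))" and D2: "distributed M2 lborel X2 (\<lambda>x. ennreal (p2 x))"
    and wg: "has_weak_gradient_on \<pi>0 G (Omega p1)" and G: "integrable M1 (\<lambda>\<omega>. norm (G (X1 \<omega>)))"
    and poi: "poincare_constant C p1" and W12: "\<pi>0 \<in> W12 p1"
  shows "wasserstein1 M1 X1 M2 X2 \<le> ennreal (C * sqrt (\<integral>\<omega>. (norm (G (X1 \<omega>)))\<^sup>2 \<partial>M1))"
proof -
  obtain \<phi> g where \<phi>: "\<And>n. \<phi> n \<in> test_functions UNIV"
    and m: "\<pi>0 \<in> borel_measurable borel" "g \<in> borel_measurable borel"
    and lim: "(\<lambda>n::nat. \<integral>\<^sup>+x. ennreal ((\<phi> n x - \<pi>0 x)\<^sup>2) \<partial>law p1) \<longlonglongrightarrow> 0"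
      "(\<lambda>n. \<integral>\<^sup>+x. ennreal ((norm (grad (\<phi> n) x - g x))\<^sup>2) \<partial>law p1) \<longlonglongrightarrow> 0"
    using W12 unfolding W12_def by blast
  interpret W12_approximation p1 C \<pi>0 g \<phi>
    by unfold_locales (use adm poi \<phi> m lim in \<open>auto simp: admissible_density_def\<close>)
  have distr: "distr M1 lborel X1 = law p1"
    using distributed_distr_eq_density[OF D1] by (simp add: law_def)
  have "AE x in law p1. G x = g x"
    unfolding law_def
  proof (subst AE_density)
    \<comment> \<open>Uniqueness holds on \<open>Omega p1\<close>, and outside it \<open>p1\<close>
      vanishes almost everywhere.\<close>
    show "AE x in lborel. 0 < ennreal (p1 x) \<longrightarrow> G x = g x"
      using weak_gradient_unique[OF wg] admissible_density_AE_Omega[OF adm] by eventually_elim auto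
  qed measurable
  then have AE: "AE \<omega> in M1. G (X1 \<omega>) = g (X1 \<omega>)"
    by (rule AE_distrD[OF distributed_measurable[OF D1], unfolded distr])
  have X1[measurable]: "X1 \<in> M1 \<rightarrow>\<^sub>M borel" using distributed_measurable[OF D1] by simp
  \<comment> \<open>\<open>G\<close> is controlled on compact subsets of \<open>Omega p1\<close>
    only, so measurability of its norm along \<open>X1\<close> is taken from the assumed
    integrability.\<close>
  have "(\<integral>\<omega>. (norm (G (X1 \<omega>)))\<^sup>2 \<partial>M1) = (\<integral>\<omega>. (norm (g (X1 \<omega>)))\<^sup>2 \<partial>M1)"
    using AE borel_measurable_integrable[OF G] by (intro integral_cong_AE) auto
  also have "\<dots> = (LBINT x. p1 x * (norm (g x))\<^sup>2)"
    using distributed_integral[OF D1, of "\<lambda>x. (norm (g x))\<^sup>2"] p_nonneg by simp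
  also have "\<dots> = (\<integral>x. (norm (g x))\<^sup>2 \<partial>law p1)" by (subst integral_law) auto
  finally have G2: "(\<integral>\<omega>. (norm (G (X1 \<omega>)))\<^sup>2 \<partial>M1) = (\<integral>x. (norm (g x))\<^sup>2 \<partial>law p1)" .
  have exp2: "expectation (\<lambda>x. h x * \<pi>0 x) = (LBINT x. h x * p2 x)" if [measurable]: "h \<in> borel_measurable borel" for h
    by (subst integral_law) (auto simp: p2(4) mult_ac)
  have "expectation \<pi>0 = 1" using exp2[of "\<lambda>_. 1"] p2(3) by simp
  note cov = lipschitz_covariance_bound[OF _ _ this]
  have "wasserstein1 M1 X1 M2 X2 \<le> ennreal (max C 0 * sqrt (\<integral>x. (norm (g x))\<^sup>2 \<partial>law p1))"
  proof (rule wasserstein1_le_bounded[OF p1 p_nonneg p2(1,2) D1 D2])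
    show "integrable lborel (\<lambda>x. norm x * p1 x)"
      using integrable_law_norm by (subst (asm) integrable_law) (auto simp: mult.commute)
    fix h :: "'a \<Rightarrow> real" and H assume h: "lip1 h" "\<And>x. \<bar>h x\<bar> \<le> H"
    have hm: "h \<in> borel_measurable borel" by (rule borel_measurable_continuous_onI[OF lip1_continuous[OF h(1)]])
    then have "expectation h = (LBINT x. h x * p1 x)" by (subst integral_law) (auto simp: mult.commute)
    then show "(LBINT x. h x * p2 x) - (LBINT x. h x * p1 x) \<le> max C 0 * sqrt (\<integral>x. (norm (g x))\<^sup>2 \<partial>law p1)"
      using cov[OF h] exp2[OF hm] by simp
  qed
  \<comment> \<open>For negative \<open>C\<close> both sides are 0, because \<open>ennreal\<close>
    sends negative reals to 0.\<close>
  also have "\<dots> = ennreal (C * sqrt (\<integral>x. (norm (g x))\<^sup>2 \<partial>law p1))"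
    by (cases "C \<ge> 0") (auto simp: max_def ennreal_neg mult_nonpos_nonneg)
  finally show ?thesis unfolding G2 .
qed

lemma admissible_density_integral:
  assumes "admissible_density p"
  shows "integrable lborel p" "(LBINT x. p x) = 1"
proof -
  have p: "p \<in> borel_measurable borel" "\<And>x. 0 \<le> p x" "(\<integral>\<^sup>+x. ennreal (p x) \<partial>lborel) = 1"
    using assms by (auto simp: admissible_density_def)
  show "integrable lborel p" using p by (intro integrableI_nonneg) auto
  show "(LBINT x. p x) = 1" using p by (simp add: integral_eq_nn_integral)
qed

theorem proposition4p1:
  fixes p1 p2 \<pi>0 :: "'a::euclidean_space \<Rightarrow> real" and G :: "'a \<Rightarrow> 'a"
    and M1 :: "'s measure" and X1 :: "'s \<Rightarrow> 'a"
    and M2 :: "'t measure" and X2 :: "'t \<Rightarrow> 'a"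
  assumes "admissible_density p1" and "admissible_density p2"
    and "\<And>x. p2 x = \<pi>0 x * p1 x"
    and "prob_space M1" and "distributed M1 lborel X1 (\<lambda>x. ennreal (p1 x))"
    and "prob_space M2" and "distributed M2 lborel X2 (\<lambda>x. ennreal (p2 x))"
    and "has_weak_gradient_on \<pi>0 G (Omega p1)"
    and "integrable M1 (\<lambda>\<omega>. norm (G (X1 \<omega>)))"
  shows "(\<forall>k>0. strongly_log_concave k p1 \<longrightarrow>
            wasserstein1 M1 X1 M2 X2 \<le> ennreal (1 / k * (\<integral>\<omega>. norm (G (X1 \<omega>)) \<partial>M1))) \<and>
         (\<forall>C. poincare_constant C p1 \<and> \<pi>0 \<in> W12 p1 \<longrightarrow>
            wasserstein1 M1 X1 M2 X2 \<le> ennreal (C * sqrt (\<integral>\<omega>. (norm (G (X1 \<omega>)))\<^sup>2 \<partial>M1)))"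
proof (intro conjI allI impI)
  have nn: "0 \<le> p1 x" "0 \<le> p2 x" for x
    using assms(1,2) by (auto simp: admissible_density_def)
  note p1 = admissible_density_integral[OF assms(1)] and p2 = admissible_density_integral[OF assms(2)]
  show "wasserstein1 M1 X1 M2 X2 \<le> ennreal (1 / k * (\<integral>\<omega>. norm (G (X1 \<omega>)) \<partial>M1))"
    if "k > 0" "strongly_log_concave k p1" for k
    by (rule wasserstein1_strongly_log_concave[OF p1(1) nn(1) p1(2) p2(1) nn(2) p2(2) assms(3,5,7,8,9) that])
  show "wasserstein1 M1 X1 M2 X2 \<le> ennreal (C * sqrt (\<integral>\<omega>. (norm (G (X1 \<omega>)))\<^sup>2 \<partial>M1))"
    if "poincare_constant C p1 \<and> \<pi>0 \<in> W12 p1" for C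
    using that by (intro wasserstein1_poincare[OF assms(1) p1(1) p2(1) nn(2) p2(2) assms(3,5,7,8,9)]) auto
qed

end
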